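(* Let $W:\mathcal{X}\to\mathcal{S}(\mathcal{H})$ be a classical-quantum channel with $\mathcal{X}$ finite and $\mathcal{H}$ finite-dimensional, and let $\lambda_1,\lambda_2\in(0,1)$ and $\epsilon>0$ satisfy $\epsilon<1-\lambda_1-\lambda_2$. Then \[ C_{\lambda_1,\lambda_2}(W)\le R_\epsilon(W). \] Consequently, for every $0<\epsilon<1$, $C(W)\le R_\epsilon(W)$.
   Context: $\mathcal{S}(\mathcal{H})$ is the set of density matrices on $\mathcal{H}$, $\mathcal{P}(\mathcal{X})$ the set of probability distributions; logarithms base 2. For $p\in\mathcal{P}(\mathcal{X})$, $W(p)=\sum_xp(x)W_x$, $I(X;B)_{W\times p}=\sum_xp(x)D(W_x\|W(p))$ with $D(\rho\|\sigma)=\mathrm{Tr}\,\rho(\log\rho-\log\sigma)$, and $C(W):=\sup_pI(X;B)_{W\times p}$. For $x^n\in\mathcal{X}^n$, $W^{\otimes n}_{x^n}=W_{x_1}\otimes\cdots\otimes W_{x_n}$; for a distribution $p^n$ on $\mathcal{X}^n$, $W^{\otimes n}(p^n)=\sum_{x^n}p^n(x^n)W^{\otimes n}_{x^n}$. $\mathcal{P}_M(\mathcal{X}^n)$ is the set of distributions $q$ on $\mathcal{X}^n$ with $Mq(x^n)\in\mathbb{Z}$ for all $x^n$; $\varepsilon(W^{\otimes n},M):=\sup_{p^n\in\mathcal{P}(\mathcal{X}^n)}\inf_{q^n\in\mathcal{P}_M(\mathcal{X}^n)}\frac12\|W^{\otimes n}(p^n)-W^{\otimes n}(q^n)\|_1$;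 $M_\epsilon(W^{\otimes n}):=\min\{M\in\mathbb{N}_+:\varepsilon(W^{\otimes n},M)\le\epsilon\}$ and $R_\epsilon(W):=\liminf_{n\to\infty}\frac1n\log M_\epsilon(W^{\otimes n})$. An $(n,N,\lambda_1,\lambda_2)$ identification code for $W$ is a family $(p_i,D_i)_{i=1}^N$ of distributions $p_i$ on $\mathcal{X}^n$ and operators $0\le D_i\le I$ on $\mathcal{H}^{\otimes n}$ such that $\mathrm{Tr}(W^{\otimes n}(p_i)D_i)\ge1-\lambda_1$ for all $i$ and $\mathrm{Tr}(W^{\otimes n}(p_i)D_j)\le\lambda_2$ for all $i\ne j$. $N(n,\lambda_1,\lambda_2)$ is the largest $N$ for which such a code exists, and the identification capacity is $C_{\lambda_1,\lambda_2}(W):=\liminf_{n\to\infty}\frac1n\log\log N(n,\lambda_1,\lambda_2)$. *)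

theory Defs
  imports "HOL-Analysis.Analysis" "Jordan_Normal_Form.Matrix" "HOL-Library.Extended_Nat"
begin

text \<open>The Hilbert space H is C^d; operators are d x d complex matrices (JNF type complex mat).\<close>

definition cadj :: "complex mat \<Rightarrow> complex mat" where
  "cadj A = mat (dim_col A) (dim_row A) (\<lambda>(i,j). cnj (A $$ (j,i)))"

definition mtrace :: "complex mat \<Rightarrow> complex" where
  "mtrace A = (\<Sum>i<dim_row A. A $$ (i,i))"

definition qform :: "complex mat \<Rightarrow> (nat \<Rightarrow> complex) \<Rightarrow> complex" where
  "qform A v = (\<Sum>i<dim_row A. \<Sum>j<dim_col A. cnj (v i) * A $$ (i,j) * v j)"

definition psd :: "nat \<Rightarrow> complex mat \<Rightarrow> bool" where
  "psd d A \<longleftrightarrow> A \<in> carrier_mat d d \<and> cadj A = A \<and> (\<forall>v. 0 \<le> Re (qform A v))"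

definition density :: "nat \<Rightarrow> complex mat \<Rightarrow> bool" where
  "density d \<rho> \<longleftrightarrow> psd d \<rho> \<and> mtrace \<rho> = 1"

definition unitary_mat :: "nat \<Rightarrow> complex mat \<Rightarrow> bool" where
  "unitary_mat d U \<longleftrightarrow> U \<in> carrier_mat d d \<and> cadj U * U = 1\<^sub>m d"

definition rdiag :: "nat \<Rightarrow> (nat \<Rightarrow> real) \<Rightarrow> complex mat" where
  "rdiag d l = mat d d (\<lambda>(i,j). if i = j then complex_of_real (l i) else 0)"

text \<open>Functional calculus f(A) for a Hermitian matrix A = U diag(l) U^*:
  f(A) = U diag(f l) U^* (independent of the chosen spectral decomposition).\<close>
definition mat_fun :: "(real \<Rightarrow> real) \<Rightarrow> complex mat \<Rightarrow> complex mat" where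
  "mat_fun f A = (SOME B. \<exists>U l. unitary_mat (dim_row A) U \<and>
        A = U * rdiag (dim_row A) l * cadj U \<and>
        B = U * rdiag (dim_row A) (\<lambda>i. f (l i)) * cadj U)"

definition trace_norm :: "complex mat \<Rightarrow> real" where
  "trace_norm A = Re (mtrace (mat_fun sqrt (cadj A * A)))"

text \<open>Relative entropy D(rho||sigma) = Tr rho (log rho - log sigma), logarithm base 2.
  Isabelle's log 2 0 = 0, so log is taken on the support; this is the standard value
  whenever supp rho is contained in supp sigma (the only case in which it is used below).\<close>
definition rel_entropy :: "complex mat \<Rightarrow> complex mat \<Rightarrow> real" where
  "rel_entropy \<rho> \<sigma> = Re (mtrace (\<rho> * (mat_fun (log 2) \<rho> - mat_fun (log 2) \<sigma>)))"

definition kron :: "complex mat \<Rightarrow> complex mat \<Rightarrow> complex mat" where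
  "kron A B = mat (dim_row A * dim_row B) (dim_col A * dim_col B)
     (\<lambda>(i,j). A $$ (i div dim_row B, j div dim_col B) * B $$ (i mod dim_row B, j mod dim_col B))"

definition tensor_list :: "complex mat list \<Rightarrow> complex mat" where
  "tensor_list As = foldr kron As (1\<^sub>m 1)"

definition is_dist :: "'a set \<Rightarrow> ('a \<Rightarrow> real) \<Rightarrow> bool" where
  "is_dist S p \<longleftrightarrow> (\<forall>x\<in>S. 0 \<le> p x) \<and> sum p S = 1"

definition is_Mdist :: "nat \<Rightarrow> 'a set \<Rightarrow> ('a \<Rightarrow> real) \<Rightarrow> bool" where
  "is_Mdist M S q \<longleftrightarrow> is_dist S q \<and> (\<forall>x\<in>S. real M * q x \<in> \<int>)"

definition mix :: "nat \<Rightarrow> 'a set \<Rightarrow> ('a \<Rightarrow> complex mat) \<Rightarrow> ('a \<Rightarrow> real) \<Rightarrow> complex mat" where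
  "mix d S V p = mat d d (\<lambda>ij. \<Sum>x\<in>S. complex_of_real (p x) * V x $$ ij)"

definition seqs :: "nat \<Rightarrow> 'x list set" where
  "seqs n = {xs. length xs = n}"

definition tpow :: "('x \<Rightarrow> complex mat) \<Rightarrow> 'x list \<Rightarrow> complex mat" where
  "tpow W xs = tensor_list (map W xs)"

definition tpow_mix :: "nat \<Rightarrow> ('x \<Rightarrow> complex mat) \<Rightarrow> nat \<Rightarrow> ('x list \<Rightarrow> real) \<Rightarrow> complex mat" where
  "tpow_mix d W n p = mix (d ^ n) (seqs n) (tpow W) p"

definition mutual_info :: "nat \<Rightarrow> ('x::finite \<Rightarrow> complex mat) \<Rightarrow> ('x \<Rightarrow> real) \<Rightarrow> real" where
  "mutual_info d W p = (\<Sum>x\<in>UNIV. p x * rel_entropy (W x) (mix d UNIV W p))"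

definition holevo_cap :: "nat \<Rightarrow> ('x::finite \<Rightarrow> complex mat) \<Rightarrow> ereal" where
  "holevo_cap d W = (SUP p\<in>{p. is_dist UNIV p}. ereal (mutual_info d W p))"

definition approx_err :: "nat \<Rightarrow> ('x \<Rightarrow> complex mat) \<Rightarrow> nat \<Rightarrow> nat \<Rightarrow> real" where
  "approx_err d W n M = (SUP p\<in>{p. is_dist (seqs n) p}.
      INF q\<in>{q. is_Mdist M (seqs n) q}.
        trace_norm (tpow_mix d W n p - tpow_mix d W n q) / 2)"

definition M_eps :: "nat \<Rightarrow> ('x \<Rightarrow> complex mat) \<Rightarrow> real \<Rightarrow> nat \<Rightarrow> nat" where
  "M_eps d W \<epsilon> n = (LEAST M. 0 < M \<and> approx_err d W n M \<le> \<epsilon>)"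

definition R_eps :: "nat \<Rightarrow> ('x \<Rightarrow> complex mat) \<Rightarrow> real \<Rightarrow> ereal" where
  "R_eps d W \<epsilon> = liminf (\<lambda>n. ereal (log 2 (real (M_eps d W \<epsilon> n)) / real n))"

definition is_id_code :: "nat \<Rightarrow> ('x \<Rightarrow> complex mat) \<Rightarrow> nat \<Rightarrow> nat \<Rightarrow> real \<Rightarrow> real
     \<Rightarrow> (nat \<Rightarrow> 'x list \<Rightarrow> real) \<Rightarrow> (nat \<Rightarrow> complex mat) \<Rightarrow> bool" where
  "is_id_code d W n N l1 l2 p D \<longleftrightarrow>
     (\<forall>i<N. is_dist (seqs n) (p i) \<and> psd (d ^ n) (D i) \<and> psd (d ^ n) (1\<^sub>m (d ^ n) - D i)
            \<and> Re (mtrace (tpow_mix d W n (p i) * D i)) \<ge> 1 - l1) \<and>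
     (\<forall>i<N. \<forall>j<N. i \<noteq> j \<longrightarrow> Re (mtrace (tpow_mix d W n (p i) * D j)) \<le> l2)"

definition N_id :: "nat \<Rightarrow> ('x \<Rightarrow> complex mat) \<Rightarrow> real \<Rightarrow> real \<Rightarrow> nat \<Rightarrow> enat" where
  "N_id d W l1 l2 n = Sup {enat N | N. \<exists>p D. is_id_code d W n N l1 l2 p D}"

definition id_cap :: "nat \<Rightarrow> ('x \<Rightarrow> complex mat) \<Rightarrow> real \<Rightarrow> real \<Rightarrow> ereal" where
  "id_cap d W l1 l2 = liminf (\<lambda>n. case N_id d W l1 l2 n of
        enat N \<Rightarrow> ereal (log 2 (log 2 (real N)) / real n)
      | \<infinity> \<Rightarrow> \<infinity>)"

end

theory Submission
  imports Defs "Jordan_Normal_Form.Schur_Decomposition" "HOL-Real_Asymp.Real_Asymp"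
begin

text \<open>The theorem splits as \<open>id_cap \<le> holevo_cap \<le> R_eps\<close>. (Passing from an identification code directly to
  its approximating types would only work for \<open>2 * \<epsilon> < 1 - lam1 - lam2\<close>.)

  For the first inequality let \<open>\<sigma>\<close> be a capacity-achieving output state, so that every letter has relative entropy
  at most \<open>C\<close> to \<open>\<sigma>\<close>. In the eigenbasis of \<open>\<sigma>\<close>, with eigenvalues \<open>b\<close>, truncate each eigenvector of a product
  output, with eigenvalue \<open>a\<close>, to the coordinates with \<open>a \<le> L b\<close>. By a Chernoff bound for the Nussbaum--Szkola
  distribution this changes little if \<open>L\<close> is slightly larger than \<open>2^(n C)\<close>, and the truncated outputs have norm at most
  \<open>sqrt (2 L)\<close> in a Hilbert space whose norm dominates the trace distance. Maurey's sampling argument then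
  approximates every output mixture by a mixture of slightly more than \<open>L\<close> outputs, up to an arbitrarily small error,
  and there are at most \<open>|X|^(n M)\<close> such mixtures.

  For the second inequality construct a code with \<open>K G\<close> words, where \<open>K\<close> is about \<open>2^(n I)\<close> and \<open>G\<close> is constant, from
  likelihood tests and sequential decoding. Each function \<open>f\<close> from \<open>{..<K}\<close> to \<open>{..<G}\<close> gives the uniform
  distribution on the codewords \<open>(k, f k)\<close>. A single type is within trace distance \<open>\<epsilon> < 1\<close> of only an
  \<open>exp (- K)\<close> fraction of them, so there are at least \<open>exp K\<close> types, whereas \<open>M\<close>-types number at most \<open>|X|^(n M)\<close>.\<close>

section \<open>Finite-dimensional Hilbert space in coordinates\<close>

text \<open>The obstacle in the first inequality is dimension: comparing the trace norm with a plain
  Hilbert-Schmidt norm costs powers of \<open>d ^ n\<close>, which would change the rate. The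
  Hilbert norm used is that of \<open>sigma^(-1/4) A sigma^(-1/4)\<close>. By Cauchy-Schwarz, Tr(A
  T) is at most this norm times that of \<open>sigma^(1/4) T sigma^(1/4)\<close>, and for an effect
  T the latter is at most 1 because sigma has trace one. A single sigma must serve all distributions
  of a code, hence the capacity-achieving output, for which every letter, and not just an average,
  has relative entropy at most C. In the second inequality one input p is fixed and W(p) itself is
  the reference. Going through C decouples the parameters: covering and decoding errors both tend to
  0, so one half asks for lam1 + lam2 < 1 and the other for \<epsilon> < 1. Functions into
  \<open>{..<G}\<close> are used because an \<epsilon> close to 1 is compensated by a larger
  constant G, at no cost in rate: a type close to the distribution of f must put a fixed fraction of
  its clipped output statistics on the graph of f, which a random graph receives with probability at
  most exp (- K).\<close>

text \<open>Vectors and operators on \<open>C^D\<close> are functions on \<open>nat\<close> of which only the entries below \<open>D\<close> matter;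
  \<open>e i k\<close> is the \<open>k\<close>-th coordinate of the \<open>i\<close>-th vector of a family \<open>e\<close>.\<close>

definition cin :: "nat \<Rightarrow> (nat \<Rightarrow> complex) \<Rightarrow> (nat \<Rightarrow> complex) \<Rightarrow> complex" where
  "cin D u v = (\<Sum>k<D. cnj (u k) * v k)"

definition nsq :: "nat \<Rightarrow> (nat \<Rightarrow> complex) \<Rightarrow> real" where
  "nsq D v = (\<Sum>k<D. (cmod (v k))\<^sup>2)"

definition ap :: "nat \<Rightarrow> (nat \<Rightarrow> nat \<Rightarrow> complex) \<Rightarrow> (nat \<Rightarrow> complex) \<Rightarrow> nat \<Rightarrow> complex" where
  "ap D A v = (\<lambda>k. \<Sum>k'<D. A k k' * v k')"

definition onb :: "nat \<Rightarrow> (nat \<Rightarrow> nat \<Rightarrow> complex) \<Rightarrow> bool" where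
  "onb D e \<longleftrightarrow> (\<forall>i<D. \<forall>j<D. cin D (e i) (e j) = (if i = j then 1 else 0))"

definition trp :: "nat \<Rightarrow> (nat \<Rightarrow> nat \<Rightarrow> complex) \<Rightarrow> (nat \<Rightarrow> nat \<Rightarrow> complex) \<Rightarrow> complex" where
  "trp D A B = (\<Sum>i<D. \<Sum>j<D. A i j * B j i)"

definition osum :: "nat \<Rightarrow> (nat \<Rightarrow> real) \<Rightarrow> (nat \<Rightarrow> nat \<Rightarrow> complex) \<Rightarrow> nat \<Rightarrow> nat \<Rightarrow> complex" where
  "osum D l e k k' = (\<Sum>i<D. of_real (l i) * e i k * cnj (e i k'))"

definition herm :: "nat \<Rightarrow> (nat \<Rightarrow> nat \<Rightarrow> complex) \<Rightarrow> bool" where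
  "herm D E \<longleftrightarrow> (\<forall>i<D. \<forall>j<D. E j i = cnj (E i j))"

definition effect :: "nat \<Rightarrow> (nat \<Rightarrow> nat \<Rightarrow> complex) \<Rightarrow> bool" where
  "effect D E \<longleftrightarrow> herm D E \<and>
     (\<forall>v. 0 \<le> Re (cin D v (ap D E v)) \<and> Re (cin D v (ap D E v)) \<le> nsq D v)"

lemma cnj_cin: "cnj (cin D u v) = cin D v u"
  by (simp add: cin_def mult.commute)

lemma cin_self: "cin D v v = of_real (nsq D v)"
  unfolding cin_def nsq_def of_real_sum
  by (rule sum.cong[OF refl]) (simp only: complex_norm_square mult.commute)

lemma Re_cin_self: "Re (cin D v v) = nsq D v"
  by (simp add: cin_self)

lemma nsq_nonneg [simp]: "0 \<le> nsq D v"
  by (simp add: nsq_def sum_nonneg)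

lemma nsq_eq_0: "nsq D v = 0 \<Longrightarrow> k < D \<Longrightarrow> v k = 0"
  unfolding nsq_def by (subst (asm) sum_nonneg_eq_0_iff) auto

lemma cin_diff_right: "cin D u (\<lambda>k. v k - w k) = cin D u v - cin D u w"
  by (simp add: cin_def right_diff_distrib sum_subtractf)

lemma cin_diff_left: "cin D (\<lambda>k. v k - w k) u = cin D v u - cin D w u"
  by (simp add: cin_def left_diff_distrib sum_subtractf)

lemma cin_scale_right: "cin D u (\<lambda>k. c * v k) = c * cin D u v"
  by (simp add: cin_def sum_distrib_left mult_ac)

lemma cin_scale_left: "cin D (\<lambda>k. c * u k) v = cnj c * cin D u v"
  by (simp add: cin_def sum_distrib_left mult_ac)

lemma cin_sum_right: "cin D u (\<lambda>k. \<Sum>i\<in>A. v i k) = (\<Sum>i\<in>A. cin D u (v i))"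
  unfolding cin_def sum_distrib_left by (rule sum.swap)

lemma cin_sum_left: "cin D (\<lambda>k. \<Sum>i\<in>A. v i k) u = (\<Sum>i\<in>A. cin D (v i) u)"
  unfolding cin_def cnj_sum sum_distrib_right by (rule sum.swap)

lemma cin_cong: "(\<And>k. k < D \<Longrightarrow> u k = u' k) \<Longrightarrow> (\<And>k. k < D \<Longrightarrow> v k = v' k) \<Longrightarrow> cin D u v = cin D u' v'"
  by (simp add: cin_def)

lemma nsq_cong: "(\<And>k. k < D \<Longrightarrow> u k = u' k) \<Longrightarrow> nsq D u = nsq D u'"
  by (simp add: nsq_def)

lemma nsq_scale: "nsq D (\<lambda>k. c * v k) = (cmod c)\<^sup>2 * nsq D v"
  by (simp add: nsq_def norm_mult power_mult_distrib sum_distrib_left)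

lemma cin_Cauchy_Schwarz: "(cmod (cin D u v))\<^sup>2 \<le> nsq D u * nsq D v"
proof -
  have "cmod (cin D u v) \<le> (\<Sum>k<D. cmod (u k) * cmod (v k))"
    unfolding cin_def by (rule order_trans[OF norm_sum]) (simp add: norm_mult)
  then have "(cmod (cin D u v))\<^sup>2 \<le> (\<Sum>k<D. cmod (u k) * cmod (v k))\<^sup>2"
    by (simp add: power_mono)
  also have "\<dots> \<le> nsq D u * nsq D v"
    unfolding nsq_def by (rule Cauchy_Schwarz_ineq_sum)
  finally show ?thesis .
qed

lemma cmod_cin_le: "cmod (cin D u v) \<le> sqrt (nsq D u) * sqrt (nsq D v)"
  using cin_Cauchy_Schwarz[of D u v] by (metis norm_ge_zero real_le_rsqrt real_sqrt_mult)

text \<open>Orthonormality says \<open>V * U = 1\<close> for square matrices; a left inverse is also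
  a right inverse, and the entries of \<open>U * V\<close> are the sums in question.\<close>

lemma onb_complete:
  assumes "onb D e" "k < D" "k' < D"
  shows "(\<Sum>i<D. e i k * cnj (e i k')) = (if k = k' then 1 else 0)"
proof -
  define U where "U = mat D D (\<lambda>(k,i). e i k)"
  define V where "V = mat D D (\<lambda>(i,k). cnj (e i k))"
  have c: "U \<in> carrier_mat D D" "V \<in> carrier_mat D D" by (auto simp: U_def V_def)
  have "V * U = 1\<^sub>m D"
    by (rule eq_matI) (use assms(1) in \<open>auto simp: U_def V_def scalar_prod_def onb_def cin_def atLeast0LessThan\<close>)
  then have "U * V = 1\<^sub>m D"
    using c by (metis mat_mult_left_right_inverse)
  then have "(U * V) $$ (k,k') = 1\<^sub>m D $$ (k,k')" by simp
  then show ?thesis using assms(2,3)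
    by (simp add: U_def V_def scalar_prod_def atLeast0LessThan)
qed

lemma onb_Parseval:
  assumes "onb D e"
  shows "(\<Sum>i<D. cin D u (e i) * cin D (e i) v) = cin D u v"
proof -
  have "(\<Sum>i<D. cin D u (e i) * cin D (e i) v) =
     (\<Sum>i<D. \<Sum>k<D. \<Sum>k'<D. cnj (u k) * v k' * (e i k * cnj (e i k')))"
    unfolding cin_def sum_product by (simp add: mult_ac)
  also have "\<dots> = (\<Sum>k<D. \<Sum>i<D. \<Sum>k'<D. cnj (u k) * v k' * (e i k * cnj (e i k')))"
    by (rule sum.swap)
  also have "\<dots> = (\<Sum>k<D. \<Sum>k'<D. \<Sum>i<D. cnj (u k) * v k' * (e i k * cnj (e i k')))"
    by (rule sum.cong[OF refl], rule sum.swap)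
  also have "\<dots> = (\<Sum>k<D. \<Sum>k'<D. cnj (u k) * v k' * (if k = k' then 1 else 0))"
    unfolding sum_distrib_left[symmetric] using onb_complete[OF assms] by simp
  also have "\<dots> = cin D u v" by (simp add: cin_def if_distrib[of "(*) _"] cong: if_cong)
  finally show ?thesis .
qed

lemma onb_Parseval_nsq:
  assumes "onb D e"
  shows "(\<Sum>i<D. (cmod (cin D (e i) v))\<^sup>2) = nsq D v"
proof -
  have "complex_of_real (\<Sum>i<D. (cmod (cin D (e i) v))\<^sup>2) = (\<Sum>i<D. cin D v (e i) * cin D (e i) v)"
    unfolding of_real_sum
    by (rule sum.cong[OF refl]) (simp only: complex_norm_square cnj_cin mult.commute)
  also have "\<dots> = complex_of_real (nsq D v)"
    using onb_Parseval[OF assms] by (simp add: cin_self)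
  finally show ?thesis using of_real_eq_iff by blast
qed

lemma nsq_onb: "onb D e \<Longrightarrow> i < D \<Longrightarrow> nsq D (e i) = 1"
  by (metis cin_self of_real_eq_1_iff onb_def)

lemma onb_entry_le:
  assumes "onb D e" "i < D" "k < D"
  shows "cmod (e i k) \<le> 1"
proof -
  have "(cmod (e i k))\<^sup>2 \<le> nsq D (e i)"
    unfolding nsq_def using assms(3) by (intro member_le_sum[of k]) auto
  then have "(cmod (e i k))\<^sup>2 \<le> 1\<^sup>2" using nsq_onb[OF assms(1,2)] by simp
  then show ?thesis by (rule power2_le_imp_le) simp
qed

text \<open>A dependent vector is replaced by zero and not discarded, so the indices of
  \<open>h\<close> and \<open>g\<close> stay aligned and both expansions are triangular.
  Triangularity is what the applications use: it preserves the invariant flag of a Schur form, and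
  it lets an ordering of \<open>g\<close> pass on to the supports of \<open>h\<close>.\<close>

lemma Gram_Schmidt:
  fixes g :: "nat \<Rightarrow> nat \<Rightarrow> complex"
  shows "\<exists>h c. (\<forall>i<m. nsq D (h i) = 1 \<or> h i = (\<lambda>k. 0)) \<and>
     (\<forall>i<m. \<forall>j<m. i \<noteq> j \<longrightarrow> cin D (h i) (h j) = 0) \<and>
     (\<forall>i<m. \<forall>k. h i k = (\<Sum>j\<le>i. c i j * g j k)) \<and>
     (\<forall>i<m. \<forall>k<D. g i k = (\<Sum>j\<le>i. cin D (h j) (g i) * h j k))"
proof (induction m)
  case 0
  show ?case by simp
next
  case (Suc m)
  then obtain h c where H: "\<forall>i<m. nsq D (h i) = 1 \<or> h i = (\<lambda>k. 0)"
    "\<forall>i<m. \<forall>j<m. i \<noteq> j \<longrightarrow> cin D (h i) (h j) = 0"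
    "\<forall>i<m. \<forall>k. h i k = (\<Sum>j\<le>i. c i j * g j k)"
    "\<forall>i<m. \<forall>k<D. g i k = (\<Sum>j\<le>i. cin D (h j) (g i) * h j k)"
    by (elim exE conjE) (rule that)
  note h1 = H(1)[rule_format] and h2 = H(2)[rule_format]
    and h3 = H(3)[rule_format] and h4 = H(4)[rule_format]
  define r where "r = (\<lambda>k. g m k - (\<Sum>j<m. cin D (h j) (g m) * h j k))"
  have r_orth: "cin D (h i) r = 0" if i: "i < m" for i
  proof -
    have "cin D (h i) r = cin D (h i) (g m) - (\<Sum>j<m. cin D (h j) (g m) * cin D (h i) (h j))"
      unfolding r_def cin_diff_right cin_sum_right cin_scale_right ..
    also have "(\<Sum>j<m. cin D (h j) (g m) * cin D (h i) (h j)) = cin D (h i) (g m) * cin D (h i) (h i)"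
      using i h2 by (subst sum.remove[of _ i]) auto
    also have "\<dots> = cin D (h i) (g m)"
      using h1[OF i] by (auto simp: cin_self) (simp add: cin_def)
    finally show ?thesis by simp
  qed
  \<comment> \<open>If \<open>r\<close> vanishes below D, the factor 0 makes \<open>hm\<close> the
    zero function everywhere, not only below D.\<close>
  define z where "z = (if nsq D r = 0 then 0 else complex_of_real (1 / sqrt (nsq D r)))"
  define hm where "hm = (\<lambda>k. z * r k)"
  have cin_hm_g: "cin D hm (g m) * hm k = r k" if k: "k < D" for k
  proof (cases "nsq D r = 0")
    case True
    then show ?thesis using nsq_eq_0[OF True k] by (simp add: hm_def)
  next
    case False
    then have pos: "nsq D r > 0" using nsq_nonneg[of D r] by linarith
    \<comment> \<open>Since \<open>r\<close> is orthogonal to the earlier \<open>h j\<close>,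
      pairing it with itself or with \<open>g m\<close> gives the same number.\<close>
    have "cin D r r = cin D r (g m) - (\<Sum>j<m. cin D (h j) (g m) * cin D r (h j))"
      by (subst (2) r_def) (simp only: cin_diff_right cin_sum_right cin_scale_right)
    also have "(\<Sum>j<m. cin D (h j) (g m) * cin D r (h j)) = 0"
      using r_orth by (intro sum.neutral) (metis cnj_cin complex_cnj_zero lessThan_iff mult_zero_right)
    finally have "cin D r (g m) = of_real (nsq D r)" by (simp add: cin_self)
    then have "cin D hm (g m) = of_real (nsq D r / sqrt (nsq D r))"
      using False by (simp only: hm_def z_def cin_scale_left if_False complex_cnj_complex_of_real
        flip: of_real_mult) simp
    moreover have "hm k = of_real (1 / sqrt (nsq D r)) * r k"
      using False by (simp add: hm_def z_def)
    ultimately have "cin D hm (g m) * hm k = of_real (nsq D r / sqrt (nsq D r) * (1 / sqrt (nsq D r))) * r k"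
      by (simp only: of_real_mult mult.assoc)
    also have "nsq D r / sqrt (nsq D r) * (1 / sqrt (nsq D r)) = 1"
      using pos by (simp add: field_simps)
    finally show ?thesis by simp
  qed
  have nsq_hm: "nsq D hm = 1 \<or> hm = (\<lambda>k. 0)"
    by (auto simp: hm_def z_def nsq_scale norm_divide power_divide)
  \<comment> \<open>The coefficients come from inserting the expansions of the earlier
    \<open>h i\<close> into \<open>r\<close> and exchanging the triangular double sum.\<close>
  define cm where "cm = (\<lambda>j. if j = m then z else - z * (\<Sum>i\<in>{j..<m}. cin D (h i) (g m) * c i j))"
  have hm_span: "hm k = (\<Sum>j\<le>m. cm j * g j k)" for k
  proof -
    have "(\<Sum>i<m. cin D (h i) (g m) * h i k) = (\<Sum>i<m. \<Sum>j\<le>i. cin D (h i) (g m) * c i j * g j k)"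
      by (rule sum.cong) (auto simp: h3 sum_distrib_left mult_ac)
    also have "\<dots> = (\<Sum>j<m. \<Sum>i\<in>{j..<m}. cin D (h i) (g m) * c i j * g j k)"
      unfolding sum.Sigma[OF finite_lessThan, OF ballI, OF finite_atMost] 
        sum.Sigma[OF finite_lessThan, OF ballI, OF finite_atLeastLessThan]
      by (rule sum.reindex_bij_witness[of _ "\<lambda>(a,b). (b,a)" "\<lambda>(a,b). (b,a)"]) auto
    finally have *: "(\<Sum>i<m. cin D (h i) (g m) * h i k) = (\<Sum>j<m. \<Sum>i\<in>{j..<m}. cin D (h i) (g m) * c i j * g j k)" .
    have "(\<Sum>j\<le>m. cm j * g j k) = z * g m k + (\<Sum>j<m. cm j * g j k)"
      by (simp add: lessThan_Suc_atMost[symmetric] cm_def)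
    also have "(\<Sum>j<m. cm j * g j k) = - z * (\<Sum>j<m. \<Sum>i\<in>{j..<m}. cin D (h i) (g m) * c i j * g j k)"
      unfolding sum_distrib_left
      by (rule sum.cong) (auto simp: cm_def sum_distrib_left sum_distrib_right mult_ac sum_negf)
    finally show ?thesis unfolding hm_def r_def * by (simp add: algebra_simps)
  qed
  define h' where "h' = h(m := hm)"
  define c' where "c' = c(m := cm)"
  have 1: "(\<forall>i<Suc m. nsq D (h' i) = 1 \<or> h' i = (\<lambda>k. 0))"
    using h1 nsq_hm by (auto simp: h'_def less_Suc_eq)
  have 2: "cin D (h' i) (h' j) = 0" if "i < Suc m" "j < Suc m" "i \<noteq> j" for i j
  proof -
    have a: "cin D (h i) hm = 0" if "i < m" for i using r_orth[OF that] by (simp add: hm_def cin_scale_right)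
    then have "cin D hm (h i) = 0" if "i < m" for i using that by (metis cnj_cin complex_cnj_zero)
    then show ?thesis using a that h2 by (auto simp: h'_def less_Suc_eq)
  qed
  have 3: "h' i k = (\<Sum>j\<le>i. c' i j * g j k)" if "i < Suc m" for i k
    using that h3 hm_span by (auto simp: h'_def c'_def less_Suc_eq)
  have 4: "g i k = (\<Sum>j\<le>i. cin D (h' j) (g i) * h' j k)" if "i < Suc m" "k < D" for i k
  proof (cases "i = m")
    case True
    have "(\<Sum>j\<le>m. cin D (h' j) (g m) * h' j k) = cin D hm (g m) * hm k + (\<Sum>j<m. cin D (h j) (g m) * h j k)"
      by (simp add: lessThan_Suc_atMost[symmetric] h'_def)
    then show ?thesis using True cin_hm_g[OF that(2)] by (simp add: r_def)
  next
    case False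
    then have "i < m" using that by simp
    then show ?thesis using h4[of i k] that by (simp add: h'_def)
  qed
  show ?case
  proof (rule exI[of _ h'], rule exI[of _ c'], intro conjI allI impI)
    show "nsq D (h' i) = 1 \<or> h' i = (\<lambda>k. 0)" if "i < Suc m" for i using 1 that by blast
  qed (rule 2 3 4; assumption)+
qed


section \<open>Hermitian operators and the spectral theorem\<close>

lemma ap_sum: "ap D A (\<lambda>k. \<Sum>i\<in>I. v i k) k = (\<Sum>i\<in>I. ap D A (v i) k)"
  unfolding ap_def sum_distrib_left by (rule sum.swap)

lemma ap_scale: "ap D A (\<lambda>k. c * v k) k = c * ap D A v k"
  by (simp add: ap_def sum_distrib_left mult_ac)

lemma ap_diff: "ap D A (\<lambda>k. v k - w k) k = ap D A v k - ap D A w k"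
  by (simp add: ap_def right_diff_distrib sum_subtractf)

lemma ap_cong: "(\<And>k. k < D \<Longrightarrow> v k = w k) \<Longrightarrow> ap D A v = ap D A w"
  by (simp add: ap_def)

lemma cin_ap: "cin D u (ap D A v) = (\<Sum>k<D. \<Sum>k'<D. cnj (u k) * A k k' * v k')"
  by (simp add: cin_def ap_def sum_distrib_left mult_ac)

lemma hermD: "herm D E \<Longrightarrow> i < D \<Longrightarrow> j < D \<Longrightarrow> cnj (E i j) = E j i"
  unfolding herm_def by (drule spec[of _ i], drule mp, assumption, drule spec[of _ j]) simp

lemma herm_cin_ap:
  assumes "herm D E"
  shows "cin D (ap D E u) v = cin D u (ap D E v)"
proof -
  have "cin D (ap D E u) v = (\<Sum>k<D. \<Sum>k'<D. cnj (E k k') * cnj (u k') * v k)"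
    by (simp add: cin_def ap_def sum_distrib_right sum_distrib_left mult_ac)
  also have "\<dots> = (\<Sum>k'<D. \<Sum>k<D. cnj (E k k') * cnj (u k') * v k)"
    by (rule sum.swap)
  also have "\<dots> = cin D u (ap D E v)"
    unfolding cin_ap by (intro sum.cong refl) (simp add: hermD[OF assms] mult_ac)
  finally show ?thesis .
qed

lemma herm_cnj_cin_ap: "herm D E \<Longrightarrow> cnj (cin D u (ap D E v)) = cin D v (ap D E u)"
  using herm_cin_ap[of D E v u] by (simp add: cnj_cin)

lemma cin_delta_left: "k < D \<Longrightarrow> cin D (\<lambda>j. if j = k then 1 else 0) v = v k"
  by (simp add: cin_def if_distrib[of cnj] if_distrib[of "\<lambda>x. x * _"] cong: if_cong)

lemma cin_delta_right: "k < D \<Longrightarrow> cin D v (\<lambda>j. if j = k then 1 else 0) = cnj (v k)"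
  by (simp add: cin_def if_distrib[of "(*) _"] cong: if_cong)

lemma ap_delta: "k < D \<Longrightarrow> ap D A (\<lambda>j. if j = k then 1 else 0) i = A i k"
  by (simp add: ap_def if_distrib[of "(*) _"] cong: if_cong)

text \<open>In a Schur form \<open>A P = P B\<close> the spans of the first columns of
  \<open>P\<close> are invariant under A. Gram-Schmidt preserves these spans, so A is upper
  triangular in the orthonormal basis \<open>h\<close>, and a Hermitian triangular matrix is
  diagonal with real entries.\<close>

theorem spectral_decomposition:
  assumes A: "herm D A"
  obtains e l where "onb D e" "\<And>k k'. k < D \<Longrightarrow> k' < D \<Longrightarrow> A k k' = osum D l e k k'"
proof -
  define Am where "Am = mat D D (\<lambda>(i,j). A i j)"
  have Am: "Am \<in> carrier_mat D D" by (simp add: Am_def)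
  from char_poly_factorized[OF Am] obtain as where as: "char_poly Am = (\<Prod>a\<leftarrow>as. [:- a, 1:])" by auto
  obtain B P Q where bpq: "schur_decomposition Am as = (B,P,Q)" by (cases "schur_decomposition Am as") auto
  from schur_decomposition[OF Am as bpq] have sim: "similar_mat_wit Am B P Q" and up: "upper_triangular B" by auto
  from sim Am have c: "B \<in> carrier_mat D D" "P \<in> carrier_mat D D" "Q \<in> carrier_mat D D"
    and QP: "Q * P = 1\<^sub>m D" and eq: "Am = P * B * Q"
    by (auto simp: similar_mat_wit_def Let_def)
  have AP: "Am * P = P * B"
    using c QP unfolding eq by (simp add: assoc_mult_mat[of _ D D _ D _ D])
  define p where "p = (\<lambda>j k. P $$ (k,j))"
  \<comment> \<open>The rows of \<open>Q\<close> are the functionals dual to the columns of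
    \<open>P\<close>; they certify that the columns are independent.\<close>
  define qf where "qf = (\<lambda>i v. \<Sum>k<D. Q $$ (i,k) * v k)"
  have qf_p: "qf i (p j) = (if i = j then 1 else 0)" if "i < D" "j < D" for i j
  proof -
    have "(Q * P) $$ (i,j) = (if i = j then 1 else 0)" using that by (simp add: QP)
    then show ?thesis using c that by (simp add: qf_def p_def scalar_prod_def atLeast0LessThan)
  qed
  have qf_sum: "qf i (\<lambda>k. \<Sum>j\<in>J. x j * v j k) = (\<Sum>j\<in>J. x j * qf i (v j))" for i J x v
    unfolding qf_def sum_distrib_left by (subst sum.swap) (simp add: mult_ac)
  have A_p: "ap D A (p j) k = (\<Sum>l\<le>j. B $$ (l,j) * p l k)" if "j < D" "k < D" for j k
  proof -
    have "(Am * P) $$ (k,j) = (P * B) $$ (k,j)" by (simp add: AP)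
    then have "ap D A (p j) k = (\<Sum>l<D. B $$ (l,j) * p l k)"
      using c Am that by (simp add: ap_def p_def Am_def scalar_prod_def atLeast0LessThan mult.commute)
    also have "\<dots> = (\<Sum>l\<le>j. B $$ (l,j) * p l k)"
      using that up c by (intro sum.mono_neutral_right) (auto simp: upper_triangular_def)
    finally show ?thesis .
  qed
  from Gram_Schmidt[of D D p] obtain h cc where H: "\<forall>i<D. nsq D (h i) = 1 \<or> h i = (\<lambda>k. 0)"
    "\<forall>i<D. \<forall>j<D. i \<noteq> j \<longrightarrow> cin D (h i) (h j) = 0"
    "\<forall>i<D. \<forall>k. h i k = (\<Sum>j\<le>i. cc i j * p j k)"
    "\<forall>i<D. \<forall>k<D. p i k = (\<Sum>j\<le>i. cin D (h j) (p i) * h j k)"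
    by (elim exE conjE) (rule that)
  \<comment> \<open>If \<open>h i\<close> were zero, \<open>p i\<close> would lie in the span of the
    earlier columns, where \<open>qf i\<close> vanishes; but \<open>qf i (p i) = 1\<close>.\<close>
  have hn: "nsq D (h i) = 1" if i: "i < D" for i
  proof (rule ccontr)
    assume "nsq D (h i) \<noteq> 1"
    then have h0: "h i = (\<lambda>k. 0)" using H(1) i by blast
    have "qf i (p i) = qf i (\<lambda>k. \<Sum>j\<le>i. cin D (h j) (p i) * h j k)"
      unfolding qf_def using H(4) i by simp
    also have "\<dots> = (\<Sum>j\<le>i. cin D (h j) (p i) * qf i (h j))" by (rule qf_sum)
    also have "\<dots> = 0"
    proof (rule sum.neutral, safe)
      fix j assume "j \<le> i"
      show "cin D (h j) (p i) * qf i (h j) = 0"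
      proof (cases "j = i")
        case True then show ?thesis using h0 by (simp add: qf_def)
      next
        case False
        then have j: "j < i" using \<open>j \<le> i\<close> by simp
        have "h j = (\<lambda>k. \<Sum>l\<le>j. cc j l * p l k)" using H(3) j i by (intro ext) auto
        then have "qf i (h j) = (\<Sum>l\<le>j. cc j l * qf i (p l))" using qf_sum by simp
        also have "\<dots> = 0" using j i by (intro sum.neutral) (auto simp: qf_p)
        finally show ?thesis by simp
      qed
    qed
    finally show False using qf_p[OF i i] by simp
  qed
  have onb: "onb D h" unfolding onb_def using H(2) hn by (auto simp: cin_self)
  have hp: "cin D (h j) (p l) = 0" if "l < j" "j < D" for j l
  proof -
    have "cin D (h j) (p l) = cin D (h j) (\<lambda>k. \<Sum>r\<le>l. cin D (h r) (p l) * h r k)"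
      by (rule cin_cong) (use H(4) that in auto)
    also have "\<dots> = (\<Sum>r\<le>l. cin D (h r) (p l) * cin D (h j) (h r))"
      by (simp only: cin_sum_right cin_scale_right)
    also have "\<dots> = 0" using that H(2) by (intro sum.neutral) auto
    finally show ?thesis .
  qed
  have low: "cin D (h j) (ap D A (h i)) = 0" if "i < j" "j < D" for i j
  proof -
    have hi: "h i = (\<lambda>k. \<Sum>l\<le>i. cc i l * p l k)" using H(3) that by (intro ext) auto
    have "ap D A (h i) k = (\<Sum>l\<le>i. cc i l * (\<Sum>r\<le>l. B $$ (r,l) * p r k))" if "k < D" for k
      unfolding hi ap_sum ap_scale using A_p \<open>i < j\<close> \<open>j < D\<close> that by (intro sum.cong) auto
    then have "cin D (h j) (ap D A (h i)) = cin D (h j) (\<lambda>k. \<Sum>l\<le>i. cc i l * (\<Sum>r\<le>l. B $$ (r,l) * p r k))"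
      by (intro cin_cong) auto
    also have "\<dots> = (\<Sum>l\<le>i. cc i l * (\<Sum>r\<le>l. B $$ (r,l) * cin D (h j) (p r)))"
      by (simp only: cin_sum_right cin_scale_right)
    also have "\<dots> = 0" using that hp by (intro sum.neutral ballI) auto
    finally show ?thesis .
  qed
  \<comment> \<open>One of the two mirror entries is zero by triangularity, and the other is its
    conjugate.\<close>
  have diag: "cin D (h j) (ap D A (h i)) = 0" if "i \<noteq> j" "i < D" "j < D" for i j
    using low[of i j] low[of j i] that herm_cnj_cin_ap[OF A, of "h i" "h j"]
    by (metis complex_cnj_zero linorder_neqE_nat)
  define l where "l = (\<lambda>i. Re (cin D (h i) (ap D A (h i))))"
  have lr: "cin D (h i) (ap D A (h i)) = of_real (l i)" for i
    using herm_cnj_cin_ap[OF A, of "h i" "h i"] unfolding l_def by (metis Reals_cnj_iff of_real_Re)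
  have hA: "cin D (h i) (ap D A v) = of_real (l i) * cin D (h i) v" if i: "i < D" for i v
  proof -
    have "cin D v (ap D A (h i)) = (\<Sum>j<D. cin D v (h j) * cin D (h j) (ap D A (h i)))"
      using onb_Parseval[OF onb] by simp
    also have "\<dots> = cin D v (h i) * of_real (l i)"
      using i diag lr by (subst sum.remove[of _ i]) auto
    finally have "cnj (cin D v (ap D A (h i))) = cnj (cin D v (h i) * of_real (l i))" by simp
    then show ?thesis by (simp add: herm_cin_ap[OF A] cnj_cin mult.commute)
  qed
  have "A k k' = osum D l h k k'" if kk: "k < D" "k' < D" for k k'
  proof -
    let ?\<delta> = "\<lambda>k (j::nat). if j = k then 1 else 0 :: complex"
    have "A k k' = cin D (?\<delta> k) (ap D A (?\<delta> k'))"
      using kk by (simp add: cin_delta_left ap_delta)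
    also have "\<dots> = (\<Sum>i<D. cin D (?\<delta> k) (h i) * cin D (h i) (ap D A (?\<delta> k')))"
      using onb_Parseval[OF onb] by simp
    also have "\<dots> = osum D l h k k'"
      unfolding osum_def using kk
      by (intro sum.cong refl) (simp add: hA cin_delta_left cin_delta_right)
    finally show ?thesis .
  qed
  with onb show ?thesis by (rule that)
qed

lemma trp_osum: "trp D (osum D l e) T = (\<Sum>i<D. of_real (l i) * cin D (e i) (ap D T (e i)))"
proof -
  have "trp D (osum D l e) T = (\<Sum>k<D. \<Sum>k'<D. \<Sum>i<D. of_real (l i) * (cnj (e i k') * T k' k * e i k))"
    unfolding trp_def osum_def sum_distrib_right by (simp add: mult_ac)
  also have "\<dots> = (\<Sum>k<D. \<Sum>i<D. \<Sum>k'<D. of_real (l i) * (cnj (e i k') * T k' k * e i k))"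
    by (rule sum.cong[OF refl], rule sum.swap)
  also have "\<dots> = (\<Sum>i<D. \<Sum>k<D. \<Sum>k'<D. of_real (l i) * (cnj (e i k') * T k' k * e i k))"
    by (rule sum.swap)
  also have "\<dots> = (\<Sum>i<D. \<Sum>k'<D. \<Sum>k<D. of_real (l i) * (cnj (e i k') * T k' k * e i k))"
    by (rule sum.cong[OF refl], rule sum.swap)
  finally show ?thesis by (simp only: cin_ap sum_distrib_left)
qed

lemma trp_cong:
  assumes "\<And>i j. i < D \<Longrightarrow> j < D \<Longrightarrow> A i j = A' i j" "\<And>i j. i < D \<Longrightarrow> j < D \<Longrightarrow> B i j = B' i j"
  shows "trp D A B = trp D A' B'"
  unfolding trp_def using assms by (intro sum.cong refl) auto

lemma cin_ap_osum:
  "cin D u (ap D (osum D l e) v) = (\<Sum>i<D. of_real (l i) * cin D u (e i) * cin D (e i) v)"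
proof -
  have "ap D (osum D l e) v k = (\<Sum>i<D. of_real (l i) * cin D (e i) v * e i k)" for k
    unfolding ap_def osum_def sum_distrib_right cin_def sum_distrib_left
    by (subst sum.swap) (simp add: mult_ac)
  then have "ap D (osum D l e) v = (\<lambda>k. \<Sum>i<D. of_real (l i) * cin D (e i) v * e i k)" by auto
  then show ?thesis by (simp only: cin_sum_right cin_scale_right) (simp add: mult_ac)
qed

lemma osum_herm: "herm D (osum D l e)"
  by (simp add: herm_def osum_def mult_ac)

subsection \<open>Effects\<close>

lemma effect_herm: "effect D E \<Longrightarrow> herm D E"
  by (simp add: effect_def)

text \<open>This is \<open>E^2 \<le> E\<close>. Positivity of E on the vector (1 - E) v gives
  \<open>E - 2 E^2 + E^3 \<ge> 0\<close>, and \<open>E^3 \<le> E^2\<close> is the bound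
  \<open>E \<le> 1\<close> on the vector E v.\<close>

lemma effect_square_le:
  assumes "effect D E"
  shows "nsq D (ap D E v) \<le> Re (cin D v (ap D E v))"
proof -
  let ?w = "ap D E v"
  note H = effect_herm[OF assms]
  have "0 \<le> Re (cin D (\<lambda>k. v k - ?w k) (ap D E (\<lambda>k. v k - ?w k)))"
    using assms by (simp add: effect_def)
  also have "ap D E (\<lambda>k. v k - ?w k) = (\<lambda>k. ?w k - ap D E ?w k)" by (intro ext ap_diff)
  also have "Re (cin D (\<lambda>k. v k - ?w k) (\<lambda>k. ?w k - ap D E ?w k)) =
     Re (cin D v ?w) - 2 * nsq D ?w + Re (cin D ?w (ap D E ?w))"
    using herm_cin_ap[OF H, of v ?w]
    by (simp add: cin_diff_left cin_diff_right Re_cin_self flip: herm_cin_ap[OF H, of v ?w])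
  also have "Re (cin D ?w (ap D E ?w)) \<le> nsq D ?w"
    using assms by (simp add: effect_def)
  finally show ?thesis by simp
qed

lemma effect_contraction: "effect D E \<Longrightarrow> nsq D (ap D E v) \<le> nsq D v"
  by (rule order_trans[OF effect_square_le]) (simp_all add: effect_def)

lemma effect_cin_le:
  assumes "effect D E"
  shows "cmod (cin D u (ap D E v)) \<le> sqrt (nsq D u) * sqrt (nsq D v)"
  by (intro order_trans[OF cmod_cin_le] mult_left_mono real_sqrt_le_mono effect_contraction[OF assms]) simp

lemma effect_column_le:
  assumes "effect D E" "k < D"
  shows "(\<Sum>i<D. (cmod (E i k))\<^sup>2) \<le> 1"
proof -
  let ?\<delta> = "\<lambda>(j::nat). if j = k then 1 else 0 :: complex"
  have "(\<Sum>i<D. (cmod (E i k))\<^sup>2) = nsq D (ap D E ?\<delta>)"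
    using assms(2) by (simp add: nsq_def ap_delta)
  also have "\<dots> \<le> nsq D ?\<delta>" by (rule effect_contraction[OF assms(1)])
  also have "\<dots> = 1" using assms(2) by (simp add: nsq_def if_distrib[of cmod] if_distrib[of "\<lambda>x. x\<^sup>2"] cong: if_cong)
  finally show ?thesis .
qed

text \<open>\<open>(2 E - 1)^2 = 1 - 4 (E - E^2)\<close>, where the bracket is nonnegative. Working
  with \<open>2 E - 1\<close> instead of E is what yields the factor 1/2 in the trace
  distance.\<close>

lemma effect_refl_contraction:
  assumes "effect D E"
  shows "nsq D (\<lambda>k. 2 * ap D E v k - v k) \<le> nsq D v"
proof -
  let ?w = "ap D E v"
  have "nsq D (\<lambda>k. 2 * ?w k - v k) = Re (cin D (\<lambda>k. 2 * ?w k - v k) (\<lambda>k. 2 * ?w k - v k))"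
    by (simp add: Re_cin_self)
  also have "\<dots> = 4 * nsq D ?w - 2 * Re (cin D ?w v) - 2 * Re (cin D v ?w) + nsq D v"
    by (simp add: cin_diff_left cin_diff_right cin_scale_left cin_scale_right cin_self)
  also have "Re (cin D ?w v) = Re (cin D v ?w)"
    using cnj_cin[of D ?w v] by (metis cnj.simps(1))
  finally show ?thesis using effect_square_le[OF assms, of v] by simp
qed

text \<open>The matrix of \<open>A\<close> with respect to the basis \<open>f\<close>.\<close>

definition cj :: "nat \<Rightarrow> (nat \<Rightarrow> nat \<Rightarrow> complex) \<Rightarrow> (nat \<Rightarrow> nat \<Rightarrow> complex) \<Rightarrow> nat \<Rightarrow> nat \<Rightarrow> complex" where
  "cj D f A k k' = cin D (f k) (ap D A (f k'))"

lemma cj_herm: "herm D A \<Longrightarrow> herm D (cj D f A)"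
  by (simp add: herm_def[of D "cj D f A"] cj_def herm_cnj_cin_ap)

lemma cin_ap_cj:
  "cin D u (ap D (cj D f A) v) = cin D (\<lambda>j. \<Sum>k<D. u k * f k j) (ap D A (\<lambda>j. \<Sum>k<D. v k * f k j))"
proof -
  have "ap D A (\<lambda>j. \<Sum>k<D. v k * f k j) = (\<lambda>j. \<Sum>k<D. v k * ap D A (f k) j)"
    by (intro ext) (simp only: ap_sum ap_scale)
  then have "cin D (\<lambda>j. \<Sum>k<D. u k * f k j) (ap D A (\<lambda>j. \<Sum>k<D. v k * f k j))
     = (\<Sum>k<D. cnj (u k) * (\<Sum>k'<D. v k' * cin D (f k) (ap D A (f k'))))"
    by (simp only: cin_sum_left cin_sum_right cin_scale_left cin_scale_right sum_distrib_left)
  then show ?thesis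
    by (simp only: cin_ap[of D u] cj_def sum_distrib_left mult_ac)
qed

lemma onb_nsq_sum:
  assumes "onb D f"
  shows "nsq D (\<lambda>j. \<Sum>k<D. v k * f k j) = nsq D v"
proof -
  have "cin D (\<lambda>j. \<Sum>k<D. v k * f k j) (\<lambda>j. \<Sum>k<D. v k * f k j)
     = (\<Sum>k<D. \<Sum>k'<D. cnj (v k) * v k' * cin D (f k) (f k'))"
    by (simp only: cin_sum_left cin_sum_right cin_scale_left cin_scale_right sum_distrib_left mult.assoc)
  also have "\<dots> = (\<Sum>k<D. \<Sum>k'<D. if k = k' then cnj (v k) * v k' else 0)"
    using assms by (intro sum.cong refl) (auto simp: onb_def)
  also have "\<dots> = cin D v v" by (simp add: cin_def)
  finally show ?thesis by (simp add: cin_self)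
qed

lemma effect_cj:
  assumes "onb D f" "effect D E"
  shows "effect D (cj D f E)"
  unfolding effect_def cin_ap_cj
proof (intro conjI allI)
  show "herm D (cj D f E)" using assms(2) by (intro cj_herm effect_herm)
  show "0 \<le> Re (cin D (\<lambda>j. \<Sum>k<D. v k * f k j) (ap D E (\<lambda>j. \<Sum>k<D. v k * f k j)))" for v
    using assms(2) unfolding effect_def by blast
  show "Re (cin D (\<lambda>j. \<Sum>k<D. v k * f k j) (ap D E (\<lambda>j. \<Sum>k<D. v k * f k j))) \<le> nsq D v" for v
    using assms(2) unfolding effect_def by (subst onb_nsq_sum[OF assms(1), symmetric]) blast
qed

lemma cj_osum: "cj D f (osum D l e) = osum D l (\<lambda>i k. cin D (f k) (e i))"
  by (intro ext) (simp add: cj_def cin_ap_osum osum_def cnj_cin)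

lemma onb_coords:
  assumes "onb D f" "onb D e"
  shows "onb D (\<lambda>i k. cin D (f k) (e i))"
  unfolding onb_def
proof (intro allI impI)
  fix i j assume "i < D" "j < D"
  have "cin D (\<lambda>k. cin D (f k) (e i)) (\<lambda>k. cin D (f k) (e j)) = cin D (e i) (e j)"
    using onb_Parseval[OF assms(1), of "e i" "e j"]
    by (subst cin_def) (simp add: cnj_cin)
  then show "cin D (\<lambda>k. cin D (f k) (e i)) (\<lambda>k. cin D (f k) (e j)) = (if i = j then 1 else 0)"
    using assms(2) \<open>i < D\<close> \<open>j < D\<close> by (simp add: onb_def)
qed

lemma cj_cong: "(\<And>i j. i < D \<Longrightarrow> j < D \<Longrightarrow> A i j = B i j) \<Longrightarrow> cj D f A = cj D f B"
  by (intro ext) (simp add: cj_def cin_ap)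

lemma trp_cj:
  assumes "onb D f" "herm D A"
  shows "trp D (cj D f A) (cj D f T) = trp D A T"
proof -
  obtain e l where "onb D e" and Ae: "\<And>k k'. k < D \<Longrightarrow> k' < D \<Longrightarrow> A k k' = osum D l e k k'"
    using spectral_decomposition[OF assms(2)] by blast
  have "cj D f A = osum D l (\<lambda>i k. cin D (f k) (e i))"
    unfolding cj_osum[symmetric] by (rule cj_cong) (rule Ae)
  then have "trp D (cj D f A) (cj D f T) =
     (\<Sum>i<D. of_real (l i) * cin D (\<lambda>j. \<Sum>k<D. cin D (f k) (e i) * f k j) (ap D T (\<lambda>j. \<Sum>k<D. cin D (f k) (e i) * f k j)))"
    by (simp add: trp_osum cin_ap_cj)
  also have "\<dots> = (\<Sum>i<D. of_real (l i) * cin D (e i) (ap D T (e i)))"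
  proof (intro sum.cong refl arg_cong2[where f = "(*)"])
    fix i
    have "(\<Sum>k<D. cin D (f k) (e i) * f k j) = e i j" if "j < D" for j
      using onb_Parseval[OF assms(1), of "\<lambda>r. if r = j then 1 else 0" "e i"] that
      by (simp add: cin_delta_left mult.commute)
    then show "cin D (\<lambda>j. \<Sum>k<D. cin D (f k) (e i) * f k j) (ap D T (\<lambda>j. \<Sum>k<D. cin D (f k) (e i) * f k j))
       = cin D (e i) (ap D T (e i))"
      by (intro cin_cong) (auto simp: ap_def)
  qed
  also have "\<dots> = trp D A T"
    by (simp add: trp_osum[symmetric]) (rule trp_cong, simp_all add: Ae)
  finally show ?thesis .
qed

lemma onb_adjoint: "onb D f \<Longrightarrow> onb D (\<lambda>k j. cnj (f j k))"
  unfolding onb_def[of D "\<lambda>k j. cnj (f j k)"]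
  using onb_complete[of D f] by (simp add: cin_def)

text \<open>Undoes a change of basis: decoding operators built in an eigenbasis of the average
  output are carried back to the standard basis with it.\<close>

lemma cj_adjoint:
  assumes "onb D f" "i < D" "j < D"
  shows "cj D f (cj D (\<lambda>k j. cnj (f j k)) T) i j = T i j"
proof -
  have *: "(\<Sum>k<D. f i k * cnj (f a k)) = (if i = a then 1 else 0)" if "i < D" "a < D" for i a
    using assms(1) that unfolding onb_def cin_def by (metis (no_types, lifting) mult.commute sum.cong)
  have "cj D f (cj D (\<lambda>k j. cnj (f j k)) T) i j
     = cin D (\<lambda>a. \<Sum>k<D. f i k * cnj (f a k)) (ap D T (\<lambda>a. \<Sum>k<D. f j k * cnj (f a k)))"
    by (simp add: cj_def[of D f] cin_ap_cj)
  also have "\<dots> = cin D (\<lambda>a. if a = i then 1 else 0) (ap D T (\<lambda>a. if a = j then 1 else 0))"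
    using assms * by (intro cin_cong) (auto simp: ap_def intro!: sum.cong)
  finally show ?thesis using assms by (simp add: cin_delta_left ap_delta)
qed

section \<open>Covering\<close>

lemma exists_le_average:
  fixes p F :: "'a \<Rightarrow> real"
  assumes "is_dist S p" "(\<Sum>x\<in>S. p x * F x) \<le> R"
  shows "\<exists>x\<in>S. F x \<le> R"
proof (rule ccontr)
  assume "\<not> ?thesis"
  then have F: "F x > R" if "x \<in> S" for x using that by force
  have fin: "finite S" using assms(1) by (metis is_dist_def sum.infinite zero_neq_one)
  have "\<exists>x\<in>S. p x \<noteq> 0" using assms(1) by (metis is_dist_def sum.neutral zero_neq_one)
  then obtain y where y: "y \<in> S" "p y > 0" using assms(1) by (metis is_dist_def order_less_le)
  have "(\<Sum>x\<in>S. p x * R) < (\<Sum>x\<in>S. p x * F x)"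
  proof (rule sum_strict_mono_ex1[OF fin])
    show "\<forall>x\<in>S. p x * R \<le> p x * F x"
      using assms(1) by (intro ballI mult_left_mono less_imp_le[OF F]) (auto simp: is_dist_def)
    show "\<exists>x\<in>S. p x * R < p x * F x"
      using F y by (intro bexI[of _ y]) auto
  qed
  then show False using assms by (simp add: is_dist_def flip: sum_distrib_right)
qed

lemma real_variance_identity:
  fixes p v :: "'a \<Rightarrow> real"
  assumes "sum p S = 1" "m = (\<Sum>x\<in>S. p x * v x)"
  shows "(\<Sum>x\<in>S. p x * (a + (v x - m))\<^sup>2) = a\<^sup>2 + (\<Sum>x\<in>S. p x * (v x)\<^sup>2) - m\<^sup>2"
proof -
  have "(\<Sum>x\<in>S. p x * (a + (v x - m))\<^sup>2)
     = (\<Sum>x\<in>S. (a - m)\<^sup>2 * p x + 2 * (a - m) * (p x * v x) + p x * (v x)\<^sup>2)"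
    by (intro sum.cong refl) (simp add: power2_eq_square algebra_simps)
  also have "\<dots> = (a - m)\<^sup>2 * sum p S + 2 * (a - m) * m + (\<Sum>x\<in>S. p x * (v x)\<^sup>2)"
    by (simp only: sum.distrib sum_distrib_left[symmetric] assms(2)[symmetric])
  finally show ?thesis using assms(1) by (simp add: power2_eq_square algebra_simps)
qed

text \<open>The cross term between \<open>a\<close> and the centred variable averages to zero, and
  the variance is at most the second moment. Real and imaginary parts are treated
  separately.\<close>

lemma complex_variance_le:
  fixes p :: "'a \<Rightarrow> real" and v :: "'a \<Rightarrow> complex"
  assumes "sum p S = 1"
  shows "(\<Sum>x\<in>S. p x * (cmod (a + (v x - (\<Sum>y\<in>S. of_real (p y) * v y))))\<^sup>2)
     \<le> (cmod a)\<^sup>2 + (\<Sum>x\<in>S. p x * (cmod (v x))\<^sup>2)"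
proof -
  let ?m = "\<Sum>y\<in>S. of_real (p y) * v y"
  have "(\<Sum>x\<in>S. p x * (cmod (a + (v x - ?m)))\<^sup>2)
     = (\<Sum>x\<in>S. p x * (Re a + (Re (v x) - Re ?m))\<^sup>2) + (\<Sum>x\<in>S. p x * (Im a + (Im (v x) - Im ?m))\<^sup>2)"
    by (simp add: cmod_power2 distrib_left sum.distrib del: Re_sum Im_sum)
  also have "(\<Sum>x\<in>S. p x * (Re a + (Re (v x) - Re ?m))\<^sup>2)
     = (Re a)\<^sup>2 + (\<Sum>x\<in>S. p x * (Re (v x))\<^sup>2) - (Re ?m)\<^sup>2"
    by (rule real_variance_identity[OF assms]) simp
  also have "(\<Sum>x\<in>S. p x * (Im a + (Im (v x) - Im ?m))\<^sup>2)
     = (Im a)\<^sup>2 + (\<Sum>x\<in>S. p x * (Im (v x))\<^sup>2) - (Im ?m)\<^sup>2"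
    by (rule real_variance_identity[OF assms]) simp
  finally have "(\<Sum>x\<in>S. p x * (cmod (a + (v x - ?m)))\<^sup>2)
    = (cmod a)\<^sup>2 + (\<Sum>x\<in>S. p x * (cmod (v x))\<^sup>2) - (cmod ?m)\<^sup>2"
    by (simp add: cmod_power2 distrib_left sum.distrib)
  then show ?thesis by simp
qed

text \<open>The random sample is derandomised one point at a time. On average over the next point
  the squared deviation grows by at most B, so some point does no worse. After division by M the
  error is sqrt (B / M), whatever the number of coordinates in \<open>J\<close>.\<close>

lemma Maurey_sampling:
  fixes V :: "'a \<Rightarrow> 'j \<Rightarrow> complex" and p :: "'a \<Rightarrow> real"
  assumes p: "is_dist S p" and B: "\<And>x. x \<in> S \<Longrightarrow> (\<Sum>j\<in>J. (cmod (V x j))\<^sup>2) \<le> B"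
  shows "\<exists>xs. length xs = M \<and> set xs \<subseteq> S \<and>
     (\<Sum>j\<in>J. (cmod ((\<Sum>x\<leftarrow>xs. V x j) - of_nat M * (\<Sum>x\<in>S. of_real (p x) * V x j)))\<^sup>2) \<le> real M * B"
proof (induction M)
  case 0
  show ?case by simp
next
  case (Suc M)
  define m where "m = (\<lambda>j. \<Sum>x\<in>S. of_real (p x) * V x j)"
  from Suc obtain xs where xs: "length xs = M" "set xs \<subseteq> S"
    "(\<Sum>j\<in>J. (cmod ((\<Sum>x\<leftarrow>xs. V x j) - of_nat M * m j))\<^sup>2) \<le> real M * B"
    unfolding m_def by blast
  define z where "z = (\<lambda>j. (\<Sum>x\<leftarrow>xs. V x j) - of_nat M * m j)"
  define F where "F = (\<lambda>x. \<Sum>j\<in>J. (cmod (z j + (V x j - m j)))\<^sup>2)"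
  have sp: "sum p S = 1" using p by (simp add: is_dist_def)
  have "(\<Sum>x\<in>S. p x * F x) = (\<Sum>j\<in>J. \<Sum>x\<in>S. p x * (cmod (z j + (V x j - m j)))\<^sup>2)"
    unfolding F_def sum_distrib_left by (rule sum.swap)
  also have "\<dots> \<le> (\<Sum>j\<in>J. (cmod (z j))\<^sup>2 + (\<Sum>x\<in>S. p x * (cmod (V x j))\<^sup>2))"
    unfolding m_def by (intro sum_mono complex_variance_le[OF sp])
  also have "\<dots> = (\<Sum>j\<in>J. (cmod (z j))\<^sup>2) + (\<Sum>x\<in>S. p x * (\<Sum>j\<in>J. (cmod (V x j))\<^sup>2))"
    unfolding sum.distrib sum_distrib_left by (simp add: sum.swap[of _ S J])
  also have "(\<Sum>x\<in>S. p x * (\<Sum>j\<in>J. (cmod (V x j))\<^sup>2)) \<le> (\<Sum>x\<in>S. p x * B)"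
    using p B by (intro sum_mono mult_left_mono) (auto simp: is_dist_def)
  also have "\<dots> = B" by (simp add: sum_distrib_right[symmetric] sp)
  finally have "(\<Sum>x\<in>S. p x * F x) \<le> real (Suc M) * B"
    using xs(3) by (simp add: z_def algebra_simps)
  from exists_le_average[OF p this] obtain x where x: "x \<in> S" "F x \<le> real (Suc M) * B" by blast
  have *: "(\<Sum>x\<leftarrow>x # xs. V x j) - of_nat (Suc M) * m j = z j + (V x j - m j)" for j
    by (simp add: z_def algebra_simps)
  have "(\<Sum>j\<in>J. (cmod ((\<Sum>x\<leftarrow>x # xs. V x j) - of_nat (Suc M) * m j))\<^sup>2) \<le> real (Suc M) * B"
    unfolding * using x(2) by (simp add: F_def)
  then show ?case using x(1) xs(1,2) unfolding m_def
    by (intro exI[of _ "x # xs"]) (simp del: of_nat_Suc)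
qed

section \<open>Truncated eigenvectors and the weighted Hilbert-Schmidt norm\<close>

lemma weighted_Cauchy_Schwarz:
  fixes a s :: "'a \<Rightarrow> real"
  assumes "\<And>i. i \<in> I \<Longrightarrow> 0 \<le> a i" "sum a I \<le> 1" "\<And>i. i \<in> I \<Longrightarrow> 0 \<le> s i"
  shows "(\<Sum>i\<in>I. a i * sqrt (s i)) \<le> sqrt (\<Sum>i\<in>I. a i * s i)"
proof -
  have "(\<Sum>i\<in>I. a i * sqrt (s i))\<^sup>2 = (\<Sum>i\<in>I. sqrt (a i) * (sqrt (a i) * sqrt (s i)))\<^sup>2"
    using assms by (simp add: mult.assoc[symmetric])
  also have "\<dots> \<le> (\<Sum>i\<in>I. (sqrt (a i))\<^sup>2) * (\<Sum>i\<in>I. (sqrt (a i) * sqrt (s i))\<^sup>2)"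
    by (rule Cauchy_Schwarz_ineq_sum)
  also have "\<dots> = sum a I * (\<Sum>i\<in>I. a i * s i)"
    using assms by (simp add: power_mult_distrib)
  also have "\<dots> \<le> 1 * (\<Sum>i\<in>I. a i * s i)"
    using assms by (intro mult_right_mono sum_nonneg) auto
  finally show ?thesis by (simp add: real_le_rsqrt)
qed

text \<open>A gentle-measurement estimate: replacing \<open>e i\<close> by \<open>g i\<close> on
  either side of T costs the length of the difference, and Cauchy-Schwarz with weights
  \<open>a i\<close> turns the mean length into the root of the mean square.\<close>

lemma trp_perturb:
  assumes T: "effect D T" and a: "\<And>i. i < D \<Longrightarrow> 0 \<le> a i" "(\<Sum>i<D. a i) \<le> 1"
    and e: "\<And>i. i < D \<Longrightarrow> nsq D (e i) \<le> 1" and g: "\<And>i. i < D \<Longrightarrow> nsq D (g i) \<le> 1"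
    and \<eta>: "(\<Sum>i<D. a i * nsq D (\<lambda>k. e i k - g i k)) \<le> \<eta>"
  shows "cmod (trp D (osum D a e) T - trp D (osum D a g) T) \<le> 2 * sqrt \<eta>"
proof -
  let ?r = "\<lambda>i k. e i k - g i k"
  have *: "cmod (cin D (e i) (ap D T (e i)) - cin D (g i) (ap D T (g i))) \<le> 2 * sqrt (nsq D (?r i))"
    if i: "i < D" for i
  proof -
    have "ap D T (?r i) = (\<lambda>k. ap D T (e i) k - ap D T (g i) k)" by (intro ext ap_diff)
    then have "cin D (e i) (ap D T (e i)) - cin D (g i) (ap D T (g i))
       = cin D (?r i) (ap D T (e i)) + cin D (g i) (ap D T (?r i))"
      by (simp add: cin_diff_left cin_diff_right)
    then have "cmod (cin D (e i) (ap D T (e i)) - cin D (g i) (ap D T (g i)))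
       \<le> cmod (cin D (?r i) (ap D T (e i))) + cmod (cin D (g i) (ap D T (?r i)))"
      by (simp add: norm_triangle_ineq)
    also have "\<dots> \<le> sqrt (nsq D (?r i)) * sqrt (nsq D (e i)) + sqrt (nsq D (g i)) * sqrt (nsq D (?r i))"
      by (intro add_mono effect_cin_le[OF T])
    also have "\<dots> \<le> sqrt (nsq D (?r i)) * 1 + 1 * sqrt (nsq D (?r i))"
      using e[OF i] g[OF i] by (intro add_mono mult_left_mono mult_right_mono) auto
    finally show ?thesis by simp
  qed
  have "cmod (trp D (osum D a e) T - trp D (osum D a g) T)
     = cmod (\<Sum>i<D. of_real (a i) * (cin D (e i) (ap D T (e i)) - cin D (g i) (ap D T (g i))))"
    by (simp add: trp_osum sum_subtractf right_diff_distrib)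
  also have "\<dots> \<le> (\<Sum>i<D. a i * (2 * sqrt (nsq D (?r i))))"
    by (rule order_trans[OF norm_sum], rule sum_mono) (use a * in \<open>auto simp: norm_mult intro!: mult_left_mono\<close>)
  also have "\<dots> = 2 * (\<Sum>i<D. a i * sqrt (nsq D (?r i)))" by (simp add: sum_distrib_left mult_ac)
  also have "\<dots> \<le> 2 * sqrt (\<Sum>i<D. a i * nsq D (?r i))"
    using a by (intro mult_left_mono weighted_Cauchy_Schwarz) auto
  also have "\<dots> \<le> 2 * sqrt \<eta>" using \<eta> by simp
  finally show ?thesis .
qed

lemma osum_HS:
  "(\<Sum>k<D. \<Sum>k'<D. (cmod (osum D a G k k'))\<^sup>2) = (\<Sum>i<D. \<Sum>j<D. a i * a j * (cmod (cin D (G j) (G i)))\<^sup>2)"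
proof -
  have "complex_of_real (\<Sum>k<D. \<Sum>k'<D. (cmod (osum D a G k k'))\<^sup>2) = trp D (osum D a G) (osum D a G)"
    unfolding trp_def of_real_sum complex_norm_square
    by (intro sum.cong refl) (simp add: hermD[OF osum_herm])
  also have "\<dots> = (\<Sum>i<D. \<Sum>j<D. of_real (a i) * (of_real (a j) * cin D (G i) (G j) * cin D (G j) (G i)))"
    by (simp only: trp_osum cin_ap_osum sum_distrib_left)
  also have "\<dots> = complex_of_real (\<Sum>i<D. \<Sum>j<D. a i * a j * (cmod (cin D (G j) (G i)))\<^sup>2)"
    unfolding of_real_sum of_real_mult complex_norm_square cnj_cin by (simp add: mult_ac)
  finally show ?thesis using of_real_eq_iff by blast
qed

text \<open>On the pairs with \<open>a j \<le> a i\<close> the truncation of \<open>e j\<close> is invisible against \<open>g i\<close>, so that \<open>e j\<close> may be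
  put in place of \<open>g j\<close> and Parseval applies. This avoids pinching, hence any count of distinct eigenvalues.\<close>

lemma trunc_HS:
  fixes a b :: "nat \<Rightarrow> real"
  assumes e: "onb D e" and a: "\<And>i. i < D \<Longrightarrow> 0 \<le> a i" "(\<Sum>i<D. a i) \<le> 1"
    and b: "\<And>k. k < D \<Longrightarrow> 0 \<le> b k" and L: "L > 0"
  defines "g \<equiv> \<lambda>i k. if a i \<le> L * b k then e i k else 0"
  defines "w \<equiv> \<lambda>k. 1 / sqrt (sqrt (b k))"
  shows "(\<Sum>k<D. \<Sum>k'<D. (cmod (osum D a g k k' * of_real (w k * w k')))\<^sup>2) \<le> 2 * L"
proof -
  define G where "G = (\<lambda>i k. of_real (w k) * g i k)"
  \<comment> \<open>\<open>\<beta> i\<close> carries both weights, so the other side of the inner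
    product can be the unweighted vector \<open>e j\<close>.\<close>
  define \<beta> where "\<beta> = (\<lambda>i k. of_real ((w k)\<^sup>2) * g i k)"
  \<comment> \<open>For \<open>b k = 0\<close> both sides are 0, division by zero being 0.\<close>
  have w2: "((w k)\<^sup>2)\<^sup>2 = 1 / b k" if "k < D" for k
    using b[OF that] by (simp only: w_def power_divide real_sqrt_pow2 real_sqrt_ge_zero power_one)
  define t where "t = (\<lambda>i j. a i * a j * (cmod (cin D (G j) (G i)))\<^sup>2)"
  have t0: "0 \<le> t i j" if "i < D" "j < D" for i j using that a by (simp add: t_def)
  have tsym: "t i j = t j i" for i j
    unfolding t_def by (metis cnj_cin complex_mod_cnj mult.commute)
  have row: "(\<Sum>j<D. if a j \<le> a i then t i j else 0) \<le> a i * L" if i: "i < D" for i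
  proof -
    have eq: "cin D (G j) (G i) = cin D (e j) (\<beta> i)" if "a j \<le> a i" for j
      unfolding cin_def G_def \<beta>_def
      by (intro sum.cong refl) (use that in \<open>auto simp: g_def power2_eq_square\<close>)
    have "a i * nsq D (\<beta> i) = (\<Sum>k<D. a i * (1 / b k) * (cmod (g i k))\<^sup>2)"
      unfolding nsq_def \<beta>_def sum_distrib_left
      by (intro sum.cong refl)
        (simp only: norm_mult power_mult_distrib norm_of_real power2_abs w2 lessThan_iff mult.assoc)
    also have "\<dots> \<le> (\<Sum>k<D. L * (cmod (e i k))\<^sup>2)"
    proof (rule sum_mono)
      fix k assume "k \<in> {..<D}"
      then have k: "k < D" by simp
      show "a i * (1 / b k) * (cmod (g i k))\<^sup>2 \<le> L * (cmod (e i k))\<^sup>2"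
      proof (cases "a i \<le> L * b k")
        case True
        have "a i * (1 / b k) \<le> L"
          using True b[OF k] L by (cases "b k = 0") (auto simp: field_simps)
        then have "a i * (1 / b k) * (cmod (e i k))\<^sup>2 \<le> L * (cmod (e i k))\<^sup>2" by (rule mult_right_mono) simp
        then show ?thesis using True by (simp only: g_def if_True)
      next
        case False
        then show ?thesis using L by (simp add: g_def)
      qed
    qed
    also have "\<dots> = L" using nsq_onb[OF e i] by (simp add: nsq_def flip: sum_distrib_left)
    finally have bd: "a i * nsq D (\<beta> i) \<le> L" .
    have "(\<Sum>j<D. if a j \<le> a i then t i j else 0) \<le> (\<Sum>j<D. a i * (a i * (cmod (cin D (e j) (\<beta> i)))\<^sup>2))"
    proof (rule sum_mono)
      fix j assume "j \<in> {..<D}"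
      then have j: "j < D" by simp
      show "(if a j \<le> a i then t i j else 0) \<le> a i * (a i * (cmod (cin D (e j) (\<beta> i)))\<^sup>2)"
        using a(1)[OF i] by (auto simp: t_def eq mult.assoc intro!: mult_left_mono mult_right_mono)
    qed
    also have "\<dots> = a i * (a i * nsq D (\<beta> i))"
      by (simp only: sum_distrib_left[symmetric] onb_Parseval_nsq[OF e])
    also have "\<dots> \<le> a i * L" using bd a(1)[OF i] by (rule mult_left_mono)
    finally show ?thesis .
  qed
  have half: "(\<Sum>i<D. \<Sum>j<D. if a j \<le> a i then t i j else 0) \<le> L"
  proof -
    have "(\<Sum>i<D. \<Sum>j<D. if a j \<le> a i then t i j else 0) \<le> (\<Sum>i<D. a i * L)"
      using row by (intro sum_mono) auto
    also have "\<dots> \<le> 1 * L" unfolding sum_distrib_right[symmetric]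
      using a(2) L by (intro mult_right_mono) auto
    finally show ?thesis by simp
  qed
  have "osum D a g k k' * of_real (w k * w k') = osum D a G k k'" for k k'
    unfolding osum_def G_def sum_distrib_right by (simp add: mult_ac)
  then have "(\<Sum>k<D. \<Sum>k'<D. (cmod (osum D a g k k' * of_real (w k * w k')))\<^sup>2) = (\<Sum>i<D. \<Sum>j<D. t i j)"
    by (simp only: osum_HS t_def)
  \<comment> \<open>\<open>t\<close> is symmetric, so every pair is covered by the half
    \<open>a j \<le> a i\<close> or by its mirror image; ties are counted twice. This is the origin
    of the factor 2 in \<open>2 * L\<close>.\<close>
  also have "\<dots> \<le> (\<Sum>i<D. \<Sum>j<D. (if a j \<le> a i then t i j else 0) + (if a i \<le> a j then t j i else 0))"
    using t0 tsym by (intro sum_mono) (auto simp: not_le)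
  also have "\<dots> = (\<Sum>i<D. \<Sum>j<D. if a j \<le> a i then t i j else 0) + (\<Sum>i<D. \<Sum>j<D. if a i \<le> a j then t j i else 0)"
    by (simp only: sum.distrib)
  also have "(\<Sum>i<D. \<Sum>j<D. if a i \<le> a j then t j i else 0) = (\<Sum>i<D. \<Sum>j<D. if a j \<le> a i then t i j else 0)"
    by (rule sum.swap)
  finally show ?thesis using half by linarith
qed

text \<open>The squared norm of \<open>sigma^(1/4) T sigma^(1/4)\<close>. The arithmetic-geometric
  mean inequality for \<open>b k\<close> and \<open>b k'\<close> splits it into two equal halves,
  together Tr(sigma T^2), and each column of an effect has norm at most 1.\<close>

lemma effect_weighted_HS:
  assumes T: "effect D T" and b: "\<And>k. k < D \<Longrightarrow> 0 \<le> b k" "(\<Sum>k<D. b k) \<le> 1"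
  shows "(\<Sum>k<D. \<Sum>k'<D. (cmod (of_real (sqrt (sqrt (b k)) * sqrt (sqrt (b k'))) * T k' k))\<^sup>2) \<le> 1"
proof -
  have sym: "cmod (T k' k) = cmod (T k k')" if "k < D" "k' < D" for k k'
    using hermD[OF effect_herm[OF T] that] by (metis complex_mod_cnj)
  have "(\<Sum>k<D. \<Sum>k'<D. (cmod (of_real (sqrt (sqrt (b k)) * sqrt (sqrt (b k'))) * T k' k))\<^sup>2)
     \<le> (\<Sum>k<D. \<Sum>k'<D. (b k / 2) * (cmod (T k' k))\<^sup>2 + (b k' / 2) * (cmod (T k k'))\<^sup>2)"
  proof (intro sum_mono)
    fix k k' assume "k \<in> {..<D}" "k' \<in> {..<D}"
    then have kk: "k < D" "k' < D" by auto
    have "sqrt (b k) * sqrt (b k') \<le> (b k + b k') / 2"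
      using arith_geo_mean_sqrt[of "b k" "b k'"] b kk by (simp add: real_sqrt_mult)
    then have "sqrt (b k) * sqrt (b k') * (cmod (T k' k))\<^sup>2 \<le> (b k + b k') / 2 * (cmod (T k' k))\<^sup>2"
      by (rule mult_right_mono) simp
    then show "(cmod (of_real (sqrt (sqrt (b k)) * sqrt (sqrt (b k'))) * T k' k))\<^sup>2
       \<le> (b k / 2) * (cmod (T k' k))\<^sup>2 + (b k' / 2) * (cmod (T k k'))\<^sup>2"
      using b kk sym[OF kk] by (simp add: norm_mult power_mult_distrib add_divide_distrib distrib_right)
  qed
  also have "\<dots> = (\<Sum>k<D. \<Sum>k'<D. (b k / 2) * (cmod (T k' k))\<^sup>2) + (\<Sum>k<D. \<Sum>k'<D. (b k' / 2) * (cmod (T k k'))\<^sup>2)"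
    by (simp only: sum.distrib)
  also have "(\<Sum>k<D. \<Sum>k'<D. (b k' / 2) * (cmod (T k k'))\<^sup>2) = (\<Sum>k<D. \<Sum>k'<D. (b k / 2) * (cmod (T k' k))\<^sup>2)"
    by (rule sum.swap)
  also have "(\<Sum>k<D. \<Sum>k'<D. (b k / 2) * (cmod (T k' k))\<^sup>2) + (\<Sum>k<D. \<Sum>k'<D. (b k / 2) * (cmod (T k' k))\<^sup>2)
     = (\<Sum>k<D. b k * (\<Sum>k'<D. (cmod (T k' k))\<^sup>2))"
    by (simp add: sum_distrib_left[symmetric] sum.distrib[symmetric])
  also have "\<dots> \<le> (\<Sum>k<D. b k * 1)"
    using b effect_column_le[OF T] by (intro sum_mono mult_left_mono) auto
  finally show ?thesis using b(2) by simp
qed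

lemma cmod_sum_prod_le:
  assumes "(\<Sum>j\<in>J. (cmod (f j))\<^sup>2) \<le> R" "(\<Sum>j\<in>J. (cmod (h j))\<^sup>2) \<le> 1"
  shows "cmod (\<Sum>j\<in>J. f j * h j) \<le> sqrt R"
proof -
  have "cmod (\<Sum>j\<in>J. f j * h j) \<le> (\<Sum>j\<in>J. cmod (f j) * cmod (h j))"
    by (rule order_trans[OF norm_sum]) (simp add: norm_mult)
  then have "(cmod (\<Sum>j\<in>J. f j * h j))\<^sup>2 \<le> (\<Sum>j\<in>J. cmod (f j) * cmod (h j))\<^sup>2"
    by (simp add: power_mono)
  also have "\<dots> \<le> (\<Sum>j\<in>J. (cmod (f j))\<^sup>2) * (\<Sum>j\<in>J. (cmod (h j))\<^sup>2)"
    by (rule Cauchy_Schwarz_ineq_sum)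
  also have "\<dots> \<le> R * 1" using assms order_trans[OF sum_nonneg assms(1)]
    by (intro mult_mono sum_nonneg) auto
  finally show ?thesis by (simp add: real_le_rsqrt)
qed

text \<open>The list is chosen before T, so it approximates in trace distance. Truncation costs
  \<open>2 * sqrt \<eta>\<close> in the mixture and as much again in the sample; between the
  truncated operators, Maurey sampling in the weighted norm costs \<open>sqrt (2 * L / M)\<close>.
  The dimension D does not enter the bound.\<close>

theorem covering:
  fixes a :: "'x \<Rightarrow> nat \<Rightarrow> real" and b :: "nat \<Rightarrow> real"
  assumes p: "is_dist S p" and b: "\<And>k. k < D \<Longrightarrow> 0 \<le> b k" "(\<Sum>k<D. b k) \<le> 1" and L: "L > 0" and M: "M > 0"
    and e: "\<And>x. x \<in> S \<Longrightarrow> onb D (e x)"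
    and a: "\<And>x i. x \<in> S \<Longrightarrow> i < D \<Longrightarrow> 0 \<le> a x i" "\<And>x. x \<in> S \<Longrightarrow> (\<Sum>i<D. a x i) \<le> 1"
    and \<eta>: "\<And>x. x \<in> S \<Longrightarrow> (\<Sum>i<D. \<Sum>k<D. if L * b k < a x i then a x i * (cmod (e x i k))\<^sup>2 else 0) \<le> \<eta>"
  shows "\<exists>xs. length xs = M \<and> set xs \<subseteq> S \<and> (\<forall>T. effect D T \<longrightarrow>
     cmod ((\<Sum>x\<in>S. of_real (p x) * trp D (osum D (a x) (e x)) T) - (\<Sum>x\<leftarrow>xs. trp D (osum D (a x) (e x)) T) / of_nat M)
      \<le> 4 * sqrt \<eta> + sqrt (2 * L / M))"
proof -
  define g where "g = (\<lambda>x i k. if a x i \<le> L * b k then e x i k else 0)"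
  define w where "w = (\<lambda>k. 1 / sqrt (sqrt (b k)))"
  define v where "v = (\<lambda>k. sqrt (sqrt (b k)))"
  define J where "J = {..<D} \<times> {..<D}"
  define V where "V = (\<lambda>x (k,k'). osum D (a x) (g x) k k' * of_real (w k * w k'))"
  have V: "(\<Sum>j\<in>J. (cmod (V x j))\<^sup>2) \<le> 2 * L" if x: "x \<in> S" for x
    unfolding J_def V_def sum.cartesian_product[symmetric] g_def w_def
    using trunc_HS[OF e a b(1) L] x by (simp add: case_prod_unfold sum.cartesian_product)
  from Maurey_sampling[where M = M and J = J and V = V, OF p V] obtain xs where xs: "length xs = M" "set xs \<subseteq> S"
    "(\<Sum>j\<in>J. (cmod ((\<Sum>x\<leftarrow>xs. V x j) - of_nat M * (\<Sum>x\<in>S. of_real (p x) * V x j)))\<^sup>2) \<le> real M * (2 * L)"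
    by blast
  define Z where "Z = (\<lambda>j. (\<Sum>x\<in>S. of_real (p x) * V x j) - (\<Sum>x\<leftarrow>xs. V x j) / of_nat M)"
  have Z: "(\<Sum>j\<in>J. (cmod (Z j))\<^sup>2) \<le> 2 * L / M"
  proof -
    have "(cmod (Z j))\<^sup>2 = (cmod ((\<Sum>x\<leftarrow>xs. V x j) - of_nat M * (\<Sum>x\<in>S. of_real (p x) * V x j)))\<^sup>2 / (real M)\<^sup>2" for j
    proof -
      have "Z j = - ((\<Sum>x\<leftarrow>xs. V x j) - of_nat M * (\<Sum>x\<in>S. of_real (p x) * V x j)) / of_nat M"
        using M by (simp add: Z_def field_simps)
      then show ?thesis by (simp only: norm_divide norm_minus_cancel norm_of_nat power_divide)
    qed
    then have "(\<Sum>j\<in>J. (cmod (Z j))\<^sup>2)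
      = (\<Sum>j\<in>J. (cmod ((\<Sum>x\<leftarrow>xs. V x j) - of_nat M * (\<Sum>x\<in>S. of_real (p x) * V x j)))\<^sup>2) / (real M)\<^sup>2"
      by (simp add: sum_divide_distrib)
    also have "\<dots> \<le> real M * (2 * L) / (real M)\<^sup>2" using xs(3) by (rule divide_right_mono) simp
    also have "\<dots> = 2 * L / M" using M by (simp add: power2_eq_square)
    finally show ?thesis .
  qed
  have trp_V: "trp D (osum D (a x) (g x)) T = (\<Sum>(k,k')\<in>J. V x (k,k') * (of_real (v k * v k') * T k' k))"
    if x: "x \<in> S" for x T
  proof -
    have "osum D (a x) (g x) k k' = V x (k,k') * of_real (v k * v k')" if kk: "k < D" "k' < D" for k k'
    proof (cases "b k = 0 \<or> b k' = 0")
      case True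
      \<comment> \<open>Here a weight \<open>w\<close> is 0, so dividing the weights out again would
        lose information; but where \<open>b k = 0\<close> the truncation keeps only eigenvectors
        with \<open>a x i = 0\<close>.\<close>
      have "of_real (a x i) * g x i k * cnj (g x i k') = 0" if "i < D" for i
        using True a(1)[OF x that] by (auto simp: g_def)
      then have "osum D (a x) (g x) k k' = 0" unfolding osum_def by (intro sum.neutral) auto
      then show ?thesis by (simp add: V_def)
    next
      case False
      then have "w k * v k = 1" "w k' * v k' = 1" by (auto simp: w_def v_def)
      then have "of_real (w k * w k') * of_real (v k * v k') = (1::complex)"
        by (metis mult.assoc mult.left_commute mult_1 of_real_1 of_real_mult)
      then show ?thesis by (simp only: V_def prod.case mult.assoc mult_1_right)
    qed
    then have "trp D (osum D (a x) (g x)) T = (\<Sum>k<D. \<Sum>k'<D. V x (k,k') * (of_real (v k * v k') * T k' k))"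
      unfolding trp_def by (intro sum.cong refl) (simp add: mult.assoc)
    then show ?thesis by (simp add: J_def sum.cartesian_product)
  qed
  have "cmod ((\<Sum>x\<in>S. of_real (p x) * trp D (osum D (a x) (e x)) T) - (\<Sum>x\<leftarrow>xs. trp D (osum D (a x) (e x)) T) / of_nat M)
      \<le> 4 * sqrt \<eta> + sqrt (2 * L / M)" if T: "effect D T" for T
  proof -
    define t where "t = (\<lambda>x. trp D (osum D (a x) (e x)) T)"
    define t' where "t' = (\<lambda>x. trp D (osum D (a x) (g x)) T)"
    have tt: "cmod (t x - t' x) \<le> 2 * sqrt \<eta>" if x: "x \<in> S" for x
      unfolding t_def t'_def
    proof (rule trp_perturb[OF T a(1)[OF x] a(2)[OF x]])
      show "nsq D (e x i) \<le> 1" if "i < D" for i using nsq_onb[OF e[OF x] that] by simp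
      show "nsq D (g x i) \<le> 1" if "i < D" for i
      proof -
        have "nsq D (g x i) \<le> nsq D (e x i)" unfolding nsq_def g_def by (intro sum_mono) auto
        then show ?thesis using nsq_onb[OF e[OF x] that] by simp
      qed
      have "(\<Sum>i<D. a x i * nsq D (\<lambda>k. e x i k - g x i k))
        = (\<Sum>i<D. \<Sum>k<D. if L * b k < a x i then a x i * (cmod (e x i k))\<^sup>2 else 0)"
        unfolding nsq_def sum_distrib_left by (intro sum.cong refl) (auto simp: g_def)
      then show "(\<Sum>i<D. a x i * nsq D (\<lambda>k. e x i k - g x i k)) \<le> \<eta>" using \<eta>[OF x] by simp
    qed
    have A: "cmod ((\<Sum>x\<in>S. of_real (p x) * t' x) - (\<Sum>x\<leftarrow>xs. t' x) / of_nat M) \<le> sqrt (2 * L / M)"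
    proof -
      define h where "h = (\<lambda>(k,k'). of_real (v k * v k') * T k' k)"
      have t': "t' x = (\<Sum>j\<in>J. V x j * h j)" if "x \<in> S" for x
        unfolding t'_def trp_V[OF that] h_def by (simp add: case_prod_unfold)
      have "(\<Sum>x\<leftarrow>xs. t' x) = (\<Sum>x\<leftarrow>xs. \<Sum>j\<in>J. V x j * h j)"
        using xs(2) t' by (intro arg_cong[where f = sum_list] map_cong) auto
      also have "\<dots> = (\<Sum>j\<in>J. (\<Sum>x\<leftarrow>xs. V x j) * h j)"
        by (induction xs) (auto simp: distrib_right sum.distrib)
      finally have 1: "(\<Sum>x\<leftarrow>xs. t' x) = (\<Sum>j\<in>J. (\<Sum>x\<leftarrow>xs. V x j) * h j)" .
      have 2: "(\<Sum>x\<in>S. of_real (p x) * t' x) = (\<Sum>j\<in>J. (\<Sum>x\<in>S. of_real (p x) * V x j) * h j)"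
        unfolding sum_distrib_right
        by (subst sum.swap) (simp add: t' sum_distrib_left mult.assoc)
      have "(\<Sum>x\<in>S. of_real (p x) * t' x) - (\<Sum>x\<leftarrow>xs. t' x) / of_nat M = (\<Sum>j\<in>J. Z j * h j)"
        unfolding 1 2 Z_def by (simp add: left_diff_distrib sum_subtractf sum_divide_distrib)
      moreover have "(\<Sum>j\<in>J. (cmod (h j))\<^sup>2) \<le> 1"
        using effect_weighted_HS[OF T b] unfolding J_def h_def v_def
        by (simp add: sum.cartesian_product case_prod_unfold)
      ultimately show ?thesis using cmod_sum_prod_le[OF Z] by simp
    qed
    have B: "cmod ((\<Sum>x\<in>S. of_real (p x) * t x) - (\<Sum>x\<in>S. of_real (p x) * t' x)) \<le> 2 * sqrt \<eta>"
    proof -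
      have "cmod ((\<Sum>x\<in>S. of_real (p x) * t x) - (\<Sum>x\<in>S. of_real (p x) * t' x))
        = cmod (\<Sum>x\<in>S. of_real (p x) * (t x - t' x))"
        by (simp add: sum_subtractf right_diff_distrib)
      also have "\<dots> \<le> (\<Sum>x\<in>S. p x * (2 * sqrt \<eta>))"
        by (rule order_trans[OF norm_sum], rule sum_mono)
          (use p tt in \<open>auto simp: norm_mult is_dist_def intro!: mult_left_mono\<close>)
      also have "\<dots> = 2 * sqrt \<eta>" using p by (simp add: is_dist_def flip: sum_distrib_right)
      finally show ?thesis .
    qed
    have C: "cmod ((\<Sum>x\<leftarrow>xs. t x) / of_nat M - (\<Sum>x\<leftarrow>xs. t' x) / of_nat M) \<le> 2 * sqrt \<eta>"
    proof -
      have "cmod ((\<Sum>x\<leftarrow>ys. t x) - (\<Sum>x\<leftarrow>ys. t' x)) \<le> length ys * (2 * sqrt \<eta>)" if "set ys \<subseteq> S" for ys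
        using that
      proof (induction ys)
        case (Cons y ys)
        have "cmod ((\<Sum>x\<leftarrow>y # ys. t x) - (\<Sum>x\<leftarrow>y # ys. t' x))
          = cmod ((t y - t' y) + ((\<Sum>x\<leftarrow>ys. t x) - (\<Sum>x\<leftarrow>ys. t' x)))" by (simp add: algebra_simps)
        also have "\<dots> \<le> cmod (t y - t' y) + cmod ((\<Sum>x\<leftarrow>ys. t x) - (\<Sum>x\<leftarrow>ys. t' x))"
          by (rule norm_triangle_ineq)
        also have "\<dots> \<le> 2 * sqrt \<eta> + length ys * (2 * sqrt \<eta>)"
          using Cons tt[of y] by (intro add_mono) auto
        finally show ?case by (simp add: algebra_simps)
      qed simp
      from this[OF xs(2)] have "cmod ((\<Sum>x\<leftarrow>xs. t x) - (\<Sum>x\<leftarrow>xs. t' x)) / M \<le> 2 * sqrt \<eta>"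
        using xs(1) M by (simp add: field_simps)
      then show ?thesis by (simp add: norm_divide flip: diff_divide_distrib)
    qed
    have "(\<Sum>x\<in>S. of_real (p x) * t x) - (\<Sum>x\<leftarrow>xs. t x) / of_nat M
      = ((\<Sum>x\<in>S. of_real (p x) * t x) - (\<Sum>x\<in>S. of_real (p x) * t' x))
       + ((\<Sum>x\<in>S. of_real (p x) * t' x) - (\<Sum>x\<leftarrow>xs. t' x) / of_nat M)
       - ((\<Sum>x\<leftarrow>xs. t x) / of_nat M - (\<Sum>x\<leftarrow>xs. t' x) / of_nat M)" by simp
    also have "cmod \<dots> \<le> 2 * sqrt \<eta> + sqrt (2 * L / M) + 2 * sqrt \<eta>"
      by (intro order_trans[OF norm_triangle_ineq4] order_trans[OF norm_triangle_ineq] add_mono A B C)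
    finally show ?thesis unfolding t_def by simp
  qed
  with xs(1,2) show ?thesis by blast
qed

section \<open>Tests and sequential decoding\<close>

text \<open>As operators on the coordinates below D this is \<open>P^* P = P\<close>, one identity
  that contains both self-adjointness and idempotence.\<close>

definition projm :: "nat \<Rightarrow> (nat \<Rightarrow> nat \<Rightarrow> complex) \<Rightarrow> bool" where
  "projm D P \<longleftrightarrow> (\<forall>u v. cin D (ap D P u) (ap D P v) = cin D u (ap D P v))"

definition compl :: "(nat \<Rightarrow> nat \<Rightarrow> complex) \<Rightarrow> nat \<Rightarrow> nat \<Rightarrow> complex" where
  "compl P i j = (if i = j then 1 else 0) - P i j"

lemma ap_compl: "k < D \<Longrightarrow> ap D (compl P) v k = v k - ap D P v k"
  by (simp add: ap_def compl_def left_diff_distrib sum_subtractf if_distrib[of "\<lambda>x. x * _"] cong: if_cong)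

lemma cin_projm: "projm D P \<Longrightarrow> cin D (ap D P u) v = cin D u (ap D P v)"
  unfolding projm_def by (metis cnj_cin)

lemma projm_compl:
  assumes "projm D P"
  shows "projm D (compl P)"
  unfolding projm_def
proof (intro allI)
  fix u v
  have "cin D (ap D (compl P) u) (ap D (compl P) v) = cin D (\<lambda>k. u k - ap D P u k) (\<lambda>k. v k - ap D P v k)"
    by (intro cin_cong) (auto simp: ap_compl)
  also have "\<dots> = cin D u v - cin D u (ap D P v)"
    using assms cin_projm[OF assms, of u v] by (simp add: cin_diff_left cin_diff_right projm_def)
  also have "\<dots> = cin D u (\<lambda>k. v k - ap D P v k)" by (simp add: cin_diff_right)
  also have "\<dots> = cin D u (ap D (compl P) v)"
    by (intro cin_cong) (auto simp: ap_compl)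
  finally show "cin D (ap D (compl P) u) (ap D (compl P) v) = cin D u (ap D (compl P) v)" .
qed

lemma nsq_projm: "projm D P \<Longrightarrow> of_real (nsq D (ap D P v)) = cin D v (ap D P v)"
  by (metis cin_self projm_def)

lemma nsq_projm_diff:
  assumes "projm D P"
  shows "nsq D (\<lambda>k. v k - ap D P v k) = nsq D v - nsq D (ap D P v)"
proof -
  have "complex_of_real (nsq D (\<lambda>k. v k - ap D P v k)) = complex_of_real (nsq D v - nsq D (ap D P v))"
    using assms cin_projm[OF assms, of v v] nsq_projm[OF assms, of v]
    by (simp add: cin_diff_left cin_diff_right cin_self flip: cin_self[of D "\<lambda>k. v k - ap D P v k"])
  then show ?thesis using of_real_eq_iff by blast
qed

text \<open>The vector \<open>v\<close> after the tests \<open>P 0, \<dots>, P (j - 1)\<close> have all been answered negatively.\<close>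

primrec chi :: "nat \<Rightarrow> (nat \<Rightarrow> nat \<Rightarrow> nat \<Rightarrow> complex) \<Rightarrow> nat \<Rightarrow> (nat \<Rightarrow> complex) \<Rightarrow> nat \<Rightarrow> complex" where
  "chi D P 0 v = v"
| "chi D P (Suc j) v = (\<lambda>k. chi D P j v k - ap D (P j) (chi D P j v) k)"

lemma chi_nsq:
  assumes "\<And>j. j < r \<Longrightarrow> projm D (P j)"
  shows "nsq D (chi D P r v) = nsq D v - (\<Sum>j<r. nsq D (ap D (P j) (chi D P j v)))"
  using assms by (induction r) (simp_all add: nsq_projm_diff)

lemma chi_eq: "chi D P r v k = v k - (\<Sum>j<r. ap D (P j) (chi D P j v) k)"
  by (induction r) simp_all

lemma chi_sum: "chi D P r (\<lambda>k. \<Sum>i\<in>I. c i * v i k) = (\<lambda>k. \<Sum>i\<in>I. c i * chi D P r (v i) k)"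
  by (induction r) (simp_all add: ap_sum ap_scale sum_subtractf right_diff_distrib)

lemma chi_cong:
  assumes "\<And>k. k < D \<Longrightarrow> u k = v k" "k < D"
  shows "chi D P r u k = chi D P r v k"
  using assms(2)
proof (induction r arbitrary: k)
  case (Suc r)
  then have "ap D (P r) (chi D P r u) = ap D (P r) (chi D P r v)" by (intro ap_cong) auto
  then show ?case using Suc by simp
qed (use assms(1) in simp)

text \<open>Gao's union bound. Pairing \<open>v - chi D P r v\<close> with \<open>v\<close> and applying Cauchy--Schwarz leaves the factor
  \<open>1 - nsq D (chi D P r v)\<close> on both sides, which makes the bound linear in the individual errors.\<close>

lemma quantum_union_bound:
  assumes P: "\<And>j. j < r \<Longrightarrow> projm D (P j)" and v: "nsq D v = 1"
  shows "1 - nsq D (chi D P r v) \<le> 4 * (\<Sum>j<r. nsq D (ap D (P j) v))"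
proof -
  define d where "d = (\<lambda>j. ap D (P j) (chi D P j v))"
  define X where "X = (\<Sum>j<r. nsq D (ap D (P j) v))"
  define f where "f = sqrt (nsq D (chi D P r v))"
  have f2: "f\<^sup>2 = nsq D (chi D P r v)" by (simp add: f_def)
  have Y: "(\<Sum>j<r. nsq D (d j)) = 1 - f\<^sup>2"
    using chi_nsq[of r D P v] P v by (simp add: f2 d_def)
  have f0: "0 \<le> f" by (simp add: f_def)
  have "0 \<le> 1 - f\<^sup>2" unfolding Y[symmetric] by (simp add: sum_nonneg)
  then have f1: "f \<le> 1" using power2_le_imp_le[of f 1] by simp
  have X0: "0 \<le> X" by (simp add: X_def sum_nonneg)
  have "cin D v (chi D P r v) = cin D v (\<lambda>k. v k - (\<Sum>j<r. d j k))"
    by (intro cin_cong) (simp_all add: chi_eq[of D P r] d_def)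
  also have "\<dots> = 1 - (\<Sum>j<r. cin D v (d j))"
    by (simp add: cin_diff_right cin_sum_right cin_self v)
  finally have e1: "cin D v (chi D P r v) = 1 - (\<Sum>j<r. cin D v (d j))" .
  have "cmod (\<Sum>j<r. cin D v (d j)) \<le> (\<Sum>j<r. sqrt (nsq D (ap D (P j) v)) * sqrt (nsq D (d j)))"
  proof (rule order_trans[OF norm_sum], rule sum_mono)
    fix j assume "j \<in> {..<r}"
    then have "cin D v (d j) = cin D (ap D (P j) v) (d j)" using P[of j] by (simp add: d_def projm_def)
    then show "cmod (cin D v (d j)) \<le> sqrt (nsq D (ap D (P j) v)) * sqrt (nsq D (d j))"
      by (simp only: cmod_cin_le)
  qed
  also have "\<dots> \<le> sqrt (X * (1 - f\<^sup>2))"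
  proof (rule real_le_rsqrt)
    show "(\<Sum>j<r. sqrt (nsq D (ap D (P j) v)) * sqrt (nsq D (d j)))\<^sup>2 \<le> X * (1 - f\<^sup>2)"
      using Cauchy_Schwarz_ineq_sum[of "\<lambda>j. sqrt (nsq D (ap D (P j) v))" "\<lambda>j. sqrt (nsq D (d j))" "{..<r}"]
      by (simp add: X_def Y[symmetric])
  qed
  finally have c: "cmod (\<Sum>j<r. cin D v (d j)) \<le> sqrt (X * (1 - f\<^sup>2))" .
  have "1 - f \<le> 1 - Re (cin D v (chi D P r v))"
    using cmod_cin_le[of D v "chi D P r v"] complex_Re_le_cmod[of "cin D v (chi D P r v)"]
    by (simp add: v f_def)
  also have "\<dots> = Re (\<Sum>j<r. cin D v (d j))" by (simp add: e1)
  also have "\<dots> \<le> sqrt (X * (1 - f\<^sup>2))" using c complex_Re_le_cmod order_trans by blast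
  finally have "(1 - f)\<^sup>2 \<le> (sqrt (X * (1 - f\<^sup>2)))\<^sup>2" using f1 by (intro power_mono) auto
  moreover have "(sqrt (X * (1 - f\<^sup>2)))\<^sup>2 = X * (1 - f\<^sup>2)"
    using X0 \<open>0 \<le> 1 - f\<^sup>2\<close> by (intro real_sqrt_pow2 mult_nonneg_nonneg)
  ultimately have sq: "(1 - f) * (1 - f) \<le> (1 - f) * (X * (1 + f))"
    by (simp add: power2_eq_square algebra_simps)
  show ?thesis
  proof (cases "f = 1")
    case True
    then show ?thesis using f2 X0 unfolding X_def by simp
  next
    case False
    \<comment> \<open>After cancelling the positive factor \<open>1 - f\<close>, multiplication by
      \<open>1 + f\<close> produces \<open>1 - f^2\<close> on the left; the constant 4 is the bound
      for \<open>(1 + f)^2\<close>.\<close>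
    then have "1 - f \<le> X * (1 + f)" using sq f1 by simp
    then have "(1 - f) * (1 + f) \<le> X * (1 + f) * (1 + f)" using f0 by (intro mult_right_mono) auto
    also have "\<dots> \<le> X * (2 * 2)"
      unfolding mult.assoc using f0 f1 X0 by (intro mult_left_mono mult_mono) auto
    finally show ?thesis unfolding f2[symmetric] X_def[symmetric]
      by (simp add: power2_eq_square algebra_simps)
  qed
qed

text \<open>A positive answer to \<open>P k\<close> is a negative answer to its complement. Correct
  decoding of \<open>k\<close> is thus a run of \<open>k + 1\<close> negative answers, and the union
  bound applies with the last test complemented.\<close>

lemma sequential_decoding:
  assumes P: "\<And>j. j \<le> k \<Longrightarrow> projm D (P j)" and v: "nsq D v = 1"
  shows "1 - nsq D (ap D (P k) (chi D P k v))
     \<le> 4 * ((\<Sum>j<k. nsq D (ap D (P j) v)) + nsq D (\<lambda>i. v i - ap D (P k) v i))"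
proof -
  define P' where "P' = P(k := compl (P k))"
  have same: "chi D P' j v = chi D P j v" if "j \<le> k" for j
    using that by (induction j) (auto simp: P'_def)
  have P': "projm D (P' j)" if "j < Suc k" for j
    using that P projm_compl by (auto simp: P'_def)
  have "nsq D (chi D P' (Suc k) v) = nsq D (ap D (P k) (chi D P k v))"
    by (intro nsq_cong) (simp add: same, simp add: P'_def ap_compl)
  moreover have "(\<Sum>j<Suc k. nsq D (ap D (P' j) v))
      = (\<Sum>j<k. nsq D (ap D (P j) v)) + nsq D (\<lambda>i. v i - ap D (P k) v i)"
  proof -
    have "nsq D (ap D (compl (P k)) v) = nsq D (\<lambda>i. v i - ap D (P k) v i)"
      by (intro nsq_cong) (simp add: ap_compl)
    then show ?thesis by (simp add: P'_def)
  qed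
  ultimately show ?thesis using quantum_union_bound[of "Suc k" D P' v, OF P' v] by metis
qed

text \<open>The test projects onto the span of the vectors \<open>e i\<close> truncated to \<open>{k. L * b k < a i}\<close>. Orthonormalising
  them in the order of increasing \<open>a i\<close> keeps the \<open>i\<close>-th vector supported on \<open>{k. L * b k < a i}\<close>.\<close>

lemma likelihood_test:
  fixes a b :: "nat \<Rightarrow> real"
  assumes e: "onb D e" and a: "\<And>i. i < D \<Longrightarrow> 0 \<le> a i" "(\<Sum>i<D. a i) \<le> 1" and L: "L > 0"
    and b: "\<And>k. k < D \<Longrightarrow> 0 \<le> b k"
  shows "\<exists>P. projm D P \<and>
     (\<Sum>i<D. a i * nsq D (\<lambda>k. e i k - ap D P (e i) k))
        \<le> (\<Sum>i<D. \<Sum>k<D. if L * b k < a i then 0 else a i * (cmod (e i k))\<^sup>2) \<and>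
     (\<Sum>k<D. b k * Re (P k k)) \<le> 1 / L"
proof -
  define xs where "xs = sort_key a [0..<D]"
  define \<pi> where "\<pi> = (\<lambda>i. xs ! i)"
  have xs: "distinct xs" "set xs = {..<D}" "length xs = D" by (auto simp: xs_def atLeast0LessThan)
  have bij: "bij_betw \<pi> {..<D} {..<D}"
    unfolding \<pi>_def by (rule bij_betw_nth) (simp_all only: xs)
  have mono: "a (\<pi> j) \<le> a (\<pi> i)" if "j \<le> i" "i < D" for i j
  proof -
    have "sorted (map a xs)" by (simp add: xs_def)
    from sorted_nth_mono[OF this that(1)] show ?thesis using that xs by (simp add: \<pi>_def)
  qed
  have \<pi>D: "\<pi> i < D" if "i < D" for i using bij that by (auto simp: bij_betw_def)
  define g where "g = (\<lambda>i k. if L * b k < a (\<pi> i) then e (\<pi> i) k else 0)"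
  from Gram_Schmidt[of D D g] obtain h c where H: "\<forall>i<D. nsq D (h i) = 1 \<or> h i = (\<lambda>k. 0)"
    "\<forall>i<D. \<forall>j<D. i \<noteq> j \<longrightarrow> cin D (h i) (h j) = 0"
    "\<forall>i<D. \<forall>k. h i k = (\<Sum>j\<le>i. c i j * g j k)"
    "\<forall>i<D. \<forall>k<D. g i k = (\<Sum>j\<le>i. cin D (h j) (g i) * h j k)"
    by (elim exE conjE) (rule that)
  define P where "P = osum D (\<lambda>_. 1) h"
  have apP: "ap D P v = (\<lambda>k. \<Sum>i<D. cin D (h i) v * h i k)" for v
    unfolding ap_def P_def osum_def sum_distrib_right cin_def
    by (intro ext, subst sum.swap) (simp add: mult_ac)
  have hP: "cin D (h j) (ap D P v) = cin D (h j) v" if j: "j < D" for j v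
  proof -
    have "cin D (h j) (ap D P v) = (\<Sum>i<D. cin D (h i) v * cin D (h j) (h i))"
      unfolding apP by (simp only: cin_sum_right cin_scale_right)
    also have "\<dots> = cin D (h j) v * cin D (h j) (h j)"
      using j H(2) by (subst sum.remove[of _ j]) auto
    also have "\<dots> = cin D (h j) v"
    proof (cases "nsq D (h j) = 1")
      case True then show ?thesis by (simp add: cin_self)
    next
      case False
      then have "h j = (\<lambda>k. 0)" using H(1) j by blast
      then show ?thesis by (simp add: cin_def)
    qed
    finally show ?thesis .
  qed
  have projP: "projm D P"
    unfolding projm_def
  proof (intro allI)
    fix u v
    have "cin D (ap D P u) (ap D P v) = (\<Sum>i<D. cnj (cin D (h i) u) * cin D (h i) (ap D P v))"
      by (subst apP) (simp only: cin_sum_left cin_scale_left)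
    also have "\<dots> = (\<Sum>i<D. cnj (cin D (h i) u) * cin D (h i) v)" using hP by simp
    also have "\<dots> = cin D u (ap D P v)"
      unfolding apP cin_sum_right cin_scale_right cnj_cin by (simp only: mult.commute)
    finally show "cin D (ap D P u) (ap D P v) = cin D u (ap D P v)" .
  qed
  have Pg: "ap D P (g i) k = g i k" if i: "i < D" and k: "k < D" for i k
  proof -
    have gi: "g i k = (\<Sum>j\<le>i. cin D (h j) (g i) * h j k)" if "k < D" for k using H(4) i that by blast
    have "cin D (h j) (g i) = 0" if "i < j" "j < D" for j
    proof -
      have "cin D (h j) (g i) = cin D (h j) (\<lambda>k. \<Sum>r\<le>i. cin D (h r) (g i) * h r k)"
        by (intro cin_cong) (use gi in auto)
      also have "\<dots> = (\<Sum>r\<le>i. cin D (h r) (g i) * cin D (h j) (h r))"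
        by (simp only: cin_sum_right cin_scale_right)
      also have "\<dots> = 0" using that H(2) by (intro sum.neutral) auto
      finally show ?thesis .
    qed
    then have "(\<Sum>j<D. cin D (h j) (g i) * h j k) = (\<Sum>j\<le>i. cin D (h j) (g i) * h j k)"
      using i by (intro sum.mono_neutral_right) (auto simp: not_le)
    then show ?thesis using gi[OF k] by (simp add: apP)
  qed
  have first: "(\<Sum>i<D. a i * nsq D (\<lambda>k. e i k - ap D P (e i) k))
        \<le> (\<Sum>i<D. \<Sum>k<D. if L * b k < a i then 0 else a i * (cmod (e i k))\<^sup>2)"
  proof -
    have "(\<Sum>i<D. a i * nsq D (\<lambda>k. e i k - ap D P (e i) k))
      = (\<Sum>i<D. a (\<pi> i) * nsq D (\<lambda>k. e (\<pi> i) k - ap D P (e (\<pi> i)) k))"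
      by (rule sum.reindex_bij_betw[OF bij, symmetric])
    also have "\<dots> \<le> (\<Sum>i<D. \<Sum>k<D. if L * b k < a (\<pi> i) then 0 else a (\<pi> i) * (cmod (e (\<pi> i) k))\<^sup>2)"
    proof (rule sum_mono)
      fix i assume "i \<in> {..<D}"
      then have i: "i < D" by simp
      \<comment> \<open>P fixes the truncated vector \<open>g i\<close>, so the missed part of the
        eigenvector is that of \<open>r\<close> alone, at most its norm.\<close>
      define r where "r = (\<lambda>k. e (\<pi> i) k - g i k)"
      have "nsq D (\<lambda>k. e (\<pi> i) k - ap D P (e (\<pi> i)) k) = nsq D (\<lambda>k. r k - ap D P r k)"
      proof (intro nsq_cong)
        fix k assume k: "k < D"
        have "ap D P r k = ap D P (e (\<pi> i)) k - g i k"
          unfolding r_def ap_diff using Pg[OF i k] by simp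
        then show "e (\<pi> i) k - ap D P (e (\<pi> i)) k = r k - ap D P r k" by (simp add: r_def)
      qed
      also have "\<dots> \<le> nsq D r" unfolding nsq_projm_diff[OF projP] by simp
      also have "nsq D r = (\<Sum>k<D. if L * b k < a (\<pi> i) then 0 else (cmod (e (\<pi> i) k))\<^sup>2)"
        unfolding nsq_def by (intro sum.cong refl) (simp add: r_def g_def)
      finally have "a (\<pi> i) * nsq D (\<lambda>k. e (\<pi> i) k - ap D P (e (\<pi> i)) k)
        \<le> a (\<pi> i) * (\<Sum>k<D. if L * b k < a (\<pi> i) then 0 else (cmod (e (\<pi> i) k))\<^sup>2)"
        using a(1)[OF \<pi>D[OF i]] by (rule mult_left_mono)
      also have "\<dots> = (\<Sum>k<D. if L * b k < a (\<pi> i) then 0 else a (\<pi> i) * (cmod (e (\<pi> i) k))\<^sup>2)"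
        unfolding sum_distrib_left by (intro sum.cong refl) simp
      finally show "a (\<pi> i) * nsq D (\<lambda>k. e (\<pi> i) k - ap D P (e (\<pi> i)) k)
        \<le> (\<Sum>k<D. if L * b k < a (\<pi> i) then 0 else a (\<pi> i) * (cmod (e (\<pi> i) k))\<^sup>2)" .
    qed
    also have "\<dots> = (\<Sum>i<D. \<Sum>k<D. if L * b k < a i then 0 else a i * (cmod (e i k))\<^sup>2)"
      by (rule sum.reindex_bij_betw[OF bij])
    finally show ?thesis .
  qed
  \<comment> \<open>On the support of \<open>h i\<close> the reference weight is at most
    \<open>a (\<pi> i) / L\<close>. Summing over \<open>i\<close> bounds the false-alarm probability
    Tr(sigma P) by 1 / L.\<close>
  have hbound: "(\<Sum>k<D. b k * (cmod (h i k))\<^sup>2) \<le> a (\<pi> i) / L" if i: "i < D" for i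
  proof -
    have "(\<Sum>k<D. b k * (cmod (h i k))\<^sup>2) \<le> (\<Sum>k<D. a (\<pi> i) / L * (cmod (h i k))\<^sup>2)"
    proof (rule sum_mono)
      fix k assume "k \<in> {..<D}"
      show "b k * (cmod (h i k))\<^sup>2 \<le> a (\<pi> i) / L * (cmod (h i k))\<^sup>2"
      proof (cases "h i k = 0")
        case False
        have "h i k = (\<Sum>j\<le>i. c i j * g j k)" using H(3) i by blast
        with False obtain j where "j \<le> i" "g j k \<noteq> 0"
          by (metis (no_types, lifting) atMost_iff mult_zero_right sum.neutral)
        then have "L * b k < a (\<pi> j)" "j \<le> i" by (auto simp: g_def split: if_splits)
        then have "L * b k \<le> a (\<pi> i)" using mono[OF _ i] by fastforce
        then have "b k \<le> a (\<pi> i) / L" using L by (simp add: field_simps)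
        then show ?thesis by (rule mult_right_mono) simp
      qed simp
    qed
    also have "\<dots> = a (\<pi> i) / L * nsq D (h i)" by (simp add: nsq_def sum_distrib_left)
    also have "\<dots> \<le> a (\<pi> i) / L * 1"
    proof (rule mult_left_mono)
      show "nsq D (h i) \<le> 1" using H(1) i by (auto simp: nsq_def)
      show "0 \<le> a (\<pi> i) / L" using a(1)[OF \<pi>D[OF i]] L by simp
    qed
    finally show ?thesis by simp
  qed
  have "(\<Sum>k<D. b k * Re (P k k)) = (\<Sum>k<D. \<Sum>i<D. b k * (cmod (h i k))\<^sup>2)"
  proof (rule sum.cong[OF refl])
    fix k
    have "P k k = complex_of_real (\<Sum>i<D. (cmod (h i k))\<^sup>2)"
      unfolding of_real_sum complex_norm_square P_def osum_def by simp
    then show "b k * Re (P k k) = (\<Sum>i<D. b k * (cmod (h i k))\<^sup>2)" by (simp add: sum_distrib_left)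
  qed
  also have "\<dots> = (\<Sum>i<D. \<Sum>k<D. b k * (cmod (h i k))\<^sup>2)" by (rule sum.swap)
  also have "\<dots> \<le> (\<Sum>i<D. a (\<pi> i) / L)" using hbound by (intro sum_mono) auto
  also have "\<dots> = (\<Sum>i<D. a i / L)" by (rule sum.reindex_bij_betw[OF bij])
  also have "\<dots> \<le> 1 / L" unfolding sum_divide_distrib[symmetric] using a(2) L by (intro divide_right_mono) auto
  finally show ?thesis using projP first by blast
qed

text \<open>\<open>E k\<close> is the matrix of \<open>Y^* Y\<close> for a map Y given only by its
  action, such as a product of projections. The two assumptions say that Y is linear and depends
  only on coordinates below D.\<close>

lemma effect_sum_forms:
  fixes Y :: "nat \<Rightarrow> (nat \<Rightarrow> complex) \<Rightarrow> nat \<Rightarrow> complex"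
  assumes lin: "\<And>k (I :: nat set) c v. Y k (\<lambda>j. \<Sum>i\<in>I. c i * v i j) = (\<lambda>j. \<Sum>i\<in>I. c i * Y k (v i) j)"
    and cong: "\<And>k u v j. (\<And>j. j < D \<Longrightarrow> u j = v j) \<Longrightarrow> j < D \<Longrightarrow> Y k u j = Y k v j"
  defines "E \<equiv> \<lambda>k i l. cin D (Y k (\<lambda>j. if j = i then 1 else 0)) (Y k (\<lambda>j. if j = l then 1 else 0))"
  shows "cin D v (ap D (E k) v) = of_real (nsq D (Y k v))" "herm D (E k)"
proof -
  let ?\<delta> = "\<lambda>i j. (if j = i then 1 else 0) :: complex"
  have "Y k v j = (\<Sum>i<D. v i * Y k (?\<delta> i) j)" if "j < D" for j
  proof -
    have "Y k v j = Y k (\<lambda>j. \<Sum>i<D. v i * ?\<delta> i j) j"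
      by (rule cong[OF _ that]) (simp add: if_distrib[of "(*) _"] cong: if_cong)
    then show ?thesis by (simp only: lin)
  qed
  then have "cin D (Y k v) (Y k v) = cin D (\<lambda>j. \<Sum>i<D. v i * Y k (?\<delta> i) j) (\<lambda>j. \<Sum>i<D. v i * Y k (?\<delta> i) j)"
    by (intro cin_cong) auto
  also have "\<dots> = (\<Sum>i<D. \<Sum>l<D. cnj (v i) * (v l * E k i l))"
    by (simp only: cin_sum_left cin_sum_right cin_scale_left cin_scale_right E_def sum_distrib_left)
  also have "\<dots> = cin D v (ap D (E k) v)"
    by (simp only: cin_ap mult_ac)
  finally show "cin D v (ap D (E k) v) = of_real (nsq D (Y k v))" by (simp add: cin_self)
  show "herm D (E k)" unfolding herm_def E_def by (simp add: cnj_cin)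
qed

section \<open>Greedy construction of a code\<close>

lemma ap_sum_mat: "ap D (\<lambda>i l. \<Sum>k\<in>B. E k i l) v = (\<lambda>j. \<Sum>k\<in>B. ap D (E k) v j)"
  unfolding ap_def sum_distrib_right by (intro ext sum.swap)

lemma trp_sum_right: "trp D A (\<lambda>i l. \<Sum>k\<in>B. E k i l) = (\<Sum>k\<in>B. trp D A (E k))"
proof -
  have "trp D A (\<lambda>i l. \<Sum>k\<in>B. E k i l) = (\<Sum>i<D. \<Sum>k\<in>B. \<Sum>j<D. A i j * E k j i)"
    unfolding trp_def sum_distrib_left by (intro sum.cong refl sum.swap)
  also have "\<dots> = (\<Sum>k\<in>B. trp D A (E k))" unfolding trp_def by (rule sum.swap)
  finally show ?thesis .
qed

text \<open>With sequential decoding the error of codeword \<open>k\<close> involves only the tests of the codewords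
  \<open>j \<le> k\<close>, so the code can be chosen greedily and no random coding over whole codebooks is needed.\<close>

theorem sequential_code:
  fixes a :: "'x \<Rightarrow> nat \<Rightarrow> real" and b :: "nat \<Rightarrow> real" and K :: nat
  assumes p: "is_dist S p" and L: "L > 0" and b: "\<And>k. k < D \<Longrightarrow> 0 \<le> b k"
    and e: "\<And>x. x \<in> S \<Longrightarrow> onb D (e x)"
    and a: "\<And>x i. x \<in> S \<Longrightarrow> i < D \<Longrightarrow> 0 \<le> a x i" "\<And>x. x \<in> S \<Longrightarrow> (\<Sum>i<D. a x i) = 1"
    and avg: "\<And>k k'. k < D \<Longrightarrow> k' < D \<Longrightarrow>
        (\<Sum>x\<in>S. of_real (p x) * osum D (a x) (e x) k k') = (if k = k' then of_real (b k) else 0)"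
    and \<eta>: "(\<Sum>x\<in>S. p x * (\<Sum>i<D. \<Sum>k<D. if L * b k < a x i then 0 else a x i * (cmod (e x i k))\<^sup>2)) \<le> \<eta>"
  shows "\<exists>u E. (\<forall>k<K. u k \<in> S) \<and> (\<forall>B\<subseteq>{..<K}. effect D (\<lambda>i l. \<Sum>k\<in>B. E k i l)) \<and>
     (\<forall>k<K. \<forall>x\<in>S. 0 \<le> Re (trp D (osum D (a x) (e x)) (E k))) \<and>
     (\<forall>k<K. 1 - 4 * (K / L + \<eta>) \<le> Re (trp D (osum D (a (u k)) (e (u k))) (E k)))"
proof -
  define A where "A = (\<lambda>x. osum D (a x) (e x))"
  define Pr where "Pr = (\<lambda>x P. projm D P \<and>
     (\<Sum>i<D. a x i * nsq D (\<lambda>k. e x i k - ap D P (e x i) k))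
        \<le> (\<Sum>i<D. \<Sum>k<D. if L * b k < a x i then 0 else a x i * (cmod (e x i k))\<^sup>2) \<and>
     (\<Sum>k<D. b k * Re (P k k)) \<le> 1 / L)"
  have "\<exists>P. Pr x P" if "x \<in> S" for x
    using likelihood_test[OF e[OF that] a(1)[OF that] _ L b] a(2)[OF that] unfolding Pr_def by simp
  then obtain P where Pr: "\<forall>x\<in>S. Pr x (P x)" using bchoice[of S Pr] by blast
  have P: "\<And>x. x \<in> S \<Longrightarrow> projm D (P x)"
    "\<And>x. x \<in> S \<Longrightarrow> (\<Sum>i<D. a x i * nsq D (\<lambda>k. e x i k - ap D (P x) (e x i) k))
        \<le> (\<Sum>i<D. \<Sum>k<D. if L * b k < a x i then 0 else a x i * (cmod (e x i k))\<^sup>2)"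
    "\<And>x. x \<in> S \<Longrightarrow> (\<Sum>k<D. b k * Re (P x k k)) \<le> 1 / L"
    using Pr unfolding Pr_def by blast+
  define t where "t = (\<lambda>x y. \<Sum>i<D. a x i * nsq D (ap D (P y) (e x i)))"
  define s where "s = (\<lambda>x. \<Sum>i<D. a x i * nsq D (\<lambda>k. e x i k - ap D (P x) (e x i) k))"
  have t_trp: "trp D (A x) (P y) = of_real (t x y)" if "y \<in> S" for x y
    unfolding A_def trp_osum t_def using nsq_projm[OF P(1)[OF that]] by simp
  \<comment> \<open>Averaged over the input, the output becomes the diagonal reference
    \<open>b\<close>, so the mean false alarm of any fixed test is Tr(sigma P), at most 1 /
    L.\<close>
  have t_avg: "(\<Sum>x\<in>S. p x * t x y) \<le> 1 / L" if y: "y \<in> S" for y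
  proof -
    have "complex_of_real (\<Sum>x\<in>S. p x * t x y) = (\<Sum>x\<in>S. \<Sum>k<D. \<Sum>k'<D. of_real (p x) * (A x k k' * P y k' k))"
      by (simp add: t_trp[OF y, symmetric] trp_def sum_distrib_left)
    also have "\<dots> = (\<Sum>k<D. \<Sum>x\<in>S. \<Sum>k'<D. of_real (p x) * (A x k k' * P y k' k))"
      by (rule sum.swap)
    also have "\<dots> = (\<Sum>k<D. \<Sum>k'<D. \<Sum>x\<in>S. of_real (p x) * (A x k k' * P y k' k))"
      by (rule sum.cong[OF refl], rule sum.swap)
    also have "\<dots> = (\<Sum>k<D. \<Sum>k'<D. (\<Sum>x\<in>S. of_real (p x) * A x k k') * P y k' k)"
      by (simp add: sum_distrib_right mult.assoc)
    also have "\<dots> = (\<Sum>k<D. \<Sum>k'<D. if k = k' then of_real (b k) * P y k' k else 0)"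
      using avg by (intro sum.cong refl) (auto simp: A_def)
    also have "\<dots> = (\<Sum>k<D. of_real (b k) * P y k k)" by simp
    finally have "Re (complex_of_real (\<Sum>x\<in>S. p x * t x y)) = Re (\<Sum>k<D. of_real (b k) * P y k k)" by simp
    then show ?thesis using P(3)[OF y] by simp
  qed
  have s_avg: "(\<Sum>x\<in>S. p x * s x) \<le> \<eta>"
    by (rule order_trans[OF sum_mono \<eta>]) (use p P(2) in \<open>auto simp: is_dist_def s_def intro!: mult_left_mono\<close>)
  \<comment> \<open>\<open>K / L\<close> pays for at most K earlier tests firing wrongly, \<eta> for
    the word's own test failing to fire.\<close>
  define R where "R = K / L + \<eta>"
  have "\<exists>u. \<forall>k<m. u k \<in> S \<and> (\<Sum>j<k. t (u k) (u j)) + s (u k) \<le> R" if "m \<le> K" for m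
    using that
  proof (induction m)
    case (Suc m)
    then obtain u where u: "\<And>k. k < m \<Longrightarrow> u k \<in> S" "\<And>k. k < m \<Longrightarrow> (\<Sum>j<k. t (u k) (u j)) + s (u k) \<le> R"
      by (metis Suc_leD)
    have "(\<Sum>x\<in>S. p x * ((\<Sum>j<m. t x (u j)) + s x)) = (\<Sum>j<m. \<Sum>x\<in>S. p x * t x (u j)) + (\<Sum>x\<in>S. p x * s x)"
      unfolding distrib_left sum.distrib sum_distrib_left by (simp add: sum.swap[of _ S])
    also have "\<dots> \<le> (\<Sum>j<m. 1 / L) + \<eta>"
      using u t_avg s_avg by (intro add_mono sum_mono) auto
    also have "\<dots> \<le> R" using Suc.prems L by (simp add: R_def divide_right_mono)
    finally have "(\<Sum>x\<in>S. p x * ((\<Sum>j<m. t x (u j)) + s x)) \<le> R" .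
    from exists_le_average[OF p this] obtain x where x: "x \<in> S" "(\<Sum>j<m. t x (u j)) + s x \<le> R"
      by blast
    show ?case
    proof (intro exI[of _ "u(m := x)"] allI impI)
      fix k assume "k < Suc m"
      then show "(u(m := x)) k \<in> S \<and> (\<Sum>j<k. t ((u(m := x)) k) ((u(m := x)) j)) + s ((u(m := x)) k) \<le> R"
        using u x by (cases "k = m") auto
    qed
  qed simp
  then obtain u where u: "\<And>k. k < K \<Longrightarrow> u k \<in> S" "\<And>k. k < K \<Longrightarrow> (\<Sum>j<k. t (u k) (u j)) + s (u k) \<le> R"
    by (metis order_refl)
  define Q where "Q = (\<lambda>j. P (u j))"
  have Q: "projm D (Q j)" if "j < K" for j using that u(1) P(1) by (simp add: Q_def)
  \<comment> \<open>The unnormalised state after \<open>k\<close> negative answers followed by a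
    positive answer to test \<open>k\<close>; \<open>E k\<close> is the corresponding decoding
    operator.\<close>
  define Y where "Y = (\<lambda>k v. ap D (Q k) (chi D Q k v))"
  define E where "E = (\<lambda>k i l. cin D (Y k (\<lambda>j. if j = i then 1 else 0)) (Y k (\<lambda>j. if j = l then 1 else 0)))"
  have lin: "Y k (\<lambda>j. \<Sum>i\<in>I. c i * v i j) = (\<lambda>j. \<Sum>i\<in>I. c i * Y k (v i) j)"
    for k and I :: "nat set" and c v
    unfolding Y_def chi_sum by (intro ext) (simp add: ap_sum ap_scale)
  have cong: "Y k u j = Y k v j" if "\<And>j. j < D \<Longrightarrow> u j = v j" "j < D" for k u v j
    unfolding Y_def by (rule fun_cong[where x = j], rule ap_cong, rule chi_cong[OF that(1)])
  have E_form: "cin D v (ap D (E k) v) = of_real (nsq D (Y k v))" and E_herm: "herm D (E k)" for k v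
    unfolding E_def using effect_sum_forms[where Y = Y and D = D, OF lin cong] by blast+
  \<comment> \<open>The positive outcomes and the final remainder \<open>chi D Q K v\<close> share
    out the norm of \<open>v\<close> exactly, so any subfamily of the \<open>E k\<close> sums to an
    effect.\<close>
  have total: "(\<Sum>k<K. nsq D (Y k v)) \<le> nsq D v" for v
    using chi_nsq[of K D Q v, OF Q] nsq_nonneg[of D "chi D Q K v"] unfolding Y_def by linarith
  have eff: "effect D (\<lambda>i l. \<Sum>k\<in>B. E k i l)" if B: "B \<subseteq> {..<K}" for B
  proof -
    have form: "cin D v (ap D (\<lambda>i l. \<Sum>k\<in>B. E k i l) v) = of_real (\<Sum>k\<in>B. nsq D (Y k v))" for v
      by (simp add: ap_sum_mat cin_sum_right E_form)
    have "herm D (\<lambda>i l. \<Sum>k\<in>B. E k i l)"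
      unfolding herm_def using hermD[OF E_herm] by simp
    moreover have "(\<Sum>k\<in>B. nsq D (Y k v)) \<le> nsq D v" for v
      by (rule order_trans[OF sum_mono2 total]) (use B in auto)
    ultimately show ?thesis unfolding effect_def form by (simp add: sum_nonneg)
  qed
  have E_trp: "Re (trp D (A x) (E k)) = (\<Sum>i<D. a x i * nsq D (Y k (e x i)))" for x k
    unfolding A_def trp_osum E_form by simp
  have "1 - 4 * R \<le> Re (trp D (A (u k)) (E k))" if k: "k < K" for k
  proof -
    define x where "x = u k"
    have x: "x \<in> S" using u(1) k by (simp add: x_def)
    have "1 - Re (trp D (A x) (E k)) = (\<Sum>i<D. a x i * (1 - nsq D (Y k (e x i))))"
      unfolding E_trp right_diff_distrib sum_subtractf using a(2)[OF x] by simp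
    also have "\<dots> \<le> (\<Sum>i<D. a x i * (4 * ((\<Sum>j<k. nsq D (ap D (Q j) (e x i))) + nsq D (\<lambda>l. e x i l - ap D (Q k) (e x i) l))))"
      unfolding Y_def
    proof (intro sum_mono mult_left_mono sequential_decoding)
      show "projm D (Q j)" if "j \<le> k" for j using Q that k by simp
    qed (use nsq_onb[OF e[OF x]] a(1)[OF x] in auto)
    also have "\<dots> = 4 * ((\<Sum>i<D. \<Sum>j<k. a x i * nsq D (ap D (Q j) (e x i))) + s x)"
      by (simp add: s_def x_def Q_def sum_distrib_left sum.distrib distrib_left mult_ac)
    also have "(\<Sum>i<D. \<Sum>j<k. a x i * nsq D (ap D (Q j) (e x i))) = (\<Sum>j<k. t x (u j))"
      unfolding t_def Q_def by (rule sum.swap)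
    also have "4 * ((\<Sum>j<k. t x (u j)) + s x) \<le> 4 * R" using u(2)[OF k] by (simp add: x_def)
    finally show ?thesis by (simp add: x_def)
  qed
  moreover have "0 \<le> Re (trp D (A x) (E k))" if "x \<in> S" for x k
    unfolding E_trp using a(1)[OF that] by (intro sum_nonneg mult_nonneg_nonneg) auto
  ultimately show ?thesis using u(1) eff unfolding A_def R_def by blast
qed

section \<open>Spectral decompositions of matrices and tensor powers\<close>

text \<open>A relation and not a chosen decomposition: eigenvalues may repeat and come in any order,
  so the decomposition picked inside \<open>mat_fun\<close> can be compared with the one at
  hand.\<close>

definition spec :: "nat \<Rightarrow> complex mat \<Rightarrow> (nat \<Rightarrow> real) \<Rightarrow> (nat \<Rightarrow> nat \<Rightarrow> complex) \<Rightarrow> bool" where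
  "spec D A l e \<longleftrightarrow> A \<in> carrier_mat D D \<and> onb D e \<and> (\<forall>k<D. \<forall>k'<D. A $$ (k,k') = osum D l e k k')"

lemma specD: "spec D A l e \<Longrightarrow> k < D \<Longrightarrow> k' < D \<Longrightarrow> A $$ (k,k') = osum D l e k k'"
  by (simp add: spec_def)

lemma spec_onb: "spec D A l e \<Longrightarrow> onb D e"
  by (simp add: spec_def)

lemma udu_index:
  assumes "U \<in> carrier_mat D D" "k < D" "k' < D"
  shows "(U * rdiag D l * cadj U) $$ (k,k') = osum D l (\<lambda>i k. U $$ (k,i)) k k'"
proof -
  have "(U * rdiag D l) $$ (k,i) = of_real (l i) * U $$ (k,i)" if "i < D" for i
  proof -
    have "(U * rdiag D l) $$ (k,i) = (\<Sum>j<D. U $$ (k,j) * (if j = i then of_real (l j) else 0))"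
      using assms that by (simp add: rdiag_def scalar_prod_def atLeast0LessThan)
    also have "\<dots> = (\<Sum>j<D. if j = i then U $$ (k,i) * of_real (l i) else 0)"
      by (intro sum.cong refl) simp
    finally show ?thesis using that by simp
  qed
  then show ?thesis using assms
    by (simp add: osum_def cadj_def scalar_prod_def atLeast0LessThan rdiag_def)
qed

lemma unitary_onb:
  assumes "U \<in> carrier_mat D D"
  shows "unitary_mat D U \<longleftrightarrow> onb D (\<lambda>i k. U $$ (k,i))"
proof -
  have eq: "(cadj U * U) $$ (i,j) = cin D (\<lambda>k. U $$ (k,i)) (\<lambda>k. U $$ (k,j))" if "i < D" "j < D" for i j
    using assms that by (simp add: cin_def cadj_def scalar_prod_def atLeast0LessThan)
  have dim: "cadj U * U \<in> carrier_mat D D" using assms by (auto simp: cadj_def)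
  have "cadj U * U = 1\<^sub>m D \<longleftrightarrow> (\<forall>i<D. \<forall>j<D. (cadj U * U) $$ (i,j) = (if i = j then 1 else 0))"
    using dim by (auto intro!: eq_matI)
  then show ?thesis using assms eq by (simp add: unitary_mat_def onb_def)
qed

lemma spec_iff_unitary:
  assumes "A \<in> carrier_mat D D"
  shows "spec D A l e \<longleftrightarrow> (\<exists>U. unitary_mat D U \<and> (\<forall>i<D. \<forall>k<D. e i k = U $$ (k,i)) \<and> A = U * rdiag D l * cadj U)"
proof
  assume s: "spec D A l e"
  define U where "U = mat D D (\<lambda>(k,i). e i k)"
  have U: "U \<in> carrier_mat D D" by (simp add: U_def)
  have eU: "e i k = U $$ (k,i)" if "i < D" "k < D" for i k using that by (simp add: U_def)
  have "onb D (\<lambda>i k. U $$ (k,i))"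
    using spec_onb[OF s] eU unfolding onb_def cin_def by simp
  then have "unitary_mat D U" using unitary_onb[OF U] by simp
  moreover have "A = U * rdiag D l * cadj U"
  proof (rule eq_matI)
    fix k k' assume "k < dim_row (U * rdiag D l * cadj U)" "k' < dim_col (U * rdiag D l * cadj U)"
    then have kk: "k < D" "k' < D" using U by (auto simp: cadj_def)
    show "A $$ (k,k') = (U * rdiag D l * cadj U) $$ (k,k')"
      unfolding udu_index[OF U kk] specD[OF s kk] using eU kk by (simp add: osum_def)
  qed (use assms U in \<open>auto simp: cadj_def\<close>)
  ultimately show "\<exists>U. unitary_mat D U \<and> (\<forall>i<D. \<forall>k<D. e i k = U $$ (k,i)) \<and> A = U * rdiag D l * cadj U"
    using eU by blast
next
  assume "\<exists>U. unitary_mat D U \<and> (\<forall>i<D. \<forall>k<D. e i k = U $$ (k,i)) \<and> A = U * rdiag D l * cadj U"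
  then obtain U where U: "unitary_mat D U" "\<And>i k. i < D \<Longrightarrow> k < D \<Longrightarrow> e i k = U $$ (k,i)"
    "A = U * rdiag D l * cadj U" by blast
  have c: "U \<in> carrier_mat D D" using U(1) by (simp add: unitary_mat_def)
  have "onb D e" using U(1) U(2) unitary_onb[OF c] unfolding onb_def cin_def by simp
  moreover have "A $$ (k,k') = osum D l e k k'" if "k < D" "k' < D" for k k'
    unfolding U(3) udu_index[OF c that] using U(2) that by (simp add: osum_def)
  ultimately show "spec D A l e" using assms by (simp add: spec_def)
qed

lemma cadj_index: "A \<in> carrier_mat D D \<Longrightarrow> i < D \<Longrightarrow> j < D \<Longrightarrow> cadj A $$ (i,j) = cnj (A $$ (j,i))"
  by (simp add: cadj_def)

lemma herm_mat:
  assumes "A \<in> carrier_mat D D"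
  shows "cadj A = A \<longleftrightarrow> herm D (\<lambda>i j. A $$ (i,j))"
proof
  assume eq: "cadj A = A"
  show "herm D (\<lambda>i j. A $$ (i,j))" unfolding herm_def
  proof (intro allI impI)
    fix i j assume "i < D" "j < D"
    then show "A $$ (j,i) = cnj (A $$ (i,j))" using cadj_index[OF assms, of j i] eq by simp
  qed
next
  assume h: "herm D (\<lambda>i j. A $$ (i,j))"
  show "cadj A = A"
  proof (rule eq_matI)
    fix i j assume "i < dim_row A" "j < dim_col A"
    then have "i < D" "j < D" using assms by auto
    then show "cadj A $$ (i,j) = A $$ (i,j)" using cadj_index[OF assms] hermD[OF h] by simp
  qed (use assms in \<open>auto simp: cadj_def\<close>)
qed

lemma spec_exists:
  assumes "A \<in> carrier_mat D D" "cadj A = A"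
  shows "\<exists>l e. spec D A l e"
proof -
  have "herm D (\<lambda>i j. A $$ (i,j))" using assms herm_mat by blast
  then show ?thesis
  proof (rule spectral_decomposition)
    fix e l assume "onb D e" "\<And>k k'. k < D \<Longrightarrow> k' < D \<Longrightarrow> A $$ (k,k') = osum D l e k k'"
    then have "spec D A l e" using assms(1) by (simp add: spec_def)
    then show ?thesis by blast
  qed
qed

text \<open>Evaluating the common operator between \<open>e i\<close> and \<open>e' j\<close> shows
  that their overlap vanishes unless \<open>l i = l' j\<close>; on nonzero overlaps
  \<open>f (l i)\<close> may therefore be exchanged for \<open>f (l' j)\<close>. This makes the
  choice in \<open>mat_fun\<close> immaterial, and later identifies limit states given by different
  eigenbases.\<close>

lemma functional_calculus_unique:
  assumes e: "onb D e" and e': "onb D e'"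
    and eq: "\<And>k k'. k < D \<Longrightarrow> k' < D \<Longrightarrow> osum D l e k k' = osum D l' e' k k'"
    and kk: "k < D" "k' < D"
  shows "osum D (\<lambda>i. f (l i)) e k k' = osum D (\<lambda>i. f (l' i)) e' k k'"
proof -
  define c where "c = (\<lambda>i j. cin D (e i) (e' j))"
  have cf: "of_real (f (l i)) * c i j = of_real (f (l' j)) * c i j" if ij: "i < D" "j < D" for i j
  proof -
    have "cin D (e i) (ap D (osum D l e) (e' j)) = (\<Sum>r<D. of_real (l r) * cin D (e i) (e r) * cin D (e r) (e' j))"
      by (rule cin_ap_osum)
    also have "\<dots> = of_real (l i) * c i j"
      using e ij by (subst sum.remove[of _ i]) (auto simp: onb_def c_def intro!: sum.neutral)
    finally have 1: "cin D (e i) (ap D (osum D l e) (e' j)) = of_real (l i) * c i j" .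
    have "cin D (e i) (ap D (osum D l' e') (e' j)) = (\<Sum>r<D. of_real (l' r) * cin D (e i) (e' r) * cin D (e' r) (e' j))"
      by (rule cin_ap_osum)
    also have "\<dots> = of_real (l' j) * c i j"
      using e' ij by (subst sum.remove[of _ j]) (auto simp: onb_def c_def intro!: sum.neutral)
    finally have 2: "cin D (e i) (ap D (osum D l' e') (e' j)) = of_real (l' j) * c i j" .
    have "cin D (e i) (ap D (osum D l e) (e' j)) = cin D (e i) (ap D (osum D l' e') (e' j))"
      unfolding cin_ap using eq by (intro sum.cong refl) simp
    then have "of_real (l i) * c i j = of_real (l' j) * c i j" using 1 2 by simp
    then have "l i = l' j \<or> c i j = 0" by (metis mult_right_cancel of_real_eq_iff)
    then show ?thesis by auto
  qed
  have ex: "e i k = (\<Sum>j<D. cnj (c i j) * e' j k)" if "k < D" for i k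
    using onb_Parseval[OF e', of "\<lambda>r. if r = k then 1 else 0" "e i"] that
    by (simp add: cin_delta_left c_def cnj_cin mult.commute)
  have ex': "e' j k = (\<Sum>i<D. c i j * e i k)" if "k < D" for j k
    using onb_Parseval[OF e, of "\<lambda>r. if r = k then 1 else 0" "e' j"] that
    by (simp add: cin_delta_left c_def mult.commute)
  have "osum D (\<lambda>i. f (l i)) e k k' = (\<Sum>i<D. \<Sum>j<D. of_real (f (l i)) * cnj (c i j) * e' j k * cnj (e i k'))"
    unfolding osum_def using ex[OF kk(1)] by (simp add: sum_distrib_left sum_distrib_right mult.assoc)
  also have "\<dots> = (\<Sum>i<D. \<Sum>j<D. of_real (f (l' j)) * cnj (c i j) * e' j k * cnj (e i k'))"
  proof (intro sum.cong refl)
    fix i j assume "i \<in> {..<D}" "j \<in> {..<D}"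
    then have "cnj (of_real (f (l i)) * c i j) = cnj (of_real (f (l' j)) * c i j)" using cf by simp
    then show "of_real (f (l i)) * cnj (c i j) * e' j k * cnj (e i k') =
       of_real (f (l' j)) * cnj (c i j) * e' j k * cnj (e i k')" by simp
  qed
  also have "\<dots> = (\<Sum>j<D. \<Sum>i<D. of_real (f (l' j)) * cnj (c i j) * e' j k * cnj (e i k'))"
    by (rule sum.swap)
  also have "\<dots> = osum D (\<lambda>i. f (l' i)) e' k k'"
    unfolding osum_def ex'[OF kk(2)] by (simp add: sum_distrib_left mult_ac)
  finally show ?thesis .
qed

lemma mat_fun_spec:
  assumes s: "spec D A l e"
  shows "spec D (mat_fun f A) (\<lambda>i. f (l i)) e"
proof -
  have A: "A \<in> carrier_mat D D" using s by (simp add: spec_def)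
  then have D: "dim_row A = D" by simp
  have "\<exists>B U l. unitary_mat (dim_row A) U \<and> A = U * rdiag (dim_row A) l * cadj U \<and>
        B = U * rdiag (dim_row A) (\<lambda>i. f (l i)) * cadj U"
    using s unfolding spec_iff_unitary[OF A] D by blast
  then have "\<exists>U l. unitary_mat D U \<and> A = U * rdiag D l * cadj U \<and>
        mat_fun f A = U * rdiag D (\<lambda>i. f (l i)) * cadj U"
    unfolding mat_fun_def D by (rule someI_ex)
  then obtain U l' where U: "unitary_mat D U" "A = U * rdiag D l' * cadj U"
    "mat_fun f A = U * rdiag D (\<lambda>i. f (l' i)) * cadj U" by blast
  define e' where "e' = (\<lambda>i k. U $$ (k,i))"
  have c: "U \<in> carrier_mat D D" using U(1) by (simp add: unitary_mat_def)
  have mA: "mat_fun f A \<in> carrier_mat D D" unfolding U(3) using c by (auto simp: cadj_def)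
  have s': "spec D A l' e'" unfolding spec_iff_unitary[OF A] using U by (auto simp: e'_def)
  have "mat_fun f A $$ (k,k') = osum D (\<lambda>i. f (l i)) e k k'" if "k < D" "k' < D" for k k'
  proof -
    have "mat_fun f A $$ (k,k') = osum D (\<lambda>i. f (l' i)) e' k k'"
      unfolding U(3) e'_def by (rule udu_index[OF c that])
    also have "\<dots> = osum D (\<lambda>i. f (l i)) e k k'"
      by (rule functional_calculus_unique[OF spec_onb[OF s'] spec_onb[OF s] _ that])
        (simp add: specD[OF s, symmetric] specD[OF s', symmetric])
    finally show ?thesis .
  qed
  then show ?thesis using mA spec_onb[OF s] by (simp add: spec_def)
qed

lemma mtrace_mult:
  assumes "A \<in> carrier_mat D D" "B \<in> carrier_mat D D"
  shows "mtrace (A * B) = trp D (\<lambda>i j. A $$ (i,j)) (\<lambda>i j. B $$ (i,j))"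
  using assms by (simp add: mtrace_def trp_def scalar_prod_def atLeast0LessThan)

lemma mtrace_spec:
  assumes "spec D A l e"
  shows "mtrace A = of_real (\<Sum>i<D. l i)"
proof -
  have D: "dim_row A = D" using assms by (auto simp: spec_def)
  have "mtrace A = (\<Sum>k<D. \<Sum>i<D. of_real (l i) * (cnj (e i k) * e i k))"
    unfolding mtrace_def D using specD[OF assms] by (simp add: osum_def mult_ac)
  also have "\<dots> = (\<Sum>i<D. \<Sum>k<D. of_real (l i) * (cnj (e i k) * e i k))" by (rule sum.swap)
  also have "\<dots> = (\<Sum>i<D. of_real (l i) * cin D (e i) (e i))" by (simp add: cin_def sum_distrib_left)
  also have "\<dots> = (\<Sum>i<D. of_real (l i))"
    using spec_onb[OF assms] by (intro sum.cong refl) (simp add: onb_def)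
  finally show ?thesis by simp
qed

lemma psd_spec_nonneg:
  assumes "psd D A" "spec D A l e" "i < D"
  shows "0 \<le> l i"
proof -
  have A: "A \<in> carrier_mat D D" using assms(1) by (simp add: psd_def)
  have "qform A (e i) = cin D (e i) (ap D (\<lambda>k k'. A $$ (k,k')) (e i))"
    using A by (simp add: qform_def cin_ap)
  also have "\<dots> = cin D (e i) (ap D (osum D l e) (e i))"
    unfolding cin_ap using specD[OF assms(2)] by (intro sum.cong refl) simp
  also have "\<dots> = (\<Sum>r<D. of_real (l r) * cin D (e i) (e r) * cin D (e r) (e i))" by (rule cin_ap_osum)
  also have "\<dots> = of_real (l i)"
    using spec_onb[OF assms(2)] assms(3)
    by (subst sum.remove[of _ i]) (auto simp: onb_def intro!: sum.neutral)
  finally show ?thesis using assms(1) unfolding psd_def by (metis Re_complex_of_real)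
qed

lemma density_spec:
  assumes "density D A" "spec D A l e"
  shows "\<And>i. i < D \<Longrightarrow> 0 \<le> l i" "(\<Sum>i<D. l i) = 1"
proof -
  show "\<And>i. i < D \<Longrightarrow> 0 \<le> l i" using assms psd_spec_nonneg by (auto simp: density_def)
  have "complex_of_real (\<Sum>i<D. l i) = 1" using assms mtrace_spec[OF assms(2)] by (simp add: density_def)
  then show "(\<Sum>i<D. l i) = 1" using of_real_eq_1_iff by blast
qed

lemma trp_osum_osum:
  "trp D (osum D a e) (osum D m f) = of_real (\<Sum>i<D. \<Sum>k<D. a i * m k * (cmod (cin D (f k) (e i)))\<^sup>2)"
  unfolding trp_osum cin_ap_osum of_real_sum of_real_mult complex_norm_square cnj_cin
  by (simp add: sum_distrib_left mult_ac)

lemma rel_entropy_spec: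
  assumes "spec D A a e" "spec D B m f"
  shows "rel_entropy A B = (\<Sum>i<D. a i * log 2 (a i))
     - (\<Sum>i<D. \<Sum>k<D. a i * log 2 (m k) * (cmod (cin D (f k) (e i)))\<^sup>2)"
proof -
  let ?LA = "mat_fun (log 2) A" and ?LB = "mat_fun (log 2) B"
  have LA: "spec D ?LA (\<lambda>i. log 2 (a i)) e" and LB: "spec D ?LB (\<lambda>i. log 2 (m i)) f"
    using assms by (auto intro: mat_fun_spec)
  have c: "A \<in> carrier_mat D D" "?LA \<in> carrier_mat D D" "?LB \<in> carrier_mat D D"
    using assms LA LB by (auto simp: spec_def)
  have "mtrace (A * (?LA - ?LB)) = trp D (\<lambda>i j. A $$ (i,j)) (\<lambda>i j. (?LA - ?LB) $$ (i,j))"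
    using c by (intro mtrace_mult) auto
  also have "\<dots> = trp D (\<lambda>i j. A $$ (i,j)) (\<lambda>i j. ?LA $$ (i,j)) - trp D (\<lambda>i j. A $$ (i,j)) (\<lambda>i j. ?LB $$ (i,j))"
    using c by (simp add: trp_def right_diff_distrib sum_subtractf)
  also have "trp D (\<lambda>i j. A $$ (i,j)) (\<lambda>i j. ?LA $$ (i,j)) = trp D (osum D a e) (osum D (\<lambda>i. log 2 (a i)) e)"
    using specD[OF assms(1)] specD[OF LA] by (intro trp_cong)
  also have "\<dots> = of_real (\<Sum>i<D. \<Sum>k<D. a i * log 2 (a k) * (cmod (cin D (e k) (e i)))\<^sup>2)"
    by (rule trp_osum_osum)
  also have "(\<Sum>i<D. \<Sum>k<D. a i * log 2 (a k) * (cmod (cin D (e k) (e i)))\<^sup>2) = (\<Sum>i<D. \<Sum>k<D. if k = i then a i * log 2 (a i) else 0)"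
    using spec_onb[OF assms(1)] by (intro sum.cong refl) (auto simp: onb_def)
  also have "\<dots> = (\<Sum>i<D. a i * log 2 (a i))" by simp
  also have "trp D (\<lambda>i j. A $$ (i,j)) (\<lambda>i j. ?LB $$ (i,j)) = trp D (osum D a e) (osum D (\<lambda>i. log 2 (m i)) f)"
    using specD[OF assms(1)] specD[OF LB] by (intro trp_cong)
  also have "\<dots> = of_real (\<Sum>i<D. \<Sum>k<D. a i * log 2 (m k) * (cmod (cin D (f k) (e i)))\<^sup>2)"
    by (rule trp_osum_osum)
  finally show ?thesis unfolding rel_entropy_def by (simp only: minus_complex.sel Re_complex_of_real)
qed

subsection \<open>Trace norm\<close>

text \<open>The basis diagonalises \<open>cadj A * A\<close>, whose eigenvalue at \<open>u i\<close>
  is the squared length of \<open>A (u i)\<close>. The trace norm becomes a sum of lengths, the form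
  in which all bounds below use it.\<close>

lemma trace_norm_basis:
  assumes A: "A \<in> carrier_mat D D"
  shows "\<exists>u. onb D u \<and> trace_norm A = (\<Sum>i<D. sqrt (nsq D (ap D (\<lambda>k k'. A $$ (k,k')) (u i))))"
proof -
  let ?A = "\<lambda>k k'. A $$ (k,k')"
  define B where "B = cadj A * A"
  have B: "B \<in> carrier_mat D D" using A by (auto simp: B_def cadj_def)
  have Bi: "B $$ (i,j) = (\<Sum>k<D. cnj (A $$ (k,i)) * A $$ (k,j))" if "i < D" "j < D" for i j
    using A that by (simp add: B_def cadj_def scalar_prod_def atLeast0LessThan)
  have "cadj B = B" unfolding herm_mat[OF B] herm_def by (simp add: Bi mult.commute)
  from spec_exists[OF B this] obtain l u where s: "spec D B l u" by blast
  have l: "l i = nsq D (ap D ?A (u i))" if i: "i < D" for i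
  proof -
    have "cin D (u i) (ap D (\<lambda>k k'. B $$ (k,k')) (u i)) = cin D (u i) (ap D (osum D l u) (u i))"
      unfolding cin_ap using specD[OF s] by (intro sum.cong refl) simp
    also have "\<dots> = (\<Sum>r<D. of_real (l r) * cin D (u i) (u r) * cin D (u r) (u i))" by (rule cin_ap_osum)
    also have "\<dots> = of_real (l i)"
      using spec_onb[OF s] i by (subst sum.remove[of _ i]) (auto simp: onb_def intro!: sum.neutral)
    finally have 1: "cin D (u i) (ap D (\<lambda>k k'. B $$ (k,k')) (u i)) = of_real (l i)" .
    have "cin D (u i) (ap D (\<lambda>k k'. B $$ (k,k')) (u i))
       = (\<Sum>j<D. \<Sum>j'<D. \<Sum>k<D. cnj (A $$ (k,j) * u i j) * (A $$ (k,j') * u i j'))"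
      unfolding cin_ap by (intro sum.cong refl) (simp add: Bi sum_distrib_left sum_distrib_right mult_ac)
    also have "\<dots> = (\<Sum>j<D. \<Sum>k<D. \<Sum>j'<D. cnj (A $$ (k,j) * u i j) * (A $$ (k,j') * u i j'))"
      by (rule sum.cong[OF refl], rule sum.swap)
    also have "\<dots> = (\<Sum>k<D. \<Sum>j<D. \<Sum>j'<D. cnj (A $$ (k,j) * u i j) * (A $$ (k,j') * u i j'))"
      by (rule sum.swap)
    also have "\<dots> = cin D (ap D ?A (u i)) (ap D ?A (u i))"
      unfolding cin_def[of D "ap D ?A (u i)"] unfolding ap_def cnj_sum sum_product ..
    finally have "complex_of_real (l i) = of_real (nsq D (ap D ?A (u i)))" using 1 by (simp add: cin_self)
    then show ?thesis using of_real_eq_iff by blast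
  qed
  have "mtrace (mat_fun sqrt B) = of_real (\<Sum>i<D. sqrt (l i))"
    by (rule mtrace_spec[OF mat_fun_spec[OF s]])
  then have "trace_norm A = (\<Sum>i<D. sqrt (nsq D (ap D ?A (u i))))"
    unfolding trace_norm_def B_def[symmetric] using l by simp
  then show ?thesis using spec_onb[OF s] by blast
qed

lemma trace_norm_nonneg: "A \<in> carrier_mat D D \<Longrightarrow> 0 \<le> trace_norm A"
  using trace_norm_basis[of A D] by (auto intro!: sum_nonneg)

lemma nsq_ap_le: "nsq D (ap D A v) \<le> (\<Sum>k<D. \<Sum>k'<D. (cmod (A k k'))\<^sup>2) * nsq D v"
proof -
  have "nsq D (ap D A v) \<le> (\<Sum>k<D. (\<Sum>k'<D. (cmod (A k k'))\<^sup>2) * nsq D v)"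
    unfolding nsq_def[of D "ap D A v"]
  proof (rule sum_mono)
    fix k
    have "ap D A v k = cin D (\<lambda>k'. cnj (A k k')) v" by (simp add: ap_def cin_def)
    then show "(cmod (ap D A v k))\<^sup>2 \<le> (\<Sum>k'<D. (cmod (A k k'))\<^sup>2) * nsq D v"
      using cin_Cauchy_Schwarz[of D "\<lambda>k'. cnj (A k k')" v] by (simp add: nsq_def[of D "\<lambda>k'. cnj (A k k')"])
  qed
  then show ?thesis by (simp add: sum_distrib_right)
qed

lemma trace_norm_le_entries:
  assumes A: "A \<in> carrier_mat D D" and c: "\<And>k k'. k < D \<Longrightarrow> k' < D \<Longrightarrow> cmod (A $$ (k,k')) \<le> c" "0 \<le> c"
  shows "trace_norm A \<le> real D * real D * c"
proof -
  obtain u where u: "onb D u" "trace_norm A = (\<Sum>i<D. sqrt (nsq D (ap D (\<lambda>k k'. A $$ (k,k')) (u i))))"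
    using trace_norm_basis[OF A] by blast
  have "sqrt (nsq D (ap D (\<lambda>k k'. A $$ (k,k')) (u i))) \<le> real D * c" if "i < D" for i
  proof (rule real_le_lsqrt)
    have "nsq D (ap D (\<lambda>k k'. A $$ (k,k')) (u i)) \<le> (\<Sum>k<D. \<Sum>k'<D. (cmod (A $$ (k,k')))\<^sup>2)"
      using nsq_ap_le[of D "\<lambda>k k'. A $$ (k,k')" "u i"] nsq_onb[OF u(1) that] by simp
    also have "\<dots> \<le> (\<Sum>k<D. \<Sum>k'<D. c\<^sup>2)" using c by (intro sum_mono power_mono) auto
    finally show "nsq D (ap D (\<lambda>k k'. A $$ (k,k')) (u i)) \<le> (real D * c)\<^sup>2"
      by (simp add: power2_eq_square mult_ac)
  qed (use c in auto)
  then have "trace_norm A \<le> (\<Sum>i<D. real D * c)" unfolding u(2) by (intro sum_mono) auto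
  then show ?thesis by simp
qed

lemma trp_basis:
  assumes "onb D u"
  shows "trp D A B = (\<Sum>i<D. cin D (u i) (ap D A (ap D B (u i))))"
proof -
  have "(\<Sum>i<D. cin D (u i) (ap D A (ap D B (u i))))
     = (\<Sum>i<D. \<Sum>k<D. \<Sum>j<D. \<Sum>m<D. A k j * B j m * (u i m * cnj (u i k)))"
    unfolding cin_ap by (simp add: ap_def sum_distrib_left mult_ac)
  also have "\<dots> = (\<Sum>k<D. \<Sum>i<D. \<Sum>j<D. \<Sum>m<D. A k j * B j m * (u i m * cnj (u i k)))"
    by (rule sum.swap)
  also have "\<dots> = (\<Sum>k<D. \<Sum>j<D. \<Sum>i<D. \<Sum>m<D. A k j * B j m * (u i m * cnj (u i k)))"
    by (rule sum.cong[OF refl], rule sum.swap)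
  also have "\<dots> = (\<Sum>k<D. \<Sum>j<D. \<Sum>m<D. \<Sum>i<D. A k j * B j m * (u i m * cnj (u i k)))"
    by (rule sum.cong[OF refl], rule sum.cong[OF refl], rule sum.swap)
  also have "\<dots> = (\<Sum>k<D. \<Sum>j<D. \<Sum>m<D. if m = k then A k j * B j k else 0)"
    unfolding sum_distrib_left[symmetric] using onb_complete[OF assms] by (intro sum.cong refl) auto
  also have "\<dots> = trp D A B" by (simp add: trp_def)
  finally show ?thesis by simp
qed

text \<open>As A has trace zero, \<open>2 Tr(A E) = Tr(A (2 E - 1))\<close>. Expanding in the basis
  of \<open>trace_norm_basis\<close>, each term is at most the length of \<open>A (u i)\<close>
  because \<open>2 E - 1\<close> is a contraction.\<close>

lemma trace_norm_ge:
  assumes A: "A \<in> carrier_mat D D" and H: "herm D (\<lambda>k k'. A $$ (k,k'))" and tr: "mtrace A = 0"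
    and E: "effect D E"
  shows "2 * Re (trp D (\<lambda>k k'. A $$ (k,k')) E) \<le> trace_norm A"
proof -
  let ?A = "\<lambda>k k'. A $$ (k,k')"
  obtain u where u: "onb D u" "trace_norm A = (\<Sum>i<D. sqrt (nsq D (ap D ?A (u i))))"
    using trace_norm_basis[OF A] by blast
  let ?I = "\<lambda>i j. if i = j then 1 else 0 :: complex"
  have "trp D ?A ?I = mtrace A"
    using A by (simp add: trp_def mtrace_def if_distrib[of "(*) _"] cong: if_cong)
  then have "(\<Sum>i<D. cin D (u i) (ap D ?A (ap D ?I (u i)))) = 0" using trp_basis[OF u(1), of ?A ?I] tr by simp
  moreover have "ap D ?A (ap D ?I (u i)) = ap D ?A (u i)" for i
    by (intro ap_cong) (simp add: ap_def if_distrib[of "\<lambda>x. x * _"] cong: if_cong)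
  ultimately have z: "(\<Sum>i<D. cin D (u i) (ap D ?A (u i))) = 0" by simp
  have "2 * trp D ?A E = (\<Sum>i<D. 2 * cin D (u i) (ap D ?A (ap D E (u i))) - cin D (u i) (ap D ?A (u i)))"
    by (simp add: trp_basis[OF u(1)] sum_subtractf z sum_distrib_left)
  also have "\<dots> = (\<Sum>i<D. cin D (ap D ?A (u i)) (\<lambda>k. 2 * ap D E (u i) k - u i k))"
    by (simp add: cin_diff_right cin_scale_right herm_cin_ap[OF H])
  finally have "Re (2 * trp D ?A E) = Re (\<Sum>i<D. cin D (ap D ?A (u i)) (\<lambda>k. 2 * ap D E (u i) k - u i k))"
    by (rule arg_cong)
  then have "2 * Re (trp D ?A E) = Re (\<Sum>i<D. cin D (ap D ?A (u i)) (\<lambda>k. 2 * ap D E (u i) k - u i k))"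
    by simp
  also have "\<dots> \<le> (\<Sum>i<D. cmod (cin D (ap D ?A (u i)) (\<lambda>k. 2 * ap D E (u i) k - u i k)))"
    by (rule order_trans[OF complex_Re_le_cmod norm_sum])
  also have "\<dots> \<le> (\<Sum>i<D. sqrt (nsq D (ap D ?A (u i))) * 1)"
  proof (rule sum_mono)
    fix i assume "i \<in> {..<D}"
    then have "nsq D (\<lambda>k. 2 * ap D E (u i) k - u i k) \<le> 1"
      using effect_refl_contraction[OF E, of "u i"] nsq_onb[OF u(1), of i] by simp
    then show "cmod (cin D (ap D ?A (u i)) (\<lambda>k. 2 * ap D E (u i) k - u i k)) \<le> sqrt (nsq D (ap D ?A (u i))) * 1"
      by (intro order_trans[OF cmod_cin_le] mult_left_mono) auto
  qed
  finally show ?thesis using u(2) by simp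
qed

subsection \<open>Tensor powers\<close>

text \<open>Eigenvectors and eigenvalues of a tensor product, indexed as in \<open>kron\<close>.\<close>

primrec te :: "nat \<Rightarrow> ('x \<Rightarrow> nat \<Rightarrow> nat \<Rightarrow> complex) \<Rightarrow> 'x list \<Rightarrow> nat \<Rightarrow> nat \<Rightarrow> complex" where
  "te d e [] = (\<lambda>i k. 1)"
| "te d e (x # xs) = (\<lambda>i k. e x (i div d ^ length xs) (k div d ^ length xs) *
      te d e xs (i mod d ^ length xs) (k mod d ^ length xs))"

primrec tv :: "nat \<Rightarrow> ('x \<Rightarrow> nat \<Rightarrow> real) \<Rightarrow> 'x list \<Rightarrow> nat \<Rightarrow> real" where
  "tv d a [] = (\<lambda>i. 1)"
| "tv d a (x # xs) = (\<lambda>i. a x (i div d ^ length xs) * tv d a xs (i mod d ^ length xs))"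

lemma sum_div_mod:
  fixes f :: "nat \<Rightarrow> nat \<Rightarrow> 'a::comm_monoid_add"
  shows "(\<Sum>i<m * n. f (i div n) (i mod n)) = (\<Sum>i<m. \<Sum>j<n. f i j)"
proof -
  have "(\<Sum>i<m * n. f (i div n) (i mod n)) = (\<Sum>i<m. \<Sum>r\<in>{i * n..<i * n + n}. f (r div n) (r mod n))"
    by (rule sum.nat_group[symmetric])
  also have "\<dots> = (\<Sum>i<m. \<Sum>j<n. f i j)"
  proof (rule sum.cong[OF refl])
    fix i
    show "(\<Sum>r\<in>{i * n..<i * n + n}. f (r div n) (r mod n)) = (\<Sum>j<n. f i j)"
    proof (rule sum.reindex_bij_witness[of _ "\<lambda>j. i * n + j" "\<lambda>r. r - i * n"])
      fix r assume r: "r \<in> {i * n..<i * n + n}"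
      define j where "j = r - i * n"
      have "r = i * n + j" "j < n" using r by (auto simp: j_def)
      then show "f i (r - i * n) = f (r div n) (r mod n)" by simp
    qed auto
  qed
  finally show ?thesis .
qed

lemma cin_tensor:
  "cin (m * n) (\<lambda>k. u (k div n) * v (k mod n)) (\<lambda>k. u' (k div n) * v' (k mod n)) = cin m u u' * cin n v v'"
  unfolding cin_def
  by (subst sum_div_mod[of "\<lambda>i j. cnj (u i * v j) * (u' i * v' j)"]) (simp add: sum_product mult_ac)

lemma div_mod_bounds:
  fixes i :: nat
  assumes "i < m * n"
  shows "i div n < m" "i mod n < n"
proof -
  show "i div n < m" using assms by (simp add: less_mult_imp_div_less)
  have "n > 0" using assms by (cases n) auto
  then show "i mod n < n" by simp
qed

lemma div_mod_eq_iff: "(i div n = j div n \<and> i mod n = j mod n) \<longleftrightarrow> i = (j::nat)"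
  by (metis div_mult_mod_eq)

lemma onb_te:
  assumes "\<And>x. onb d (e x)"
  shows "onb (d ^ length xs) (te d e xs)"
proof (induction xs)
  case Nil
  show ?case by (simp add: onb_def cin_def)
next
  case (Cons x xs)
  let ?n = "d ^ length xs"
  show ?case unfolding onb_def
  proof (intro allI impI)
    fix i j assume ij: "i < d ^ length (x # xs)" "j < d ^ length (x # xs)"
    then have ij': "i < d * ?n" "j < d * ?n" by auto
    note bi = div_mod_bounds[OF ij'(1)] and bj = div_mod_bounds[OF ij'(2)]
    have "cin (d ^ length (x # xs)) (te d e (x # xs) i) (te d e (x # xs) j)
      = cin d (e x (i div ?n)) (e x (j div ?n)) * cin ?n (te d e xs (i mod ?n)) (te d e xs (j mod ?n))"
      by (simp add: cin_tensor)
    also have "\<dots> = (if i div ?n = j div ?n then 1 else 0) * (if i mod ?n = j mod ?n then 1 else 0)"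
      using assms[of x] Cons.IH bi bj unfolding onb_def by simp
    also have "\<dots> = (if i = j then 1 else 0)" using div_mod_eq_iff[of i ?n j] by auto
    finally show "cin (d ^ length (x # xs)) (te d e (x # xs) i) (te d e (x # xs) j) = (if i = j then 1 else 0)" .
  qed
qed

lemma tpow_Nil: "tpow W [] = 1\<^sub>m 1"
  by (simp add: tpow_def tensor_list_def)

lemma tpow_Cons: "tpow W (x # xs) = kron (W x) (tpow W xs)"
  by (simp add: tpow_def tensor_list_def)

lemma tpow_carrier:
  assumes "\<And>x. W x \<in> carrier_mat d d"
  shows "tpow W xs \<in> carrier_mat (d ^ length xs) (d ^ length xs)"
proof (induction xs)
  case (Cons x xs)
  then show ?case using assms[of x] by (auto simp: tpow_Cons kron_def)
qed (simp add: tpow_Nil)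

lemma tpow_Cons_index:
  assumes "\<And>x. W x \<in> carrier_mat d d" "i < d ^ length (x # xs)" "j < d ^ length (x # xs)"
  shows "tpow W (x # xs) $$ (i,j) = W x $$ (i div d ^ length xs, j div d ^ length xs) *
     tpow W xs $$ (i mod d ^ length xs, j mod d ^ length xs)"
  using tpow_carrier[of W d xs, OF assms(1)] assms(1)[of x] assms(2,3) by (simp add: tpow_Cons kron_def)

lemma tpow_spec:
  assumes "\<And>x. spec d (W x) (a x) (e x)"
  shows "spec (d ^ length xs) (tpow W xs) (tv d a xs) (te d e xs)"
proof -
  have c: "W x \<in> carrier_mat d d" for x using assms[of x] by (simp add: spec_def)
  have "tpow W xs $$ (k,k') = osum (d ^ length xs) (tv d a xs) (te d e xs) k k'"
    if "k < d ^ length xs" "k' < d ^ length xs" for k k'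
    using that
  proof (induction xs arbitrary: k k')
    case Nil
    then show ?case by (simp add: tpow_Nil osum_def)
  next
    case (Cons x xs)
    let ?n = "d ^ length xs"
    have kk: "k < d * ?n" "k' < d * ?n" using Cons.prems by auto
    note bk = div_mod_bounds[OF kk(1)] and bk' = div_mod_bounds[OF kk(2)]
    have "osum (d ^ length (x # xs)) (tv d a (x # xs)) (te d e (x # xs)) k k'
      = (\<Sum>i<d * ?n. (of_real (a x (i div ?n)) * e x (i div ?n) (k div ?n) * cnj (e x (i div ?n) (k' div ?n))) *
          (of_real (tv d a xs (i mod ?n)) * te d e xs (i mod ?n) (k mod ?n) * cnj (te d e xs (i mod ?n) (k' mod ?n))))"
      by (simp add: osum_def mult_ac)
    also have "\<dots> = osum d (a x) (e x) (k div ?n) (k' div ?n) * osum ?n (tv d a xs) (te d e xs) (k mod ?n) (k' mod ?n)"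
      by (subst sum_div_mod[of "\<lambda>i j. (of_real (a x i) * e x i (k div ?n) * cnj (e x i (k' div ?n))) *
          (of_real (tv d a xs j) * te d e xs j (k mod ?n) * cnj (te d e xs j (k' mod ?n)))"])
        (simp add: osum_def sum_product)
    also have "\<dots> = tpow W (x # xs) $$ (k,k')"
      using specD[OF assms[of x] bk(1) bk'(1)] Cons.IH[OF bk(2) bk'(2)] tpow_Cons_index[OF c Cons.prems] by simp
    finally show ?case by simp
  qed
  then show ?thesis using tpow_carrier[of W d xs, OF c] onb_te[of d e xs] assms by (simp add: spec_def)
qed

lemma tv_nonneg:
  assumes "\<And>x i. i < d \<Longrightarrow> 0 \<le> a x i" "i < d ^ length xs"
  shows "0 \<le> tv d a xs i"
  using assms(2)
proof (induction xs arbitrary: i)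
  case (Cons x xs)
  then have "i < d * d ^ length xs" by simp
  from div_mod_bounds[OF this] show ?case using Cons.IH assms(1) by simp
qed simp

lemma tv_sum:
  assumes "\<And>x. (\<Sum>i<d. a x i) = 1"
  shows "(\<Sum>i<d ^ length xs. tv d a xs i) = 1"
proof (induction xs)
  case (Cons x xs)
  have "(\<Sum>i<d ^ length (x # xs). tv d a (x # xs) i) = (\<Sum>i<d. \<Sum>j<d ^ length xs. a x i * tv d a xs j)"
    using sum_div_mod[where f = "\<lambda>i j. a x i * tv d a xs j" and m = d and n = "d ^ length xs"] by simp
  then show ?case using Cons assms by (simp add: sum_product[symmetric])
qed simp

text \<open>Expectation of \<open>\<phi>\<close> under the Nussbaum--Szkola distribution of two spectral decompositions.\<close>

definition ns :: "nat \<Rightarrow> (nat \<Rightarrow> real) \<Rightarrow> (nat \<Rightarrow> nat \<Rightarrow> complex) \<Rightarrow> (nat \<Rightarrow> real) \<Rightarrow> (nat \<Rightarrow> nat \<Rightarrow> complex)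
    \<Rightarrow> (real \<Rightarrow> real \<Rightarrow> real) \<Rightarrow> real" where
  "ns D a e b f \<phi> = (\<Sum>i<D. \<Sum>k<D. a i * (cmod (cin D (f k) (e i)))\<^sup>2 * \<phi> (a i) (b k))"

text \<open>Overlaps and eigenvalues of product states factor, so the Nussbaum-Szkola distribution
  is a product distribution and a multiplicative function has the product of the letter
  expectations. The functions of interest are powers of the likelihood ratio and of its
  inverse.\<close>

lemma ns_tensor:
  assumes \<phi>: "\<And>u v u' v'. 0 \<le> u \<Longrightarrow> 0 \<le> v \<Longrightarrow> 0 \<le> u' \<Longrightarrow> 0 \<le> v' \<Longrightarrow> \<phi> (u * u') (v * v') = \<phi> u v * \<phi> u' v'"
    and one: "\<phi> 1 1 = (1::real)"
    and a: "\<And>x i. i < d \<Longrightarrow> 0 \<le> a x i" and b: "\<And>y i. i < d \<Longrightarrow> 0 \<le> b y i"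
  shows "length xs = length ys \<Longrightarrow>
     ns (d ^ length xs) (tv d a xs) (te d e xs) (tv d b ys) (te d f ys) \<phi>
       = prod_list (map2 (\<lambda>x y. ns d (a x) (e x) (b y) (f y) \<phi>) xs ys)"
proof (induction xs ys rule: list_induct2)
  case Nil
  show ?case by (simp add: ns_def cin_def one)
next
  case (Cons x xs y ys)
  let ?n = "d ^ length xs"
  have l: "length ys = length xs" using Cons by simp
  define g where "g = (\<lambda>i k. a x i * (cmod (cin d (f y k) (e x i)))\<^sup>2 * \<phi> (a x i) (b y k))"
  define h where "h = (\<lambda>i k. tv d a xs i * (cmod (cin ?n (te d f ys k) (te d e xs i)))\<^sup>2 * \<phi> (tv d a xs i) (tv d b ys k))"
  have "ns (d ^ length (x # xs)) (tv d a (x # xs)) (te d e (x # xs)) (tv d b (y # ys)) (te d f (y # ys)) \<phi>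
    = (\<Sum>i<d * ?n. \<Sum>k<d * ?n. g (i div ?n) (k div ?n) * h (i mod ?n) (k mod ?n))"
    unfolding ns_def
  proof (intro sum.cong)
    fix i k assume "i \<in> {..<d * ?n}" "k \<in> {..<d * ?n}"
    then have ik: "i < d * ?n" "k < d * ?n" by auto
    note bi = div_mod_bounds[OF ik(1)] and bk = div_mod_bounds[OF ik(2)]
    have c: "cin (d ^ length (x # xs)) (te d f (y # ys) k) (te d e (x # xs) i)
      = cin d (f y (k div ?n)) (e x (i div ?n)) * cin ?n (te d f ys (k mod ?n)) (te d e xs (i mod ?n))"
      by (simp add: l cin_tensor)
    have p: "\<phi> (tv d a (x # xs) i) (tv d b (y # ys) k)
       = \<phi> (a x (i div ?n)) (b y (k div ?n)) * \<phi> (tv d a xs (i mod ?n)) (tv d b ys (k mod ?n))"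
      using \<phi>[OF a[OF bi(1)] b[OF bk(1)] tv_nonneg[OF a bi(2)] tv_nonneg[OF b bk(2)[folded l]]] by (simp add: l)
    show "tv d a (x # xs) i * (cmod (cin (d ^ length (x # xs)) (te d f (y # ys) k) (te d e (x # xs) i)))\<^sup>2 *
       \<phi> (tv d a (x # xs) i) (tv d b (y # ys) k) = g (i div ?n) (k div ?n) * h (i mod ?n) (k mod ?n)"
      unfolding c p by (simp add: g_def h_def norm_mult power_mult_distrib mult_ac)
  qed (simp_all)
  also have "\<dots> = (\<Sum>i<d * ?n. \<Sum>k<d. \<Sum>k'<?n. g (i div ?n) k * h (i mod ?n) k')"
    by (rule sum.cong[OF refl], rule sum_div_mod)
  also have "\<dots> = (\<Sum>i<d. \<Sum>i'<?n. \<Sum>k<d. \<Sum>k'<?n. g i k * h i' k')"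
    by (rule sum_div_mod[of "\<lambda>i i'. \<Sum>k<d. \<Sum>k'<?n. g i k * h i' k'"])
  also have "\<dots> = (\<Sum>i<d. \<Sum>k<d. g i k) * (\<Sum>i'<?n. \<Sum>k'<?n. h i' k')"
    by (simp add: sum_product[symmetric])
  finally show ?case using Cons.IH by (simp add: ns_def g_def h_def)
qed

text \<open>A product eigenvalue is zero only through a zero factor, and there the single-letter
  support condition annihilates the weight.\<close>

lemma support_tensor:
  assumes "\<And>x i k. i < d \<Longrightarrow> k < d \<Longrightarrow> b k = 0 \<Longrightarrow> a x i * (cmod (cin d (f k) (e x i)))\<^sup>2 = 0"
    and "length xs = length ys" "i < d ^ length xs" "k < d ^ length xs" "tv d (\<lambda>_. b) ys k = 0"
  shows "tv d a xs i * (cmod (cin (d ^ length xs) (te d (\<lambda>_. f) ys k) (te d e xs i)))\<^sup>2 = 0"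
  using assms(2-)
proof (induction xs ys arbitrary: i k rule: list_induct2)
  case (Cons x xs y ys)
  let ?n = "d ^ length xs"
  have l: "length ys = length xs" using Cons by simp
  have ik: "i < d * ?n" "k < d * ?n" using Cons.prems by auto
  note bi = div_mod_bounds[OF ik(1)] and bk = div_mod_bounds[OF ik(2)]
  have c: "cin (d ^ length (x # xs)) (te d (\<lambda>_. f) (y # ys) k) (te d e (x # xs) i)
    = cin d (f (k div ?n)) (e x (i div ?n)) * cin ?n (te d (\<lambda>_. f) ys (k mod ?n)) (te d e xs (i mod ?n))"
    by (simp add: l cin_tensor)
  have "b (k div ?n) = 0 \<or> tv d (\<lambda>_. b) ys (k mod ?n) = 0" using Cons.prems(3) by (simp add: l)
  then show ?case
  proof
    assume "b (k div ?n) = 0"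
    from assms(1)[OF bi(1) bk(1) this, of x] show ?thesis unfolding c by auto
  next
    assume "tv d (\<lambda>_. b) ys (k mod ?n) = 0"
    from Cons.IH[OF bi(2) bk(2) this] show ?thesis unfolding c by auto
  qed
qed simp

subsection \<open>Sums over sequences\<close>

lemma finite_seqs [simp]: "finite (seqs n :: 'x::finite list set)"
  unfolding seqs_def using finite_lists_length_eq[of "UNIV :: 'x set" n] by simp

lemma card_seqs: "card (seqs n :: 'x::finite list set) = CARD('x) ^ n"
  unfolding seqs_def using card_lists_length_eq[of "UNIV :: 'x set" n] by simp

lemma sum_seqs_Suc:
  fixes F :: "'x::finite list \<Rightarrow> 'a::comm_monoid_add"
  shows "(\<Sum>xs\<in>seqs (Suc n). F xs) = (\<Sum>x\<in>UNIV. \<Sum>xs\<in>seqs n. F (x # xs))"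
proof -
  have "(\<Sum>x\<in>UNIV. \<Sum>xs\<in>seqs n. F (x # xs)) = (\<Sum>(x,xs)\<in>UNIV \<times> seqs n. F (x # xs))"
    by (rule sum.cartesian_product)
  also have "\<dots> = (\<Sum>xs\<in>seqs (Suc n). F xs)"
    by (rule sum.reindex_bij_witness[of _ "\<lambda>xs. (hd xs, tl xs)" "\<lambda>(x,xs). x # xs"])
      (auto simp: seqs_def length_Suc_conv)
  finally show ?thesis by simp
qed

lemma seqs_0: "seqs 0 = {[]}"
  by (auto simp: seqs_def)

lemma sum_seqs_prod:
  fixes q :: "'x::finite \<Rightarrow> 'a::comm_semiring_1"
  shows "(\<Sum>xs\<in>seqs n. prod_list (map q xs)) = (\<Sum>x\<in>UNIV. q x) ^ n"
  by (induction n) (simp_all add: seqs_0 sum_seqs_Suc flip: sum_product)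

lemma iid_dist:
  assumes "is_dist (UNIV :: 'x::finite set) p"
  shows "is_dist (seqs n) (\<lambda>xs. prod_list (map p xs))"
  unfolding is_dist_def
proof (intro conjI ballI)
  show "0 \<le> prod_list (map p xs)" for xs
    using assms by (induction xs) (auto simp: is_dist_def)
  show "(\<Sum>xs\<in>seqs n. prod_list (map p xs)) = 1"
    using assms by (simp add: sum_seqs_prod is_dist_def)
qed

text \<open>The average of i.i.d. product outputs is a tensor power. It is written as the output of
  the constant word over the unit type, so that \<open>tpow_spec\<close> supplies its
  eigenbasis.\<close>

lemma tpow_average:
  fixes W :: "'x::finite \<Rightarrow> complex mat"
  assumes W: "\<And>x. W x \<in> carrier_mat d d" and ij: "i < d ^ n" "j < d ^ n"
  shows "(\<Sum>xs\<in>seqs n. of_real (prod_list (map p xs)) * tpow W xs $$ (i,j))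
     = tpow (\<lambda>_. mix d UNIV W p) (replicate n ()) $$ (i,j)"
  using ij
proof (induction n arbitrary: i j)
  case 0
  then show ?case by (simp add: seqs_0 tpow_Nil)
next
  case (Suc n)
  let ?n = "d ^ n"
  have ij: "i < d * ?n" "j < d * ?n" using Suc.prems by auto
  note bi = div_mod_bounds[OF ij(1)] and bj = div_mod_bounds[OF ij(2)]
  have "(\<Sum>xs\<in>seqs (Suc n). of_real (prod_list (map p xs)) * tpow W xs $$ (i,j))
    = (\<Sum>x\<in>UNIV. \<Sum>xs\<in>seqs n. (of_real (p x) * W x $$ (i div ?n, j div ?n)) *
        (of_real (prod_list (map p xs)) * tpow W xs $$ (i mod ?n, j mod ?n)))"
    unfolding sum_seqs_Suc
  proof (intro sum.cong refl)
    fix x :: 'x and xs :: "'x list" assume "xs \<in> seqs n"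
    then have l: "length xs = n" by (simp add: seqs_def)
    show "of_real (prod_list (map p (x # xs))) * tpow W (x # xs) $$ (i,j)
      = (of_real (p x) * W x $$ (i div ?n, j div ?n)) *
        (of_real (prod_list (map p xs)) * tpow W xs $$ (i mod ?n, j mod ?n))"
      using tpow_Cons_index[of W d i x xs j, OF W] Suc.prems by (simp add: l mult_ac)
  qed
  also have "\<dots> = (\<Sum>x\<in>UNIV. of_real (p x) * W x $$ (i div ?n, j div ?n)) *
      (\<Sum>xs\<in>seqs n. of_real (prod_list (map p xs)) * tpow W xs $$ (i mod ?n, j mod ?n))"
    by (simp add: sum_product)
  also have "(\<Sum>x\<in>UNIV. of_real (p x) * W x $$ (i div ?n, j div ?n)) = mix d UNIV W p $$ (i div ?n, j div ?n)"
    using bi bj by (simp add: mix_def)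
  also have "(\<Sum>xs\<in>seqs n. of_real (prod_list (map p xs)) * tpow W xs $$ (i mod ?n, j mod ?n))
    = tpow (\<lambda>_. mix d UNIV W p) (replicate n ()) $$ (i mod ?n, j mod ?n)"
    by (rule Suc.IH[OF bi(2) bj(2)])
  also have "mix d UNIV W p $$ (i div ?n, j div ?n) * \<dots> = tpow (\<lambda>_. mix d UNIV W p) (replicate (Suc n) ()) $$ (i,j)"
    using tpow_Cons_index[of "\<lambda>_. mix d UNIV W p" d i "()" "replicate n ()" j] Suc.prems by (simp add: mix_def)
  finally show ?case .
qed

subsection \<open>Block covering and block codes\<close>

lemma map2_replicate_unit: "map2 (\<lambda>x y. g x) xs (replicate (length xs) ()) = map g xs"
  by (induction xs) auto

lemma prod_list_map_mult:
  fixes f g :: "'x \<Rightarrow> 'a::comm_monoid_mult"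
  shows "prod_list (map (\<lambda>x. f x * g x) xs) = prod_list (map f xs) * prod_list (map g xs)"
  by (induction xs) (simp_all add: mult_ac)

lemma trp_tpow_cj:
  assumes W: "spec D A l e" and F: "onb D F"
  shows "trp D (osum D l (\<lambda>i k. cin D (F k) (e i))) (cj D F T) = trp D (\<lambda>i j. A $$ (i,j)) T"
proof -
  have "trp D (osum D l (\<lambda>i k. cin D (F k) (e i))) (cj D F T) = trp D (osum D l e) T"
    unfolding cj_osum[symmetric] by (rule trp_cj[OF F osum_herm])
  also have "\<dots> = trp D (\<lambda>i j. A $$ (i,j)) T"
    using specD[OF W] by (intro trp_cong) simp_all
  finally show ?thesis .
qed

text \<open>The moment bound is required for every letter, as \<open>p\<close> may be concentrated
  on any single sequence. In the eigenbasis \<open>F\<close> of the product reference the situation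
  is that of \<open>covering\<close>; conjugating T instead of the outputs translates the result
  back.\<close>

theorem block_covering:
  fixes W :: "'x::finite \<Rightarrow> complex mat"
  assumes W: "\<And>x. density d (W x)" "\<And>x. spec d (W x) (a x) (e x)"
    and f: "onb d f" and b: "\<And>k. k < d \<Longrightarrow> 0 \<le> b k" "(\<Sum>k<d. b k) = 1"
    and supp: "\<And>x i k. i < d \<Longrightarrow> k < d \<Longrightarrow> b k = 0 \<Longrightarrow> a x i * (cmod (cin d (f k) (e x i)))\<^sup>2 = 0"
    and s: "s > 0" and c: "\<And>x. ns d (a x) (e x) b f (\<lambda>u v. (u / v) powr s) \<le> exp (s * c)"
    and L: "L > 0" and M: "M > 0" and p: "is_dist (seqs n) p"
  shows "\<exists>xs. length xs = M \<and> set xs \<subseteq> seqs n \<and> (\<forall>T. effect (d ^ n) T \<longrightarrow>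
     cmod ((\<Sum>x\<in>seqs n. of_real (p x) * trp (d ^ n) (\<lambda>i j. tpow W x $$ (i,j)) T)
        - (\<Sum>x\<leftarrow>xs. trp (d ^ n) (\<lambda>i j. tpow W x $$ (i,j)) T) / of_nat M)
      \<le> 4 * sqrt (L powr (- s) * exp (n * (s * c))) + sqrt (2 * L / M))"
proof -
  define us where "us = replicate n ()"
  define D where "D = d ^ n"
  define F where "F = te d (\<lambda>_. f) us"
  define B where "B = tv d (\<lambda>_. b) us"
  have F: "onb D F" using onb_te[of d "\<lambda>_. f" us] f by (simp add: D_def F_def us_def)
  have a: "\<And>x i. i < d \<Longrightarrow> 0 \<le> a x i" "\<And>x. (\<Sum>i<d. a x i) = 1" using density_spec[OF W] by auto
  have sp: "spec D (tpow W x) (tv d a x) (te d e x)" if "x \<in> seqs n" for x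
    using tpow_spec[of d W a e x, OF W(2)] that by (simp add: D_def seqs_def)
  define e' where "e' = (\<lambda>x i k. cin D (F k) (te d e x i))"
  have e': "onb D (e' x)" if "x \<in> seqs n" for x
    unfolding e'_def by (rule onb_coords[OF F spec_onb[OF sp[OF that]]])
  have lus: "length us = n" by (simp add: us_def)
  have B0: "0 \<le> B k" if "k < D" for k
    unfolding B_def by (rule tv_nonneg[OF b(1)]) (use that in \<open>simp_all add: D_def lus\<close>)
  have B1: "(\<Sum>k<D. B k) = 1"
    using tv_sum[of "\<lambda>_. b" d us] b(2) by (simp add: B_def D_def lus)
  have A0: "0 \<le> tv d a x i" if "x \<in> seqs n" "i < D" for x i
    by (rule tv_nonneg[OF a(1)]) (use that in \<open>simp_all add: D_def seqs_def\<close>)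
  have A1: "(\<Sum>i<D. tv d a x i) = 1" if "x \<in> seqs n" for x
    using tv_sum[of a d x, OF a(2)] that by (simp add: D_def seqs_def)
  have ns_le: "ns D (tv d a x) (te d e x) B F (\<lambda>u v. (u / v) powr s) \<le> exp (n * (s * c))" if x: "x \<in> seqs n" for x
  proof -
    have l: "length x = n" using x by (simp add: seqs_def)
    have "ns D (tv d a x) (te d e x) B F (\<lambda>u v. (u / v) powr s)
      = prod_list (map2 (\<lambda>x y. ns d (a x) (e x) b f (\<lambda>u v. (u / v) powr s)) x us)"
      unfolding D_def B_def F_def l[symmetric]
      by (rule ns_tensor) (auto simp: a b lus l powr_mult[symmetric])
    also have "\<dots> = prod_list (map (\<lambda>x. ns d (a x) (e x) b f (\<lambda>u v. (u / v) powr s)) x)"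
      unfolding us_def l[symmetric] map2_replicate_unit ..
    also have "\<dots> \<le> exp (length x * (s * c))"
    proof (induction x)
      case (Cons y x)
      have nn: "0 \<le> ns d (a y) (e y) b f (\<lambda>u v. (u / v) powr s)" for y
        unfolding ns_def using a(1) by (intro sum_nonneg mult_nonneg_nonneg) auto
      have "prod_list (map (\<lambda>x. ns d (a x) (e x) b f (\<lambda>u v. (u / v) powr s)) (y # x))
        \<le> exp (s * c) * exp (length x * (s * c))"
        using Cons.IH c[of y] nn by (auto intro!: mult_mono prod_list_nonneg)
      also have "\<dots> = exp (length (y # x) * (s * c))" by (simp add: exp_add[symmetric] algebra_simps)
      finally show ?case .
    qed simp
    finally show ?thesis by (simp add: l)
  qed
  \<comment> \<open>Markov's inequality for the power \<open>s\<close> of the likelihood ratio at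
    level \<open>L powr s\<close>.\<close>
  have \<eta>: "(\<Sum>i<D. \<Sum>k<D. if L * B k < tv d a x i then tv d a x i * (cmod (e' x i k))\<^sup>2 else 0)
     \<le> L powr (- s) * exp (n * (s * c))" if x: "x \<in> seqs n" for x
  proof -
    have l: "length x = n" using x by (simp add: seqs_def)
    have "(\<Sum>i<D. \<Sum>k<D. if L * B k < tv d a x i then tv d a x i * (cmod (e' x i k))\<^sup>2 else 0)
      \<le> (\<Sum>i<D. \<Sum>k<D. L powr (- s) * (tv d a x i * (cmod (e' x i k))\<^sup>2 * (tv d a x i / B k) powr s))"
    proof (intro sum_mono)
      fix i k assume "i \<in> {..<D}" "k \<in> {..<D}"
      then have ik: "i < D" "k < D" by auto
      have q0: "0 \<le> tv d a x i * (cmod (e' x i k))\<^sup>2" using A0[OF x ik(1)] by simp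
      show "(if L * B k < tv d a x i then tv d a x i * (cmod (e' x i k))\<^sup>2 else 0)
         \<le> L powr (- s) * (tv d a x i * (cmod (e' x i k))\<^sup>2 * (tv d a x i / B k) powr s)"
      proof (cases "L * B k < tv d a x i")
        case True
        show ?thesis
        proof (cases "B k = 0")
          case True
          \<comment> \<open>The quotient by \<open>B k = 0\<close> is 0, so the Markov term would
            not dominate an untruncated weight; the support condition says that this weight is
            zero.\<close>
          have "tv d a x i * (cmod (cin (d ^ length x) (te d (\<lambda>_. f) us k) (te d e x i)))\<^sup>2 = 0"
            by (rule support_tensor[where b = b, OF supp]) (use ik True in \<open>simp_all add: D_def B_def l lus\<close>)
          then have "tv d a x i * (cmod (e' x i k))\<^sup>2 = 0" by (simp only: e'_def F_def D_def l)
          then show ?thesis by (simp only: if_cancel mult_zero_left mult_zero_right order_refl)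
        next
          case False
          then have "B k > 0" using B0[OF ik(2)] by simp
          then have "L < tv d a x i / B k" using True by (simp add: field_simps)
          then have "L powr s \<le> (tv d a x i / B k) powr s" using L s by (intro powr_mono2) auto
          then have "L powr (- s) * L powr s \<le> L powr (- s) * (tv d a x i / B k) powr s"
            by (rule mult_left_mono) simp
          then have "1 \<le> L powr (- s) * (tv d a x i / B k) powr s" using L by (simp add: powr_minus)
          then have "tv d a x i * (cmod (e' x i k))\<^sup>2 * 1 \<le>
            tv d a x i * (cmod (e' x i k))\<^sup>2 * (L powr (- s) * (tv d a x i / B k) powr s)"
            using q0 by (rule mult_left_mono)
          then show ?thesis using True by (simp add: mult_ac)
        qed
      next
        case False
        have "0 \<le> L powr (- s) * (tv d a x i * (cmod (e' x i k))\<^sup>2 * (tv d a x i / B k) powr s)"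
          by (rule mult_nonneg_nonneg[OF powr_ge_zero mult_nonneg_nonneg[OF q0 powr_ge_zero]])
        then show ?thesis using False by (simp only: if_False)
      qed
    qed
    also have "\<dots> = L powr (- s) * ns D (tv d a x) (te d e x) B F (\<lambda>u v. (u / v) powr s)"
      by (simp add: ns_def e'_def sum_distrib_left)
    also have "\<dots> \<le> L powr (- s) * exp (n * (s * c))" using ns_le[OF x] by (rule mult_left_mono) simp
    finally show ?thesis .
  qed
  have "\<exists>xs. length xs = M \<and> set xs \<subseteq> seqs n \<and> (\<forall>T. effect D T \<longrightarrow>
     cmod ((\<Sum>x\<in>seqs n. of_real (p x) * trp D (osum D (tv d a x) (e' x)) T)
        - (\<Sum>x\<leftarrow>xs. trp D (osum D (tv d a x) (e' x)) T) / of_nat M)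
      \<le> 4 * sqrt (L powr (- s) * exp (n * (s * c))) + sqrt (2 * L / M))"
    by (rule covering[OF p B0 _ L M e' A0 _ \<eta>]) (simp_all add: B1 A1)
  then obtain xs where xs: "length xs = M" "set xs \<subseteq> seqs n" and T: "\<And>T. effect D T \<Longrightarrow>
     cmod ((\<Sum>x\<in>seqs n. of_real (p x) * trp D (osum D (tv d a x) (e' x)) T)
        - (\<Sum>x\<leftarrow>xs. trp D (osum D (tv d a x) (e' x)) T) / of_nat M)
      \<le> 4 * sqrt (L powr (- s) * exp (n * (s * c))) + sqrt (2 * L / M)"
    by blast
  have "cmod ((\<Sum>x\<in>seqs n. of_real (p x) * trp D (\<lambda>i j. tpow W x $$ (i,j)) T)
        - (\<Sum>x\<leftarrow>xs. trp D (\<lambda>i j. tpow W x $$ (i,j)) T) / of_nat M)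
      \<le> 4 * sqrt (L powr (- s) * exp (n * (s * c))) + sqrt (2 * L / M)" if "effect D T" for T
  proof -
    have t: "trp D (osum D (tv d a x) (e' x)) (cj D F T) = trp D (\<lambda>i j. tpow W x $$ (i,j)) T" if "x \<in> seqs n" for x
      unfolding e'_def by (rule trp_tpow_cj[OF sp[OF that] F])
    have "(\<Sum>x\<leftarrow>xs. trp D (osum D (tv d a x) (e' x)) (cj D F T)) = (\<Sum>x\<leftarrow>xs. trp D (\<lambda>i j. tpow W x $$ (i,j)) T)"
      using xs(2) t by (intro arg_cong[where f = sum_list] map_cong) auto
    then show ?thesis using T[OF effect_cj[OF F that]] t by simp
  qed
  then show ?thesis using xs unfolding D_def by blast
qed

text \<open>In contrast to the covering, only the average over i.i.d. inputs has to be small, so the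
  moment is averaged over \<open>p\<close>; independence raises it to the power \<open>n\<close>.
  The reference is the average output itself, which makes \<open>avg\<close> in
  \<open>sequential_code\<close> diagonal in its eigenbasis.\<close>

theorem block_code:
  fixes W :: "'x::finite \<Rightarrow> complex mat" and K :: nat
  assumes W: "\<And>x. density d (W x)" "\<And>x. spec d (W x) (a x) (e x)"
    and p: "is_dist UNIV p" and \<rho>: "spec d (mix d UNIV W p) b f" and b: "\<And>k. k < d \<Longrightarrow> 0 \<le> b k"
    and s: "s > 0" and c: "(\<Sum>x\<in>UNIV. p x * ns d (a x) (e x) b f (\<lambda>u v. (v / u) powr s)) \<le> exp (- s * c)"
    and L: "L > 0"
  shows "\<exists>u E. (\<forall>k<K. u k \<in> seqs n) \<and> (\<forall>B\<subseteq>{..<K}. effect (d ^ n) (\<lambda>i l. \<Sum>k\<in>B. E k i l)) \<and>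
     (\<forall>k<K. \<forall>x\<in>seqs n. 0 \<le> Re (trp (d ^ n) (\<lambda>i j. tpow W x $$ (i,j)) (E k))) \<and>
     (\<forall>k<K. 1 - 4 * (K / L + L powr s * exp (- (n * (s * c))))
        \<le> Re (trp (d ^ n) (\<lambda>i j. tpow W (u k) $$ (i,j)) (E k)))"
proof -
  define us where "us = replicate n ()"
  define D where "D = d ^ n"
  define F where "F = te d (\<lambda>_. f) us"
  define B where "B = tv d (\<lambda>_. b) us"
  define q where "q = (\<lambda>xs. prod_list (map p xs))"
  have q: "is_dist (seqs n) q" unfolding q_def by (rule iid_dist[OF p])
  have f: "onb d f" by (rule spec_onb[OF \<rho>])
  have F: "onb D F" using onb_te[of d "\<lambda>_. f" us] f by (simp add: D_def F_def us_def)
  have a: "\<And>x i. i < d \<Longrightarrow> 0 \<le> a x i" "\<And>x. (\<Sum>i<d. a x i) = 1" using density_spec[OF W] by auto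
  have Wc: "W x \<in> carrier_mat d d" for x using W(2)[of x] by (simp add: spec_def)
  have sp: "spec D (tpow W x) (tv d a x) (te d e x)" if "x \<in> seqs n" for x
    using tpow_spec[of d W a e x, OF W(2)] that by (simp add: D_def seqs_def)
  define e' where "e' = (\<lambda>x i k. cin D (F k) (te d e x i))"
  have e': "onb D (e' x)" if "x \<in> seqs n" for x
    unfolding e'_def by (rule onb_coords[OF F spec_onb[OF sp[OF that]]])
  have lus: "length us = n" by (simp add: us_def)
  have B0: "0 \<le> B k" if "k < D" for k
    unfolding B_def by (rule tv_nonneg[OF b]) (use that in \<open>simp_all add: D_def lus\<close>)
  have A0: "0 \<le> tv d a x i" if "x \<in> seqs n" "i < D" for x i
    by (rule tv_nonneg[OF a(1)]) (use that in \<open>simp_all add: D_def seqs_def\<close>)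
  have A1: "(\<Sum>i<D. tv d a x i) = 1" if "x \<in> seqs n" for x
    using tv_sum[of a d x, OF a(2)] that by (simp add: D_def seqs_def)
  have avg: "(\<Sum>x\<in>seqs n. of_real (q x) * osum D (tv d a x) (e' x) k k') = (if k = k' then of_real (B k) else 0)"
    if kk: "k < D" "k' < D" for k k'
  proof -
    have rsp: "spec D (tpow (\<lambda>_. mix d UNIV W p) us) B F"
      using tpow_spec[of d "\<lambda>_. mix d UNIV W p" "\<lambda>_. b" "\<lambda>_. f" us, OF \<rho>] by (simp add: D_def B_def F_def lus)
    have "(\<Sum>x\<in>seqs n. of_real (q x) * osum D (tv d a x) (e' x) k k')
      = (\<Sum>x\<in>seqs n. of_real (q x) * cin D (F k) (ap D (osum D (tv d a x) (te d e x)) (F k')))"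
      unfolding e'_def cj_osum[symmetric] cj_def ..
    also have "\<dots> = (\<Sum>x\<in>seqs n. \<Sum>i<D. \<Sum>j<D. cnj (F k i) * F k' j * (of_real (q x) * tpow W x $$ (i,j)))"
      unfolding cin_ap sum_distrib_left
      by (intro sum.cong refl) (simp add: specD[OF sp] mult_ac)
    also have "\<dots> = (\<Sum>i<D. \<Sum>x\<in>seqs n. \<Sum>j<D. cnj (F k i) * F k' j * (of_real (q x) * tpow W x $$ (i,j)))"
      by (rule sum.swap)
    also have "\<dots> = (\<Sum>i<D. \<Sum>j<D. \<Sum>x\<in>seqs n. cnj (F k i) * F k' j * (of_real (q x) * tpow W x $$ (i,j)))"
      by (rule sum.cong[OF refl], rule sum.swap)
    also have "\<dots> = (\<Sum>i<D. \<Sum>j<D. cnj (F k i) * F k' j * osum D B F i j)"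
      unfolding sum_distrib_left[symmetric]
      by (intro sum.cong refl) (simp add: q_def tpow_average[OF Wc] D_def specD[OF rsp[unfolded D_def us_def]])
    also have "\<dots> = cin D (F k) (ap D (osum D B F) (F k'))" unfolding cin_ap by (simp add: mult_ac)
    also have "\<dots> = (\<Sum>i<D. of_real (B i) * cin D (F k) (F i) * cin D (F i) (F k'))" by (rule cin_ap_osum)
    also have "\<dots> = (\<Sum>i<D. if i = k then (if k = k' then of_real (B k) else 0) else 0)"
      using F kk by (intro sum.cong refl) (auto simp: onb_def)
    finally show ?thesis using kk by simp
  qed
  have ns_eq: "(\<Sum>x\<in>seqs n. q x * ns D (tv d a x) (te d e x) B F (\<lambda>u v. (v / u) powr s))
    = (\<Sum>x\<in>UNIV. p x * ns d (a x) (e x) b f (\<lambda>u v. (v / u) powr s)) ^ n"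
    unfolding sum_seqs_prod[symmetric]
  proof (rule sum.cong[OF refl])
    fix x :: "'x list" assume x: "x \<in> seqs n"
    have l: "length x = n" using x by (simp add: seqs_def)
    have "ns D (tv d a x) (te d e x) B F (\<lambda>u v. (v / u) powr s)
      = prod_list (map2 (\<lambda>x y. ns d (a x) (e x) b f (\<lambda>u v. (v / u) powr s)) x us)"
      unfolding D_def B_def F_def l[symmetric]
      by (rule ns_tensor) (auto simp: a b lus l powr_mult[symmetric])
    also have "\<dots> = prod_list (map (\<lambda>x. ns d (a x) (e x) b f (\<lambda>u v. (v / u) powr s)) x)"
      unfolding us_def l[symmetric] map2_replicate_unit ..
    finally show "q x * ns D (tv d a x) (te d e x) B F (\<lambda>u v. (v / u) powr s)
      = prod_list (map (\<lambda>x. p x * ns d (a x) (e x) b f (\<lambda>u v. (v / u) powr s)) x)"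
      unfolding q_def by (simp only: prod_list_map_mult)
  qed
  have ns0: "0 \<le> (\<Sum>x\<in>UNIV. p x * ns d (a x) (e x) b f (\<lambda>u v. (v / u) powr s))"
    unfolding ns_def using p a(1) by (intro sum_nonneg mult_nonneg_nonneg) (auto simp: is_dist_def)
  \<comment> \<open>Markov's inequality for the inverse likelihood ratio: the probability that it is
    at least 1 / L.\<close>
  have \<eta>: "(\<Sum>x\<in>seqs n. q x * (\<Sum>i<D. \<Sum>k<D. if L * B k < tv d a x i then 0 else tv d a x i * (cmod (e' x i k))\<^sup>2))
     \<le> L powr s * exp (- (n * (s * c)))"
  proof -
    have "(\<Sum>x\<in>seqs n. q x * (\<Sum>i<D. \<Sum>k<D. if L * B k < tv d a x i then 0 else tv d a x i * (cmod (e' x i k))\<^sup>2))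
      \<le> (\<Sum>x\<in>seqs n. q x * (L powr s * ns D (tv d a x) (te d e x) B F (\<lambda>u v. (v / u) powr s)))"
    proof (intro sum_mono mult_left_mono)
      fix x :: "'x list" assume x: "x \<in> seqs n"
      show "0 \<le> q x" using q x by (simp add: is_dist_def)
      show "(\<Sum>i<D. \<Sum>k<D. if L * B k < tv d a x i then 0 else tv d a x i * (cmod (e' x i k))\<^sup>2)
        \<le> L powr s * ns D (tv d a x) (te d e x) B F (\<lambda>u v. (v / u) powr s)"
        unfolding ns_def sum_distrib_left
      proof (intro sum_mono)
        fix i k assume "i \<in> {..<D}" "k \<in> {..<D}"
        then have ik: "i < D" "k < D" by auto
        have q0: "0 \<le> tv d a x i * (cmod (e' x i k))\<^sup>2" using A0[OF x ik(1)] by simp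
        have "tv d a x i * (cmod (e' x i k))\<^sup>2 \<le> L powr s * (tv d a x i * (cmod (e' x i k))\<^sup>2 * (B k / tv d a x i) powr s)"
          if h: "\<not> L * B k < tv d a x i"
        proof (cases "tv d a x i = 0")
          case False
          then have pos: "tv d a x i > 0" using A0[OF x ik(1)] by simp
          then have "1 \<le> L * (B k / tv d a x i)" using h by (simp add: field_simps)
          then have "1 \<le> (L * (B k / tv d a x i)) powr s" using s by (simp add: ge_one_powr_ge_zero)
          also have "\<dots> = L powr s * (B k / tv d a x i) powr s"
            by (rule powr_mult)
          finally have "tv d a x i * (cmod (e' x i k))\<^sup>2 * 1 \<le>
            tv d a x i * (cmod (e' x i k))\<^sup>2 * (L powr s * (B k / tv d a x i) powr s)"
            using q0 by (rule mult_left_mono)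
          then show ?thesis by (simp add: mult_ac)
        qed simp
        moreover have "0 \<le> L powr s * (tv d a x i * (cmod (e' x i k))\<^sup>2 * (B k / tv d a x i) powr s)"
          by (rule mult_nonneg_nonneg[OF powr_ge_zero mult_nonneg_nonneg[OF q0 powr_ge_zero]])
        ultimately show "(if L * B k < tv d a x i then 0 else tv d a x i * (cmod (e' x i k))\<^sup>2)
          \<le> L powr s * (tv d a x i * (cmod (cin D (F k) (te d e x i)))\<^sup>2 * (B k / tv d a x i) powr s)"
          unfolding e'_def by presburger
      qed
    qed
    also have "\<dots> = L powr s * (\<Sum>x\<in>UNIV. p x * ns d (a x) (e x) b f (\<lambda>u v. (v / u) powr s)) ^ n"
      unfolding ns_eq[symmetric] sum_distrib_left by (simp add: mult_ac)
    also have "\<dots> \<le> L powr s * exp (- s * c) ^ n"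
      using c ns0 by (intro mult_left_mono power_mono) auto
    also have "exp (- s * c) ^ n = exp (- (n * (s * c)))" by (simp add: exp_of_nat_mult[symmetric])
    finally show ?thesis .
  qed
  from sequential_code[OF q L B0 e' A0 A1 avg \<eta>, of K]
  obtain u E where u: "\<And>k. k < K \<Longrightarrow> u k \<in> seqs n"
    and E: "\<And>B. B \<subseteq> {..<K} \<Longrightarrow> effect D (\<lambda>i l. \<Sum>k\<in>B. E k i l)"
    and E0: "\<And>k x. k < K \<Longrightarrow> x \<in> seqs n \<Longrightarrow> 0 \<le> Re (trp D (osum D (tv d a x) (e' x)) (E k))"
    and E1: "\<And>k. k < K \<Longrightarrow> 1 - 4 * (K / L + L powr s * exp (- (n * (s * c))))
       \<le> Re (trp D (osum D (tv d a (u k)) (e' (u k))) (E k))"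
    by blast
  \<comment> \<open>The code refers to the coordinates of \<open>F\<close>; the adjoint basis
    returns its operators to the standard ones.\<close>
  define F' where "F' = (\<lambda>k j. cnj (F j k))"
  have F': "onb D F'" unfolding F'_def by (rule onb_adjoint[OF F])
  define E' where "E' = (\<lambda>k. cj D F' (E k))"
  have E'_trp: "trp D (\<lambda>i j. tpow W x $$ (i,j)) (E' k) = trp D (osum D (tv d a x) (e' x)) (E k)" if "x \<in> seqs n" for x k
  proof -
    have "trp D (\<lambda>i j. tpow W x $$ (i,j)) (E' k) = trp D (osum D (tv d a x) (e' x)) (cj D F (E' k))"
      unfolding e'_def by (rule trp_tpow_cj[OF sp[OF that] F, symmetric])
    also have "\<dots> = trp D (osum D (tv d a x) (e' x)) (E k)"
      unfolding E'_def F'_def using cj_adjoint[OF F] by (intro trp_cong) simp_all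
    finally show ?thesis .
  qed
  have "effect D (\<lambda>i l. \<Sum>k\<in>C. E' k i l)" if "C \<subseteq> {..<K}" for C
  proof -
    have "(\<lambda>i l. \<Sum>k\<in>C. E' k i l) = cj D F' (\<lambda>i l. \<Sum>k\<in>C. E k i l)"
      unfolding E'_def cj_def ap_sum_mat cin_sum_right ..
    then show ?thesis using effect_cj[OF F' E[OF that]] by simp
  qed
  then show ?thesis using u E0 E1 E'_trp unfolding D_def by (intro exI[of _ u] exI[of _ E'] conjI allI ballI impI) auto
qed

section \<open>Exponential moments\<close>

text \<open>Both sides equal 1 at \<open>s = 0\<close>, where their derivatives are the mean of
  \<open>z\<close> and the strictly larger \<mu>.\<close>

lemma mgf_bound:
  fixes w z :: "'a \<Rightarrow> real"
  assumes "finite A" "sum w A = 1" "(\<Sum>i\<in>A. w i * z i) < \<mu>"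
  shows "\<exists>s0>0. \<forall>s. 0 < s \<and> s < s0 \<longrightarrow> (\<Sum>i\<in>A. w i * exp (s * z i)) \<le> exp (s * \<mu>)"
proof -
  define h where "h = (\<lambda>s. exp (s * \<mu>) - (\<Sum>i\<in>A. w i * exp (s * z i)))"
  have "(h has_real_derivative (\<mu> - (\<Sum>i\<in>A. w i * z i))) (at 0)"
    unfolding h_def by (auto intro!: derivative_eq_intros sum.cong)
  from DERIV_pos_inc_right[OF this] assms(3)
  obtain d where d: "d > 0" "\<And>s. 0 < s \<Longrightarrow> s < d \<Longrightarrow> h 0 < h s" by auto
  have "h 0 = 0" using assms(2) by (simp add: h_def)
  then show ?thesis using d by (intro exI[of _ d]) (force simp: h_def)
qed

lemma ns_weights:
  assumes "onb D e" "onb D f" "(\<Sum>i<D. a i) = 1"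
  shows "(\<Sum>i<D. \<Sum>k<D. a i * (cmod (cin D (f k) (e i)))\<^sup>2) = 1"
proof -
  have "(\<Sum>i<D. \<Sum>k<D. a i * (cmod (cin D (f k) (e i)))\<^sup>2) = (\<Sum>i<D. a i * nsq D (e i))"
    by (simp add: sum_distrib_left[symmetric] onb_Parseval_nsq[OF assms(2)])
  also have "\<dots> = (\<Sum>i<D. a i)" using nsq_onb[OF assms(1)] by simp
  finally show ?thesis using assms(3) by simp
qed

text \<open>The conclusion holds on a whole interval of exponents, so that finitely many letters can
  share one of them.\<close>

lemma ns_exp_bound_up:
  assumes e: "onb D e" and f: "onb D f" and a: "\<And>i. i < D \<Longrightarrow> 0 \<le> a i" "(\<Sum>i<D. a i) = 1"
    and b: "\<And>k. k < D \<Longrightarrow> 0 \<le> b k"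
    and supp: "\<And>i k. i < D \<Longrightarrow> k < D \<Longrightarrow> b k = 0 \<Longrightarrow> a i * (cmod (cin D (f k) (e i)))\<^sup>2 = 0"
    and lt: "ns D a e b f (\<lambda>u v. ln u - ln v) < \<mu>"
  shows "\<exists>s0>0. \<forall>s. 0 < s \<and> s < s0 \<longrightarrow> ns D a e b f (\<lambda>u v. (u / v) powr s) \<le> exp (s * \<mu>)"
proof -
  define w where "w = (\<lambda>(i,k). a i * (cmod (cin D (f k) (e i)))\<^sup>2)"
  define z where "z = (\<lambda>(i,k). ln (a i) - ln (b k))"
  let ?A = "{..<D} \<times> {..<D}"
  have w1: "sum w ?A = 1"
    using ns_weights[OF e f a(2)] by (simp add: w_def sum.cartesian_product)
  have "(\<Sum>ik\<in>?A. w ik * z ik) < \<mu>"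
    using lt by (simp add: w_def z_def ns_def sum.cartesian_product case_prod_unfold)
  from mgf_bound[OF _ w1 this] obtain s0 where s0: "s0 > 0"
    "\<And>s. 0 < s \<Longrightarrow> s < s0 \<Longrightarrow> (\<Sum>ik\<in>?A. w ik * exp (s * z ik)) \<le> exp (s * \<mu>)" by auto
  have "ns D a e b f (\<lambda>u v. (u / v) powr s) = (\<Sum>ik\<in>?A. w ik * exp (s * z ik))" for s
  proof -
    have sumA: "(\<Sum>ik\<in>?A. g ik) = (\<Sum>i<D. \<Sum>k<D. g (i,k))" for g :: "_ \<Rightarrow> real"
      by (simp add: sum.cartesian_product case_prod_unfold)
    show ?thesis unfolding sumA ns_def
    proof (intro sum.cong refl)
      fix i k assume ik: "i \<in> {..<D}" "k \<in> {..<D}"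
      show "a i * (cmod (cin D (f k) (e i)))\<^sup>2 * (a i / b k) powr s = w (i,k) * exp (s * z (i,k))"
      proof (cases "w (i,k) = 0")
        case True
        then show ?thesis by (auto simp: w_def)
      next
        case False
        \<comment> \<open>A nonzero weight forces both eigenvalues to be positive, so values of
          \<open>ln\<close> and of the quotient at 0 never matter.\<close>
        then have "a i > 0" "b k > 0" using a(1)[of i] b[of k] supp[of i k] ik by (auto simp: w_def less_le)
        then have "(a i / b k) powr s = exp (s * z (i,k))" by (simp add: powr_def z_def ln_div)
        then show ?thesis by (simp add: w_def)
      qed
    qed
  qed
  then show ?thesis using s0 by auto
qed

lemma ns_exp_bound_down:
  fixes p :: "'x::finite \<Rightarrow> real"
  assumes p: "is_dist UNIV p" and e: "\<And>x. onb D (e x)" and f: "onb D f"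
    and a: "\<And>x i. i < D \<Longrightarrow> 0 \<le> a x i" "\<And>x. (\<Sum>i<D. a x i) = 1"
    and b: "\<And>k. k < D \<Longrightarrow> 0 \<le> b k"
    and supp: "\<And>x i k. i < D \<Longrightarrow> k < D \<Longrightarrow> b k = 0 \<Longrightarrow> p x * (a x i * (cmod (cin D (f k) (e x i)))\<^sup>2) = 0"
    and gt: "\<mu> < (\<Sum>x\<in>UNIV. p x * ns D (a x) (e x) b f (\<lambda>u v. ln u - ln v))"
  shows "\<exists>s>0. (\<Sum>x\<in>UNIV. p x * ns D (a x) (e x) b f (\<lambda>u v. (v / u) powr s)) \<le> exp (- s * \<mu>)"
proof -
  define w where "w = (\<lambda>(x,i,k). p x * (a x i * (cmod (cin D (f k) (e x i)))\<^sup>2))"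
  define z where "z = (\<lambda>(x,i,k). ln (b k) - ln (a x i))"
  let ?A = "(UNIV :: 'x set) \<times> {..<D} \<times> {..<D}"
  have sumA: "(\<Sum>t\<in>?A. g t) = (\<Sum>x\<in>UNIV. \<Sum>i<D. \<Sum>k<D. g (x,i,k))" for g :: "_ \<Rightarrow> real"
    by (simp add: sum.cartesian_product case_prod_unfold)
  have w1: "sum w ?A = 1"
    using ns_weights[OF e f a(2)] p unfolding sumA
    by (simp add: w_def sum_distrib_left[symmetric] is_dist_def)
  have "(\<Sum>t\<in>?A. w t * z t) = (\<Sum>x\<in>UNIV. p x * - ns D (a x) (e x) b f (\<lambda>u v. ln u - ln v))"
    unfolding sumA ns_def sum_negf[symmetric] sum_distrib_left
    by (intro sum.cong refl) (simp add: w_def z_def algebra_simps)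
  then have "(\<Sum>t\<in>?A. w t * z t) < - \<mu>" using gt by (simp add: sum_negf)
  from mgf_bound[OF _ w1 this] obtain s0 where s0: "s0 > 0"
    "\<And>s. 0 < s \<Longrightarrow> s < s0 \<Longrightarrow> (\<Sum>t\<in>?A. w t * exp (s * z t)) \<le> exp (s * - \<mu>)" by auto
  define s where "s = s0 / 2"
  have s: "0 < s" "s < s0" using s0 by (auto simp: s_def)
  have "(\<Sum>t\<in>?A. w t * exp (s * z t)) = (\<Sum>x\<in>UNIV. p x * ns D (a x) (e x) b f (\<lambda>u v. (v / u) powr s))"
    unfolding sumA ns_def sum_distrib_left
  proof (intro sum.cong refl)
    fix x i k assume ik: "i \<in> {..<D}" "k \<in> {..<D}"
    show "w (x,i,k) * exp (s * z (x,i,k)) = p x * (a x i * (cmod (cin D (f k) (e x i)))\<^sup>2 * (b k / a x i) powr s)"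
    proof (cases "w (x,i,k) = 0")
      case True
      then show ?thesis by (auto simp: w_def)
    next
      case False
      then have "a x i > 0" "b k > 0" using a(1)[of i x] b[of k] supp[of i k x] ik by (auto simp: w_def less_le)
      then have "(b k / a x i) powr s = exp (s * z (x,i,k))" by (simp add: powr_def z_def ln_div)
      then show ?thesis by (simp add: w_def)
    qed
  qed
  then show ?thesis using s0(2)[OF s] s by auto
qed

section \<open>The capacity-achieving output state\<close>

text \<open>Relative entropy is the mean log-likelihood ratio under the Nussbaum-Szkola
  distribution; this is what lets classical large-deviation estimates see it. The factor
  \<open>ln 2\<close> passes from bits to nats.\<close>

lemma rel_entropy_ns:
  assumes A: "spec D A a e" and B: "spec D B m f"
  shows "rel_entropy A B * ln 2 = ns D a e m f (\<lambda>u v. ln u - ln v)"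
proof -
  have "(\<Sum>i<D. a i * log 2 (a i)) = (\<Sum>i<D. \<Sum>k<D. a i * log 2 (a i) * (cmod (cin D (f k) (e i)))\<^sup>2)"
    using nsq_onb[OF spec_onb[OF A]]
    by (simp add: sum_distrib_left[symmetric] onb_Parseval_nsq[OF spec_onb[OF B]])
  then have "rel_entropy A B = (\<Sum>i<D. \<Sum>k<D. a i * (cmod (cin D (f k) (e i)))\<^sup>2 * (log 2 (a i) - log 2 (m k)))"
    unfolding rel_entropy_spec[OF A B] by (simp add: sum_subtractf[symmetric] algebra_simps)
  also have "\<dots> = ns D a e m f (\<lambda>u v. ln u - ln v) / ln 2"
    by (simp add: ns_def sum_divide_distrib log_def flip: diff_divide_distrib)
  finally show ?thesis by simp
qed

text \<open>Klein's inequality. Termwise \<open>ln y \<le> y - 1\<close> bounds the summand below by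
  \<open>(a i - m k)\<close> times the overlap, and these sum to zero because both spectra sum to
  1.\<close>

lemma ns_ln_nonneg:
  assumes e: "onb D e" and f: "onb D f"
    and a: "\<And>i. i < D \<Longrightarrow> 0 \<le> a i" "(\<Sum>i<D. a i) = 1"
    and m: "\<And>k. k < D \<Longrightarrow> 0 \<le> m k" "(\<Sum>k<D. m k) = 1"
    and supp: "\<And>i k. i < D \<Longrightarrow> k < D \<Longrightarrow> m k = 0 \<Longrightarrow> a i * (cmod (cin D (f k) (e i)))\<^sup>2 = 0"
  shows "0 \<le> ns D a e m f (\<lambda>u v. ln u - ln v)"
proof -
  let ?c = "\<lambda>i k. (cmod (cin D (f k) (e i)))\<^sup>2"
  have "(\<Sum>i<D. \<Sum>k<D. m k * ?c i k) = (\<Sum>k<D. \<Sum>i<D. m k * ?c i k)" by (rule sum.swap)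
  also have "\<dots> = 1"
    using ns_weights[OF f e m(2)] by (metis (no_types, lifting) cnj_cin complex_mod_cnj sum.cong)
  finally have "0 = (\<Sum>i<D. \<Sum>k<D. (a i - m k) * ?c i k)"
    using ns_weights[OF e f a(2)] by (simp add: left_diff_distrib sum_subtractf)
  also have "\<dots> \<le> ns D a e m f (\<lambda>u v. ln u - ln v)"
    unfolding ns_def
  proof (intro sum_mono)
    fix i k assume "i \<in> {..<D}" "k \<in> {..<D}"
    then have ik: "i < D" "k < D" by auto
    show "(a i - m k) * ?c i k \<le> a i * ?c i k * (ln (a i) - ln (m k))"
    proof (cases "a i * ?c i k = 0")
      case True
      then have "(a i - m k) * ?c i k \<le> 0" using m(1)[OF ik(2)] by (auto simp: left_diff_distrib)
      then show ?thesis by (simp only: True mult_zero_left)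
    next
      case False
      then have pos: "a i > 0" "m k > 0" using a(1)[OF ik(1)] m(1)[OF ik(2)] supp[OF ik] by (auto simp: less_le)
      have "ln (m k / a i) \<le> m k / a i - 1" using pos by (intro ln_le_minus_one) auto
      then have "1 - m k / a i \<le> ln (a i) - ln (m k)" using pos by (simp add: ln_div)
      then have "a i * ?c i k * (1 - m k / a i) \<le> a i * ?c i k * (ln (a i) - ln (m k))"
        using pos by (intro mult_left_mono) auto
      moreover have "a i * ?c i k * (1 - m k / a i) = (a i - m k) * ?c i k" using pos by (simp add: field_simps)
      ultimately show ?thesis by (simp only:)
    qed
  qed
  finally show ?thesis .
qed

section \<open>Output states of input distributions\<close>

lemma mix_density:
  fixes W :: "'x::finite \<Rightarrow> complex mat"
  assumes W: "\<And>x. density d (W x)" and p: "is_dist UNIV p"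
  shows "density d (mix d UNIV W p)"
proof -
  have Wc: "W x \<in> carrier_mat d d" for x using W[of x] by (auto simp: density_def psd_def)
  have Wh: "herm d (\<lambda>i j. W x $$ (i,j))" for x
    using W[of x] herm_mat[OF Wc] by (auto simp: density_def psd_def)
  have c: "mix d UNIV W p \<in> carrier_mat d d" by (simp add: mix_def)
  have "herm d (\<lambda>i j. mix d UNIV W p $$ (i,j))"
    unfolding herm_def by (simp add: mix_def hermD[OF Wh])
  then have "cadj (mix d UNIV W p) = mix d UNIV W p" using herm_mat[OF c] by simp
  moreover have "0 \<le> Re (qform (mix d UNIV W p) v)" for v
  proof -
    have "qform (mix d UNIV W p) v = (\<Sum>i<d. \<Sum>j<d. \<Sum>x\<in>UNIV. of_real (p x) * (cnj (v i) * W x $$ (i,j) * v j))"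
      by (simp add: qform_def mix_def sum_distrib_left sum_distrib_right mult_ac)
    also have "\<dots> = (\<Sum>i<d. \<Sum>x\<in>UNIV. \<Sum>j<d. of_real (p x) * (cnj (v i) * W x $$ (i,j) * v j))"
      by (rule sum.cong[OF refl], rule sum.swap)
    also have "\<dots> = (\<Sum>x\<in>UNIV. \<Sum>i<d. \<Sum>j<d. of_real (p x) * (cnj (v i) * W x $$ (i,j) * v j))"
      by (rule sum.swap)
    also have "\<dots> = (\<Sum>x\<in>UNIV. of_real (p x) * qform (W x) v)"
      by (simp add: qform_def sum_distrib_left carrier_matD[OF Wc])
    finally have "Re (qform (mix d UNIV W p) v) = (\<Sum>x\<in>UNIV. p x * Re (qform (W x) v))" by simp
    also have "\<dots> \<ge> 0" using p W by (intro sum_nonneg mult_nonneg_nonneg) (auto simp: is_dist_def density_def psd_def)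
    finally show ?thesis .
  qed
  moreover have "mtrace (mix d UNIV W p) = 1"
  proof -
    have "mtrace (mix d UNIV W p) = (\<Sum>x\<in>UNIV. \<Sum>i<d. of_real (p x) * W x $$ (i,i))"
      by (simp add: mtrace_def mix_def) (rule sum.swap)
    also have "\<dots> = (\<Sum>x\<in>UNIV. of_real (p x) * mtrace (W x))"
      by (simp add: mtrace_def sum_distrib_left carrier_matD[OF Wc])
    also have "\<dots> = of_real (\<Sum>x\<in>UNIV. p x)" using W by (simp add: density_def)
    finally show ?thesis using p by (simp add: is_dist_def del: of_real_sum)
  qed
  ultimately show ?thesis using c by (simp add: density_def psd_def)
qed

lemma density_spec_exists:
  assumes "density d A"
  shows "\<exists>l e. spec d A l e"
  using assms by (intro spec_exists) (auto simp: density_def psd_def)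

lemma density_spec_family:
  assumes "\<And>x. density d (W x)"
  shows "\<exists>a e. (\<forall>x. spec d (W x) (a x) (e x)) \<and> (\<forall>x. \<forall>i<d. 0 \<le> a x i) \<and> (\<forall>x. (\<Sum>i<d. a x i) = 1)"
proof -
  have "\<forall>x. \<exists>ae. spec d (W x) (fst ae) (snd ae)" using density_spec_exists[OF assms] by simp
  then obtain ae where W: "\<And>x. spec d (W x) (fst (ae x)) (snd (ae x))" by metis
  show ?thesis
    by (rule exI[of _ "\<lambda>x. fst (ae x)"], rule exI[of _ "\<lambda>x. snd (ae x)"])
      (use W density_spec[OF assms W] in auto)
qed

lemma spec_quad:
  assumes "spec d A a e"
  shows "cin d v (ap d (\<lambda>i j. A $$ (i,j)) v) = of_real (\<Sum>i<d. a i * (cmod (cin d v (e i)))\<^sup>2)"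
proof -
  have "cin d v (ap d (\<lambda>i j. A $$ (i,j)) v) = cin d v (ap d (osum d a e) v)"
    unfolding cin_ap using specD[OF assms] by (intro sum.cong refl) simp
  also have "\<dots> = of_real (\<Sum>i<d. a i * (cmod (cin d v (e i)))\<^sup>2)"
    unfolding cin_ap_osum of_real_sum of_real_mult complex_norm_square cnj_cin by (simp add: mult_ac)
  finally show ?thesis .
qed

lemma mix_quad:
  fixes W :: "'x::finite \<Rightarrow> complex mat"
  assumes W: "\<And>x. spec d (W x) (a x) (e x)" and r: "spec d (mix d UNIV W p) m f"
  shows "(\<Sum>x\<in>UNIV. p x * (\<Sum>i<d. a x i * (cmod (cin d v (e x i)))\<^sup>2)) = (\<Sum>j<d. m j * (cmod (cin d v (f j)))\<^sup>2)"
proof -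
  have "complex_of_real (\<Sum>j<d. m j * (cmod (cin d v (f j)))\<^sup>2)
    = (\<Sum>i<d. \<Sum>j<d. \<Sum>x\<in>UNIV. of_real (p x) * (cnj (v i) * W x $$ (i,j) * v j))"
    unfolding spec_quad[OF r, symmetric] cin_ap by (simp add: mix_def sum_distrib_left sum_distrib_right mult_ac)
  also have "\<dots> = (\<Sum>i<d. \<Sum>x\<in>UNIV. \<Sum>j<d. of_real (p x) * (cnj (v i) * W x $$ (i,j) * v j))"
    by (rule sum.cong[OF refl], rule sum.swap)
  also have "\<dots> = (\<Sum>x\<in>UNIV. \<Sum>i<d. \<Sum>j<d. of_real (p x) * (cnj (v i) * W x $$ (i,j) * v j))"
    by (rule sum.swap)
  also have "\<dots> = (\<Sum>x\<in>UNIV. of_real (p x) * cin d v (ap d (\<lambda>i j. W x $$ (i,j)) v))"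
    by (simp only: cin_ap sum_distrib_left)
  also have "\<dots> = complex_of_real (\<Sum>x\<in>UNIV. p x * (\<Sum>i<d. a x i * (cmod (cin d v (e x i)))\<^sup>2))"
    by (simp only: spec_quad[OF W] of_real_sum of_real_mult)
  finally show ?thesis by (simp only: of_real_eq_iff)
qed

text \<open>An eigenvector of the mixture with eigenvalue 0 has expectation 0 in it; this is a sum
  of nonnegative contributions, each of which must vanish.\<close>

lemma mix_support:
  fixes W :: "'x::finite \<Rightarrow> complex mat"
  assumes W: "\<And>x. spec d (W x) (a x) (e x)" and a: "\<And>x i. i < d \<Longrightarrow> 0 \<le> a x i"
    and p: "is_dist UNIV p" and r: "spec d (mix d UNIV W p) m f"
    and k: "k < d" "m k = 0" and i: "i < d"
  shows "p x * (a x i * (cmod (cin d (f k) (e x i)))\<^sup>2) = 0"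
proof -
  have "(\<Sum>j<d. m j * (cmod (cin d (f k) (f j)))\<^sup>2) = 0"
    using spec_onb[OF r] k by (intro sum.neutral) (auto simp: onb_def)
  then have z: "(\<Sum>x\<in>UNIV. p x * (\<Sum>i<d. a x i * (cmod (cin d (f k) (e x i)))\<^sup>2)) = 0"
    using mix_quad[OF W r, of "f k"] by simp
  have in0: "0 \<le> (\<Sum>i<d. a x i * (cmod (cin d (f k) (e x i)))\<^sup>2)" for x
    using a by (intro sum_nonneg) auto
  have "p x * (\<Sum>i<d. a x i * (cmod (cin d (f k) (e x i)))\<^sup>2) = 0"
    using z in0 p by (subst (asm) sum_nonneg_eq_0_iff) (auto simp: is_dist_def)
  moreover have "(\<Sum>i<d. a x i * (cmod (cin d (f k) (e x i)))\<^sup>2) = 0 \<Longrightarrow> a x i * (cmod (cin d (f k) (e x i)))\<^sup>2 = 0"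
    using a i by (subst (asm) sum_nonneg_eq_0_iff) auto
  ultimately show ?thesis by auto
qed

lemma mutual_info_ns:
  fixes W :: "'x::finite \<Rightarrow> complex mat"
  assumes "\<And>x. spec d (W x) (a x) (e x)" "spec d (mix d UNIV W p) m f"
  shows "mutual_info d W p * ln 2 = (\<Sum>x\<in>UNIV. p x * ns d (a x) (e x) m f (\<lambda>u v. ln u - ln v))"
  unfolding mutual_info_def sum_distrib_right mult.assoc rel_entropy_ns[OF assms] ..

text \<open>Separates the entropy part from the cross term. The cross term is linear in the first
  state, so it can be averaged over inputs and passed to limits.\<close>

lemma ns_ln_split:
  assumes e: "onb D e" and f: "onb D f"
  shows "ns D a e m f (\<lambda>u v. ln u - ln v)
     = (\<Sum>i<D. a i * ln (a i)) - (\<Sum>k<D. ln (m k) * (\<Sum>i<D. a i * (cmod (cin D (f k) (e i)))\<^sup>2))"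
proof -
  have "ns D a e m f (\<lambda>u v. ln u - ln v)
    = (\<Sum>i<D. \<Sum>k<D. a i * ln (a i) * (cmod (cin D (f k) (e i)))\<^sup>2)
      - (\<Sum>i<D. \<Sum>k<D. ln (m k) * (a i * (cmod (cin D (f k) (e i)))\<^sup>2))"
    by (simp add: ns_def sum_subtractf[symmetric] algebra_simps)
  also have "(\<Sum>i<D. \<Sum>k<D. a i * ln (a i) * (cmod (cin D (f k) (e i)))\<^sup>2) = (\<Sum>i<D. a i * ln (a i))"
    using nsq_onb[OF e] by (simp add: sum_distrib_left[symmetric] onb_Parseval_nsq[OF f])
  also have "(\<Sum>i<D. \<Sum>k<D. ln (m k) * (a i * (cmod (cin D (f k) (e i)))\<^sup>2))
    = (\<Sum>k<D. ln (m k) * (\<Sum>i<D. a i * (cmod (cin D (f k) (e i)))\<^sup>2))"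
    by (subst sum.swap) (simp add: sum_distrib_left)
  finally show ?thesis .
qed

text \<open>The difference of both sides is the relative entropy of \<open>W(p)\<close> to the state with spectrum \<open>m'\<close> and
  eigenbasis \<open>f'\<close>.\<close>

lemma mutual_info_le:
  fixes W :: "'x::finite \<Rightarrow> complex mat"
  assumes Wd: "\<And>x. density d (W x)" and W: "\<And>x. spec d (W x) (a x) (e x)" and p: "is_dist UNIV p"
    and f': "onb d f'" and m': "\<And>k. k < d \<Longrightarrow> 0 \<le> m' k" "(\<Sum>k<d. m' k) = 1"
    and supp: "\<And>x i k. i < d \<Longrightarrow> k < d \<Longrightarrow> m' k = 0 \<Longrightarrow> p x * (a x i * (cmod (cin d (f' k) (e x i)))\<^sup>2) = 0"
  shows "mutual_info d W p * ln 2 \<le> (\<Sum>x\<in>UNIV. p x * ns d (a x) (e x) m' f' (\<lambda>u v. ln u - ln v))"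
proof -
  have rd: "density d (mix d UNIV W p)" by (rule mix_density[OF Wd p])
  from density_spec_exists[OF rd] obtain m f where r: "spec d (mix d UNIV W p) m f" by blast
  note f = spec_onb[OF r] and m = density_spec[OF rd r]
  have e: "onb d (e x)" for x by (rule spec_onb[OF W])
  define h where "h = (\<lambda>x. \<Sum>i<d. a x i * ln (a x i))"
  \<comment> \<open>After averaging, the cross term sees the letters only through W(p), for any
    basis and spectrum of the second argument.\<close>
  have avg: "(\<Sum>x\<in>UNIV. p x * ns d (a x) (e x) m' f' (\<lambda>u v. ln u - ln v))
     = (\<Sum>x\<in>UNIV. p x * h x) - (\<Sum>k<d. ln (m' k) * (\<Sum>j<d. m j * (cmod (cin d (f' k) (f j)))\<^sup>2))"
    if f': "onb d f'" for m' f'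
  proof -
    have "(\<Sum>x\<in>UNIV. p x * ns d (a x) (e x) m' f' (\<lambda>u v. ln u - ln v))
      = (\<Sum>x\<in>UNIV. p x * h x) - (\<Sum>x\<in>UNIV. \<Sum>k<d. ln (m' k) * (p x * (\<Sum>i<d. a x i * (cmod (cin d (f' k) (e x i)))\<^sup>2)))"
      unfolding ns_ln_split[OF e f'] h_def by (simp add: right_diff_distrib sum_subtractf sum_distrib_left mult_ac)
    also have "(\<Sum>x\<in>UNIV. \<Sum>k<d. ln (m' k) * (p x * (\<Sum>i<d. a x i * (cmod (cin d (f' k) (e x i)))\<^sup>2)))
      = (\<Sum>k<d. \<Sum>x\<in>UNIV. ln (m' k) * (p x * (\<Sum>i<d. a x i * (cmod (cin d (f' k) (e x i)))\<^sup>2)))"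
      by (rule sum.swap)
    also have "\<dots> = (\<Sum>k<d. ln (m' k) * (\<Sum>j<d. m j * (cmod (cin d (f' k) (f j)))\<^sup>2))"
      unfolding sum_distrib_left[symmetric] mix_quad[OF W r] ..
    finally show ?thesis .
  qed
  have "0 \<le> ns d m f m' f' (\<lambda>u v. ln u - ln v)"
  proof (rule ns_ln_nonneg[OF f f' m m'])
    fix i k assume ik: "i < d" "k < d" "m' k = 0"
    have "(\<Sum>j<d. m j * (cmod (cin d (f' k) (f j)))\<^sup>2) = 0"
      unfolding mix_quad[OF W r, symmetric] sum_distrib_left
      by (intro sum.neutral ballI) (use supp ik in auto)
    then show "m i * (cmod (cin d (f' k) (f i)))\<^sup>2 = 0"
      using m(1) ik by (subst (asm) sum_nonneg_eq_0_iff) auto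
  qed auto
  also have "ns d m f m' f' (\<lambda>u v. ln u - ln v) = (\<Sum>k<d. ln (m k) * (\<Sum>j<d. m j * (cmod (cin d (f k) (f j)))\<^sup>2))
     - (\<Sum>k<d. ln (m' k) * (\<Sum>j<d. m j * (cmod (cin d (f' k) (f j)))\<^sup>2))"
  proof -
    have 1: "(\<Sum>k<d. ln (m k) * (\<Sum>j<d. m j * (cmod (cin d (f k) (f j)))\<^sup>2)) = (\<Sum>k<d. m k * ln (m k))"
    proof (rule sum.cong[OF refl])
      fix k assume k: "k \<in> {..<d}"
      have "(\<Sum>j<d. m j * (cmod (cin d (f k) (f j)))\<^sup>2) = (\<Sum>j<d. if j = k then m k else 0)"
        using f k by (intro sum.cong refl) (auto simp: onb_def)
      then show "ln (m k) * (\<Sum>j<d. m j * (cmod (cin d (f k) (f j)))\<^sup>2) = m k * ln (m k)" using k by simp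
    qed
    show ?thesis unfolding ns_ln_split[OF f f'] 1 ..
  qed
  finally show ?thesis
    unfolding mutual_info_ns[OF W r] avg[OF f] avg[OF f'] by linarith
qed

section \<open>Perturbation of near-optimal inputs and passage to the limit\<close>

lemma common_convergent_subsequence:
  fixes z :: "'i \<Rightarrow> nat \<Rightarrow> complex"
  assumes "finite I" "\<And>i k. i \<in> I \<Longrightarrow> cmod (z i k) \<le> 1"
  shows "\<exists>r l. strict_mono r \<and> (\<forall>i\<in>I. (\<lambda>k. z i (r k)) \<longlonglongrightarrow> l i)"
  using assms
proof (induction I rule: finite_induct)
  case empty
  show ?case by (intro exI[of _ "\<lambda>k. k"]) (auto simp: strict_mono_def)
next
  case (insert i I)
  then have "\<exists>r l. strict_mono r \<and> (\<forall>i\<in>I. (\<lambda>k. z i (r k)) \<longlonglongrightarrow> l i)" by simp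
  then obtain r l where r: "strict_mono r" "\<And>j. j \<in> I \<Longrightarrow> (\<lambda>k. z j (r k)) \<longlonglongrightarrow> l j" by blast
  have "bounded (range (\<lambda>k. z i (r k)))" using insert.prems by (auto simp: bounded_iff intro!: exI[of _ 1])
  from bounded_imp_convergent_subsequence[OF this] obtain l' r' where r': "strict_mono r'"
    "((\<lambda>k. z i (r k)) \<circ> r') \<longlonglongrightarrow> l'" by auto
  have "strict_mono (r \<circ> r')" using r(1) r'(1) by (rule strict_mono_o)
  moreover have "(\<lambda>k. z j ((r \<circ> r') k)) \<longlonglongrightarrow> (if j = i then l' else l j)" if "j \<in> insert i I" for j
  proof (cases "j = i")
    case True
    then show ?thesis using r'(2) by (simp add: o_def)
  next
    case False
    then have "(\<lambda>k. z j (r k)) \<longlonglongrightarrow> l j" using that r(2) by auto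
    from LIMSEQ_subseq_LIMSEQ[OF this r'(1)] show ?thesis using False by (simp add: o_def)
  qed
  ultimately show ?case
    by (intro exI[of _ "r \<circ> r'"] exI[of _ "\<lambda>j. if j = i then l' else l j"] conjI ballI)
qed

text \<open>With N the relative entropies to the perturbed output, the information of the new input
  is \<open>(1 - t)\<close> times the p-mean of N plus \<open>t * N x\<close>. It is at most C,
  while that mean is at least the old information. The gap \<open>t^2\<close> is chosen so that
  division by \<open>t\<close> leaves the error \<open>t\<close>. The positive mass at
  \<open>x\<close> puts the support of \<open>W x\<close> inside that of the output.\<close>

lemma perturbed_input:
  fixes W :: "'x::finite \<Rightarrow> complex mat" and x :: 'x
  assumes Wd: "\<And>x. density d (W x)" and W: "\<And>x. spec d (W x) (a x) (e x)"
    and C: "\<And>p. is_dist UNIV p \<Longrightarrow> mutual_info d W p \<le> C"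
    and p: "is_dist UNIV p" "C - t\<^sup>2 \<le> mutual_info d W p" and t: "0 < t" "t < 1"
  defines "p' \<equiv> \<lambda>y. (1 - t) * p y + (if y = x then t else 0)"
  assumes r: "spec d (mix d UNIV W p') m f"
  shows "is_dist UNIV p'" "ns d (a x) (e x) m f (\<lambda>u v. ln u - ln v) \<le> (C + t) * ln 2"
    and "\<And>i k. i < d \<Longrightarrow> k < d \<Longrightarrow> m k = 0 \<Longrightarrow> a x i * (cmod (cin d (f k) (e x i)))\<^sup>2 = 0"
proof -
  show p': "is_dist UNIV p'"
    using p(1) t by (auto simp: is_dist_def p'_def sum.distrib simp flip: sum_distrib_left)
  have a: "\<And>x i. i < d \<Longrightarrow> 0 \<le> a x i" using density_spec[OF Wd W] by auto
  note rd = mix_density[OF Wd p']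
  have sup: "p' y * (a y i * (cmod (cin d (f k) (e y i)))\<^sup>2) = 0" if "k < d" "m k = 0" "i < d" for y i k
    by (rule mix_support[OF W _ p' r that]) (rule a)
  have px: "p' x > 0" using p(1) t by (simp add: p'_def is_dist_def add_nonneg_pos)
  show "a x i * (cmod (cin d (f k) (e x i)))\<^sup>2 = 0" if "i < d" "k < d" "m k = 0" for i k
    using sup[OF that(2,3,1), of x] px by simp
  define N where "N = (\<lambda>y. ns d (a y) (e y) m f (\<lambda>u v. ln u - ln v))"
  have "mutual_info d W p * ln 2 \<le> (\<Sum>y\<in>UNIV. p y * N y)"
    unfolding N_def
  proof (rule mutual_info_le[OF Wd W p(1) spec_onb[OF r] density_spec[OF rd r]])
    fix y i k assume ik: "i < d" "k < d" "m k = 0"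
    show "p y * (a y i * (cmod (cin d (f k) (e y i)))\<^sup>2) = 0"
    proof (cases "p y = 0")
      case False
      then have "p y > 0" using p(1) by (auto simp: is_dist_def less_le)
      then have "p' y > 0" using t by (simp add: p'_def add_pos_nonneg)
      then show ?thesis using sup[OF ik(2,3,1), of y] by simp
    qed simp
  qed
  then have 1: "(1 - t) * (mutual_info d W p * ln 2) \<le> (1 - t) * (\<Sum>y\<in>UNIV. p y * N y)"
    using t by (intro mult_left_mono) auto
  have "mutual_info d W p' * ln 2 = (\<Sum>y\<in>UNIV. p' y * N y)" unfolding N_def by (rule mutual_info_ns[OF W r])
  also have "\<dots> = (\<Sum>y\<in>UNIV. (1 - t) * (p y * N y)) + (\<Sum>y\<in>UNIV. if y = x then t * N x else 0)"
    unfolding p'_def by (subst sum.distrib[symmetric]) (intro sum.cong refl, auto simp: algebra_simps)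
  also have "\<dots> = (1 - t) * (\<Sum>y\<in>UNIV. p y * N y) + t * N x" by (simp add: sum_distrib_left)
  finally have "(1 - t) * (mutual_info d W p * ln 2) + t * N x \<le> C * ln 2"
    using 1 mult_right_mono[OF C[OF p'], of "ln 2"] by simp
  then have "t * N x \<le> (C - (1 - t) * mutual_info d W p) * ln 2" by (simp add: algebra_simps)
  also have "\<dots> \<le> (t * (C + t)) * ln 2"
  proof (rule mult_right_mono)
    have "C - (1 - t) * mutual_info d W p = (C - mutual_info d W p) + t * mutual_info d W p" by (simp add: algebra_simps)
    also have "\<dots> \<le> t\<^sup>2 + t * C" using p(2) t C[OF p(1)] by (intro add_mono mult_left_mono) auto
    finally show "C - (1 - t) * mutual_info d W p \<le> t * (C + t)" by (simp add: power2_eq_square algebra_simps)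
  qed simp
  finally show "ns d (a x) (e x) m f (\<lambda>u v. ln u - ln v) \<le> (C + t) * ln 2"
    using t unfolding N_def by (simp add: mult.assoc)
qed

text \<open>Lower semicontinuity of the relative entropy in its second argument.\<close>

lemma cross_entropy_limit:
  fixes w m :: "nat \<Rightarrow> nat \<Rightarrow> real"
  assumes w: "\<And>j. j < d \<Longrightarrow> (\<lambda>k. w k j) \<longlonglongrightarrow> w' j" and m: "\<And>j. j < d \<Longrightarrow> (\<lambda>k. m k j) \<longlonglongrightarrow> m' j"
    and w0: "\<And>k j. j < d \<Longrightarrow> 0 \<le> w k j" and m0: "\<And>k j. j < d \<Longrightarrow> 0 \<le> m k j" "\<And>k j. j < d \<Longrightarrow> m k j \<le> 1"
    and supp: "\<And>k j. j < d \<Longrightarrow> m k j = 0 \<Longrightarrow> w k j = 0"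
    and R: "\<And>k. (\<Sum>j<d. - ln (m k j) * w k j) \<le> R k" "R \<longlonglongrightarrow> R'"
  shows "\<And>j. j < d \<Longrightarrow> m' j = 0 \<Longrightarrow> w' j = 0" "(\<Sum>j<d. - ln (m' j) * w' j) \<le> R'"
proof -
  have term0: "0 \<le> - ln (m k j) * w k j" if "j < d" for k j
  proof (cases "m k j = 0")
    case False
    then have "ln (m k j) \<le> 0" using m0[OF that, of k] by (simp add: ln_le_zero_iff less_le)
    then show ?thesis using w0[OF that, of k] by (simp add: mult_nonpos_nonneg)
  qed simp
  have term_le: "- ln (m k j) * w k j \<le> R k" if "j < d" for k j
  proof -
    have "- ln (m k j) * w k j \<le> (\<Sum>j<d. - ln (m k j) * w k j)"
      using that term0 by (intro member_le_sum[of j]) auto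
    then show ?thesis using R(1)[of k] by linarith
  qed
  \<comment> \<open>If \<open>w' j\<close> were positive, the bounded right-hand side would keep
    \<open>m k j\<close> above a positive constant, contradicting the limit 0.\<close>
  show supp': "w' j = 0" if j: "j < d" "m' j = 0" for j
  proof (rule ccontr)
    assume "w' j \<noteq> 0"
    moreover have "0 \<le> w' j" using LIMSEQ_le_const[OF w[OF j(1)]] w0[OF j(1)] by blast
    ultimately have pos: "w' j > 0" by simp
    have "\<forall>\<^sub>F k in sequentially. w' j / 2 < w k j"
      using order_tendstoD(1)[OF w[OF j(1)], of "w' j / 2"] pos by simp
    moreover have "\<forall>\<^sub>F k in sequentially. R k < \<bar>R'\<bar> + 1"
      using order_tendstoD(2)[OF R(2), of "\<bar>R'\<bar> + 1"] by simp
    ultimately have "\<forall>\<^sub>F k in sequentially. exp (- (2 * (\<bar>R'\<bar> + 1) / w' j)) \<le> m k j"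
    proof eventually_elim
      case (elim k)
      have wpos: "w k j > 0" using elim(1) pos by linarith
      then have mpos: "m k j > 0" using supp[OF j(1), of k] m0(1)[OF j(1), of k] by (auto simp: less_le)
      have ln0: "- ln (m k j) \<ge> 0" using mpos m0(2)[OF j(1), of k] by simp
      have "- ln (m k j) * (w' j / 2) \<le> - ln (m k j) * w k j" using elim(1) ln0 by (intro mult_left_mono) auto
      also have "\<dots> \<le> \<bar>R'\<bar> + 1" using term_le[OF j(1), of k] elim(2) by linarith
      finally have "- ln (m k j) \<le> 2 * (\<bar>R'\<bar> + 1) / w' j" using pos by (simp add: field_simps)
      then have "exp (- (2 * (\<bar>R'\<bar> + 1) / w' j)) \<le> exp (ln (m k j))" by simp
      then show ?case using mpos by simp
    qed
    then have "exp (- (2 * (\<bar>R'\<bar> + 1) / w' j)) \<le> m' j"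
      using tendsto_lowerbound[OF m[OF j(1)]] by simp
    then show False using j(2) by (metis exp_gt_zero not_le)
  qed
  \<comment> \<open>The logarithm is continuous only at positive arguments. The coordinates outside
    \<open>J\<close> contribute nonnegative terms before the limit, which may be dropped, and 0 in
    the limit.\<close>
  define J where "J = {j. j < d \<and> m' j \<noteq> 0}"
  have J: "finite J" "J \<subseteq> {..<d}" by (auto simp: J_def)
  have "(\<lambda>k. \<Sum>j\<in>J. - ln (m k j) * w k j) \<longlonglongrightarrow> (\<Sum>j\<in>J. - ln (m' j) * w' j)"
    by (intro tendsto_intros) (auto simp: J_def intro: w m)
  moreover have "(\<Sum>j\<in>J. - ln (m k j) * w k j) \<le> R k" for k
    by (rule order_trans[OF sum_mono2[OF _ J(2)] R(1)]) (use term0 in auto)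
  ultimately have "(\<Sum>j\<in>J. - ln (m' j) * w' j) \<le> R'"
    using R(2) by (intro LIMSEQ_le[of "\<lambda>k. \<Sum>j\<in>J. - ln (m k j) * w k j" _ R]) auto
  moreover have "(\<Sum>j<d. - ln (m' j) * w' j) = (\<Sum>j\<in>J. - ln (m' j) * w' j)"
    using J by (intro sum.mono_neutral_right) (auto simp: J_def)
  ultimately show "(\<Sum>j<d. - ln (m' j) * w' j) \<le> R'" by simp
qed

text \<open>Moving a nearly optimal input slightly towards the letter \<open>x\<close> shows that the relative entropy of \<open>W x\<close> to the
  perturbed output is almost at most \<open>C\<close>. Along a subsequence the perturbed outputs and their spectral
  decompositions converge, and by uniqueness of the functional calculus the limits for different \<open>x\<close> agree.\<close>

theorem capacity_output_state:
  fixes W :: "'x::finite \<Rightarrow> complex mat"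
  assumes Wd: "\<And>x. density d (W x)" and W: "\<And>x. spec d (W x) (a x) (e x)"
    and C: "\<And>p. is_dist UNIV p \<Longrightarrow> mutual_info d W p \<le> C"
    and near: "\<And>\<delta>. \<delta> > 0 \<Longrightarrow> \<exists>p. is_dist UNIV p \<and> C - \<delta> \<le> mutual_info d W p"
  shows "\<exists>b f. onb d f \<and> (\<forall>k<d. 0 \<le> b k) \<and> (\<Sum>k<d. b k) = 1 \<and>
     (\<forall>x. \<forall>i<d. \<forall>k<d. b k = 0 \<longrightarrow> a x i * (cmod (cin d (f k) (e x i)))\<^sup>2 = 0) \<and>
     (\<forall>x. ns d (a x) (e x) b f (\<lambda>u v. ln u - ln v) \<le> C * ln 2)"
proof -
  have e: "onb d (e x)" for x by (rule spec_onb[OF W])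
  have a: "\<And>x i. i < d \<Longrightarrow> 0 \<le> a x i" using density_spec[OF Wd W] by auto
  define t where "t = (\<lambda>k::nat. 1 / (real k + 2))"
  have t: "0 < t k" "t k < 1" for k by (auto simp: t_def)
  have t_lim: "t \<longlonglongrightarrow> 0" unfolding t_def by real_asymp
  have "\<exists>p. is_dist UNIV p \<and> C - (t k)\<^sup>2 \<le> mutual_info d W p" for k
    using near[of "(t k)\<^sup>2"] t[of k] by simp
  then obtain P where P: "\<And>k. is_dist UNIV (P k)" "\<And>k. C - (t k)\<^sup>2 \<le> mutual_info d W (P k)" by metis
  define P' where "P' = (\<lambda>k x y. (1 - t k) * P k y + (if y = x then t k else 0))"
  have P': "is_dist UNIV (P' k x)" for k x
    using P(1)[of k] t[of k] by (auto simp: is_dist_def P'_def sum.distrib simp flip: sum_distrib_left)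
  have "\<forall>k x. \<exists>mf. spec d (mix d UNIV W (P' k x)) (fst mf) (snd mf)"
    using density_spec_exists[OF mix_density[OF Wd P']] by simp
  then obtain mf where mf: "\<And>k x. spec d (mix d UNIV W (P' k x)) (fst (mf k x)) (snd (mf k x))" by metis
  define m where "m = (\<lambda>k x. fst (mf k x))"
  define f where "f = (\<lambda>k x. snd (mf k x))"
  have r: "spec d (mix d UNIV W (P' k x)) (m k x) (f k x)" for k x using mf by (simp add: m_def f_def)
  note rd = mix_density[OF Wd P']
  note f_onb = spec_onb[OF r] and m_dens = density_spec[OF rd r]
  have pert: "ns d (a x) (e x) (m k x) (f k x) (\<lambda>u v. ln u - ln v) \<le> (C + t k) * ln 2" for k x
    by (rule perturbed_input(2)[OF Wd W _ P t r[unfolded P'_def]], rule C)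
  have pert_supp: "a x i * (cmod (cin d (f k x j) (e x i)))\<^sup>2 = 0" if "i < d" "j < d" "m k x j = 0" for k x i j
    by (rule perturbed_input(3)[OF Wd W _ P t r[unfolded P'_def] that], rule C)
  have m_le1: "m k x j \<le> 1" if "j < d" for k x j
    using member_le_sum[of j "{..<d}" "m k x"] m_dens that by simp
  have f_le1: "cmod (f k x j i) \<le> 1" if "j < d" "i < d" for k x j i
    by (rule onb_entry_le[OF f_onb that])
  have P_le1: "P k y \<le> 1" "0 \<le> P k y" for k y
    using member_le_sum[of y UNIV "P k"] P(1)[of k] by (auto simp: is_dist_def)
  \<comment> \<open>All inputs, eigenvalues and eigenvector entries are collected in one finite
    family bounded by 1, so that one subsequence makes everything converge.\<close>
  define z :: "'x + ('x \<times> nat) + ('x \<times> nat \<times> nat) \<Rightarrow> nat \<Rightarrow> complex" where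
    "z = (\<lambda>c k. case c of Inl y \<Rightarrow> of_real (P k y) | Inr (Inl (x,j)) \<Rightarrow> of_real (m k x j) | Inr (Inr (x,j,i)) \<Rightarrow> f k x j i)"
  let ?I = "(UNIV :: 'x set) <+> ((UNIV :: 'x set) \<times> {..<d}) <+> ((UNIV :: 'x set) \<times> {..<d} \<times> {..<d})"
  have "finite ?I" by simp
  moreover have "cmod (z c k) \<le> 1" if "c \<in> ?I" for c k
    using that P_le1 m_le1 m_dens(1) f_le1 by (auto simp: z_def)
  ultimately have "\<exists>r l. strict_mono r \<and> (\<forall>c\<in>?I. (\<lambda>k. z c (r k)) \<longlonglongrightarrow> l c)"
    by (rule common_convergent_subsequence)
  then obtain q l where q: "strict_mono q" and l: "\<And>c. c \<in> ?I \<Longrightarrow> (\<lambda>k. z c (q k)) \<longlonglongrightarrow> l c" by blast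
  define P0 where "P0 = (\<lambda>y. Re (l (Inl y)))"
  define m' where "m' = (\<lambda>x j. Re (l (Inr (Inl (x,j)))))"
  define f' where "f' = (\<lambda>x j i. l (Inr (Inr (x,j,i))))"
  have limP: "(\<lambda>k. P (q k) y) \<longlonglongrightarrow> P0 y" for y
    using tendsto_Re[OF l[OF InlI[of y]]] by (simp add: z_def P0_def)
  have limm: "(\<lambda>k. m (q k) x j) \<longlonglongrightarrow> m' x j" if "j < d" for x j
    using tendsto_Re[OF l[OF InrI[OF InlI[of "(x,j)"]]]] that by (simp add: z_def m'_def)
  have limf: "(\<lambda>k. f (q k) x j i) \<longlonglongrightarrow> f' x j i" if "j < d" "i < d" for x j i
    using l[OF InrI[OF InrI[of "(x,j,i)"]]] that by (simp add: z_def f'_def)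
  have limt: "(\<lambda>k. t (q k)) \<longlonglongrightarrow> 0" using LIMSEQ_subseq_LIMSEQ[OF t_lim q] by (simp add: o_def)
  have limP': "(\<lambda>k. P' (q k) x y) \<longlonglongrightarrow> P0 y" for x y
  proof -
    have "(\<lambda>k. if y = x then t (q k) else 0) \<longlonglongrightarrow> 0" using limt by (cases "y = x") simp_all
    then have "(\<lambda>k. (1 - t (q k)) * P (q k) y + (if y = x then t (q k) else 0)) \<longlonglongrightarrow> (1 - 0) * P0 y + 0"
      by (intro tendsto_intros limt limP)
    then show ?thesis by (simp add: P'_def)
  qed
  have onb': "onb d (f' x)" for x
    unfolding onb_def
  proof (intro allI impI)
    fix i j assume ij: "i < d" "j < d"
    have "(\<lambda>k. cin d (f (q k) x i) (f (q k) x j)) \<longlonglongrightarrow> cin d (f' x i) (f' x j)"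
      unfolding cin_def using ij by (intro tendsto_intros limf) auto
    moreover have "cin d (f (q k) x i) (f (q k) x j) = (if i = j then 1 else 0)" for k
      using f_onb ij unfolding onb_def by blast
    ultimately show "cin d (f' x i) (f' x j) = (if i = j then 1 else 0)"
      by (simp add: LIMSEQ_const_iff)
  qed
  \<comment> \<open>The mass moved to \<open>x\<close> tends to 0, so the limit state is the same
    for all \<open>x\<close>, although its limiting eigenvalues and eigenvectors may depend on
    \<open>x\<close>.\<close>
  have osum': "osum d (m' x) (f' x) i j = (\<Sum>y\<in>UNIV. of_real (P0 y) * W y $$ (i,j))" if ij: "i < d" "j < d" for x i j
  proof -
    have "(\<lambda>k. osum d (m (q k) x) (f (q k) x) i j) \<longlonglongrightarrow> osum d (m' x) (f' x) i j"
      unfolding osum_def using ij by (intro tendsto_intros limf limm) auto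
    moreover have "osum d (m (q k) x) (f (q k) x) i j = (\<Sum>y\<in>UNIV. of_real (P' (q k) x y) * W y $$ (i,j))" for k
      using specD[OF r ij, of "q k" x] ij by (simp add: mix_def)
    moreover have "(\<lambda>k. \<Sum>y\<in>UNIV. of_real (P' (q k) x y) * W y $$ (i,j)) \<longlonglongrightarrow> (\<Sum>y\<in>UNIV. of_real (P0 y) * W y $$ (i,j))"
      by (intro tendsto_intros limP')
    ultimately show ?thesis using LIMSEQ_unique by simp
  qed
  have m'0: "0 \<le> m' x j" if "j < d" for x j
    using LIMSEQ_le_const[OF limm[OF that]] m_dens(1)[OF that] by blast
  have m'1: "(\<Sum>j<d. m' x j) = 1" for x
  proof -
    have "(\<lambda>k. \<Sum>j<d. m (q k) x j) \<longlonglongrightarrow> (\<Sum>j<d. m' x j)" by (intro tendsto_intros limm) auto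
    then show ?thesis by (simp add: m_dens(2) LIMSEQ_const_iff)
  qed
  define w where "w = (\<lambda>x (f :: nat \<Rightarrow> nat \<Rightarrow> complex) (j :: nat). \<Sum>i<d. a x i * (cmod (cin d (f j) (e x i)))\<^sup>2)"
  define H where "H = (\<lambda>x. \<Sum>i<d. a x i * ln (a x i))"
  have lim_w: "(\<lambda>k. w x (f (q k) x) j) \<longlonglongrightarrow> w x (f' x) j" if "j < d" for x j
    unfolding w_def cin_def using that by (intro tendsto_intros limf) auto
  have w0: "0 \<le> w x g j" for x g j unfolding w_def using a by (intro sum_nonneg) auto
  have w_supp: "w x (f k x) j = 0" if "j < d" "m k x j = 0" for k x j
    unfolding w_def using pert_supp that by (intro sum.neutral) auto
  have ce: "(\<Sum>j<d. - ln (m k x j) * w x (f k x) j) \<le> (C + t k) * ln 2 - H x" for k x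
    using pert[of x k] unfolding ns_ln_split[OF e f_onb] by (simp add: w_def H_def sum_negf)
  have lim_R: "(\<lambda>k. (C + t (q k)) * ln 2 - H x) \<longlonglongrightarrow> C * ln 2 - H x" for x
  proof -
    have "(\<lambda>k. (C + t (q k)) * ln 2 - H x) \<longlonglongrightarrow> (C + 0) * ln 2 - H x" by (intro tendsto_intros limt)
    then show ?thesis by simp
  qed
  have limit: "(\<Sum>j<d. - ln (m' x j) * w x (f' x) j) \<le> C * ln 2 - H x" for x
    by (rule cross_entropy_limit(2)[where w = "\<lambda>k. w x (f (q k) x)" and m = "\<lambda>k. m (q k) x"
          and R = "\<lambda>k. (C + t (q k)) * ln 2 - H x"])
      (rule lim_w limm w0 m_dens(1) m_le1 w_supp ce lim_R; assumption?)+
  have limit_supp: "w x (f' x) j = 0" if "j < d" "m' x j = 0" for x j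
    by (rule cross_entropy_limit(1)[where w = "\<lambda>k. w x (f (q k) x)" and m = "\<lambda>k. m (q k) x" and m' = "m' x"
          and R = "\<lambda>k. (C + t (q k)) * ln 2 - H x" and R' = "C * ln 2 - H x" and d = d])
      (rule lim_w limm w0 m_dens(1) m_le1 w_supp ce lim_R that; assumption?)+
  \<comment> \<open>Both sides are the trace of \<open>W x\<close> against \<phi> of the common
    limit state, computed in two spectral decompositions.\<close>
  have transfer: "(\<Sum>j<d. \<phi> (m' y j) * w x (f' y) j) = (\<Sum>j<d. \<phi> (m' x j) * w x (f' x) j)" for x y and \<phi> :: "real \<Rightarrow> real"
  proof -
    have tr: "trp d (osum d (a x) (e x)) (osum d (\<lambda>j. \<phi> (m' y j)) (f' y)) = of_real (\<Sum>j<d. \<phi> (m' y j) * w x (f' y) j)" for y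
      unfolding trp_osum_osum w_def sum_distrib_left by (subst sum.swap) (simp add: mult_ac)
    have "trp d (osum d (a x) (e x)) (osum d (\<lambda>j. \<phi> (m' y j)) (f' y))
      = trp d (osum d (a x) (e x)) (osum d (\<lambda>j. \<phi> (m' x j)) (f' x))"
    proof (rule trp_cong[OF refl])
      fix i j assume "i < d" "j < d"
      then show "osum d (\<lambda>j. \<phi> (m' y j)) (f' y) i j = osum d (\<lambda>j. \<phi> (m' x j)) (f' x) i j"
        by (intro functional_calculus_unique[where l = "m' y" and l' = "m' x" and f = \<phi>, OF onb' onb'])
          (simp_all only: osum')
    qed
    then show ?thesis unfolding tr of_real_eq_iff .
  qed
  define x0 :: 'x where "x0 = undefined"
  have "a x i * (cmod (cin d (f' x0 k) (e x i)))\<^sup>2 = 0" if ik: "i < d" "k < d" "m' x0 k = 0" for x i k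
  proof -
    \<comment> \<open>With this function \<phi> of the limit state is the projection onto its
      kernel, so \<open>transfer\<close> moves the support condition from the decomposition for
      \<open>x\<close> to that for \<open>x0\<close>.\<close>
    define \<phi> :: "real \<Rightarrow> real" where "\<phi> = (\<lambda>u. if u = 0 then 1 else 0)"
    have "(\<Sum>j<d. \<phi> (m' x j) * w x (f' x) j) = 0"
      by (intro sum.neutral ballI) (use limit_supp in \<open>auto simp: \<phi>_def\<close>)
    then have "(\<Sum>j<d. \<phi> (m' x0 j) * w x (f' x0) j) = 0" using transfer[of \<phi> x0 x] by simp
    moreover have "0 \<le> \<phi> (m' x0 j) * w x (f' x0) j" for j by (simp add: \<phi>_def w0)
    ultimately have "\<phi> (m' x0 k) * w x (f' x0) k = 0"
      using sum_nonneg_0[of "{..<d}" "\<lambda>j. \<phi> (m' x0 j) * w x (f' x0) j" k] ik by simp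
    then have "w x (f' x0) k = 0" using ik by (simp add: \<phi>_def)
    then show ?thesis using ik a unfolding w_def by (subst (asm) sum_nonneg_eq_0_iff) auto
  qed
  moreover have "ns d (a x) (e x) (m' x0) (f' x0) (\<lambda>u v. ln u - ln v) \<le> C * ln 2" for x
  proof -
    have "ns d (a x) (e x) (m' x0) (f' x0) (\<lambda>u v. ln u - ln v) = H x - (\<Sum>j<d. ln (m' x0 j) * w x (f' x0) j)"
      unfolding ns_ln_split[OF e onb'] H_def w_def ..
    also have "\<dots> = H x + (\<Sum>j<d. - ln (m' x j) * w x (f' x) j)"
      unfolding transfer[of ln x0 x] by (simp add: sum_negf)
    also have "\<dots> \<le> C * ln 2" using limit[of x] by simp
    finally show ?thesis .
  qed
  ultimately show ?thesis using onb' m'0 m'1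
    by (intro exI[of _ "m' x0"] exI[of _ "f' x0"] conjI) auto
qed

section \<open>Identification codes\<close>

lemma psd_effect:
  assumes "psd D E" "psd D (1\<^sub>m D - E)"
  shows "effect D (\<lambda>i j. E $$ (i,j))"
proof -
  have c: "E \<in> carrier_mat D D" using assms(1) by (simp add: psd_def)
  have q: "qform E v = cin D v (ap D (\<lambda>i j. E $$ (i,j)) v)" for v
    using c by (simp add: qform_def cin_ap)
  have "qform (1\<^sub>m D - E) v = cin D v v - cin D v (ap D (\<lambda>i j. E $$ (i,j)) v)" for v
  proof -
    have "qform (1\<^sub>m D - E) v = (\<Sum>i<D. \<Sum>j<D. (if j = i then cnj (v i) * v i else 0) - cnj (v i) * E $$ (i,j) * v j)"
      unfolding qform_def using c by (intro sum.cong) (auto simp: algebra_simps)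
    also have "\<dots> = cin D v v - cin D v (ap D (\<lambda>i j. E $$ (i,j)) v)"
      unfolding sum_subtractf cin_ap by (simp add: cin_def)
    finally show ?thesis .
  qed
  then have "Re (cin D v (ap D (\<lambda>i j. E $$ (i,j)) v)) \<le> nsq D v" for v
    using assms(2) unfolding psd_def by (metis Re_cin_self diff_ge_0_iff_ge minus_complex.sel(1))
  moreover have "0 \<le> Re (cin D v (ap D (\<lambda>i j. E $$ (i,j)) v))" for v
    using assms(1) unfolding psd_def q by blast
  moreover have "herm D (\<lambda>i j. E $$ (i,j))" using assms(1) herm_mat[OF c] by (simp add: psd_def)
  ultimately show ?thesis by (simp add: effect_def)
qed

lemma trp_mix:
  "trp D (\<lambda>i j. mix D S V p $$ (i,j)) T = (\<Sum>x\<in>S. of_real (p x) * trp D (\<lambda>i j. V x $$ (i,j)) T)"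
proof -
  have "trp D (\<lambda>i j. mix D S V p $$ (i,j)) T = (\<Sum>i<D. \<Sum>j<D. \<Sum>x\<in>S. of_real (p x) * (V x $$ (i,j) * T j i))"
    by (simp add: trp_def mix_def sum_distrib_right mult.assoc)
  also have "\<dots> = (\<Sum>i<D. \<Sum>x\<in>S. \<Sum>j<D. of_real (p x) * (V x $$ (i,j) * T j i))"
    by (rule sum.cong[OF refl], rule sum.swap)
  also have "\<dots> = (\<Sum>x\<in>S. \<Sum>i<D. \<Sum>j<D. of_real (p x) * (V x $$ (i,j) * T j i))" by (rule sum.swap)
  finally show ?thesis by (simp add: trp_def sum_distrib_left)
qed

text \<open>Two messages cannot share an approximating list: the test of the first gives at least
  \<open>1 - l1\<close> on its own output and at most \<open>l2\<close> on the other, while both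
  values are within \<kappa> of the value on the list. So the code injects into the lists of length
  M.\<close>

lemma id_code_size_le:
  fixes W :: "'x::finite \<Rightarrow> complex mat"
  assumes cov: "\<And>p. is_dist (seqs n) p \<Longrightarrow> \<exists>xs. length xs = M \<and> set xs \<subseteq> seqs n \<and> (\<forall>T. effect (d ^ n) T \<longrightarrow>
     cmod ((\<Sum>x\<in>seqs n. of_real (p x) * trp (d ^ n) (\<lambda>i j. tpow W x $$ (i,j)) T)
        - (\<Sum>x\<leftarrow>xs. trp (d ^ n) (\<lambda>i j. tpow W x $$ (i,j)) T) / of_nat M) \<le> \<kappa>)"
    and \<kappa>: "2 * \<kappa> < 1 - l1 - l2" and code: "is_id_code d W n N l1 l2 p E"
  shows "N \<le> (CARD('x) ^ n) ^ M"
proof -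
  define D where "D = d ^ n"
  define F where "F = (\<lambda>p T. Re (\<Sum>x\<in>seqs n. of_real (p x) * trp D (\<lambda>i j. tpow W x $$ (i,j)) T))"
  define A where "A = (\<lambda>xs T. Re ((\<Sum>x\<leftarrow>xs. trp D (\<lambda>i j. tpow W x $$ (i,j)) T) / of_nat M))"
  define Q where "Q = (\<lambda>p xs. length xs = M \<and> set xs \<subseteq> seqs n \<and> (\<forall>T. effect D T \<longrightarrow> \<bar>F p T - A xs T\<bar> \<le> \<kappa>))"
  have "\<exists>xs. Q p xs" if p: "is_dist (seqs n) p" for p
  proof -
    from cov[OF p] obtain xs where xs: "length xs = M" "set xs \<subseteq> seqs n" "\<And>T. effect D T \<Longrightarrow>
     cmod ((\<Sum>x\<in>seqs n. of_real (p x) * trp D (\<lambda>i j. tpow W x $$ (i,j)) T)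
        - (\<Sum>x\<leftarrow>xs. trp D (\<lambda>i j. tpow W x $$ (i,j)) T) / of_nat M) \<le> \<kappa>"
      unfolding D_def by blast
    have "\<bar>F p T - A xs T\<bar> \<le> \<kappa>" if "effect D T" for T
      using order_trans[OF abs_Re_le_cmod xs(3)[OF that]] unfolding F_def A_def minus_complex.sel .
    then show ?thesis using xs(1,2) unfolding Q_def by blast
  qed
  moreover have dist: "is_dist (seqs n) (p i)" if "i < N" for i using code that by (simp add: is_id_code_def)
  ultimately have "\<forall>i\<in>{..<N}. \<exists>xs. Q (p i) xs" by blast
  from bchoice[OF this] obtain xs where xs: "\<And>i. i < N \<Longrightarrow> Q (p i) (xs i)" by auto
  have tr: "Re (mtrace (tpow_mix d W n (p i) * E j)) = F (p i) (\<lambda>a b. E j $$ (a,b))" if "i < N" "j < N" for i j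
  proof -
    have "E j \<in> carrier_mat D D" using code that by (simp add: is_id_code_def psd_def D_def)
    then have "mtrace (tpow_mix d W n (p i) * E j)
      = trp D (\<lambda>a b. mix D (seqs n) (tpow W) (p i) $$ (a,b)) (\<lambda>a b. E j $$ (a,b))"
      unfolding tpow_mix_def D_def[symmetric] by (intro mtrace_mult) (auto simp: mix_def)
    then show ?thesis by (simp only: trp_mix F_def)
  qed
  have "inj_on xs {..<N}"
  proof (rule inj_onI, rule ccontr)
    fix i j assume "i \<in> {..<N}" "j \<in> {..<N}" and eq: "xs i = xs j" and ne: "i \<noteq> j"
    then have ij: "i < N" "j < N" by auto
    define T where "T = (\<lambda>a b. E i $$ (a,b))"
    have T: "effect D T" unfolding T_def
      by (rule psd_effect) (use code ij in \<open>auto simp: is_id_code_def D_def\<close>)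
    have "1 - l1 \<le> Re (mtrace (tpow_mix d W n (p i) * E i))" using code ij by (simp add: is_id_code_def)
    then have "1 - l1 \<le> F (p i) T" unfolding T_def tr[OF ij(1) ij(1)] .
    moreover have "\<forall>i<N. \<forall>j<N. i \<noteq> j \<longrightarrow> Re (mtrace (tpow_mix d W n (p i) * E j)) \<le> l2"
      using code by (simp add: is_id_code_def)
    then have "Re (mtrace (tpow_mix d W n (p j) * E i)) \<le> l2" using ij ne by blast
    then have "F (p j) T \<le> l2" unfolding T_def tr[OF ij(2) ij(1)] .
    moreover have "\<bar>F (p i) T - A (xs i) T\<bar> \<le> \<kappa>" "\<bar>F (p j) T - A (xs j) T\<bar> \<le> \<kappa>"
      using xs[OF ij(1)] xs[OF ij(2)] T unfolding Q_def by blast+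
    ultimately show False using \<kappa> unfolding eq by linarith
  qed
  moreover have "xs ` {..<N} \<subseteq> {ys. set ys \<subseteq> seqs n \<and> length ys = M}" using xs by (auto simp: Q_def)
  moreover have "finite {ys. set ys \<subseteq> (seqs n :: 'x list set) \<and> length ys = M}"
    by (rule finite_lists_length_eq) simp
  ultimately have "card {..<N} \<le> card {ys. set ys \<subseteq> (seqs n :: 'x list set) \<and> length ys = M}"
    by (rule card_inj_on_le)
  then show ?thesis by (simp add: card_lists_length_eq card_seqs)
qed

lemma N_id_le:
  assumes "\<And>N p E. is_id_code d W n N l1 l2 p E \<Longrightarrow> N \<le> B"
  shows "\<exists>N0\<le>B. N_id d W l1 l2 n = enat N0"
proof -
  have "N_id d W l1 l2 n \<le> enat B"
    unfolding N_id_def using assms by (intro Sup_least) auto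
  then show ?thesis by (metis enat_ile enat_ord_simps(1))
qed

text \<open>For \<open>N \<le> 1\<close> the left side is 0, as \<open>log 2 0 = 0\<close>; this is
  where \<open>1 \<le> Y\<close> enters.\<close>

lemma loglog_le:
  fixes N :: nat and Y :: real
  assumes "real N \<le> 2 powr Y" "1 \<le> Y"
  shows "log 2 (log 2 (real N)) \<le> log 2 Y"
proof (cases "N \<le> 1")
  case True
  then have "N = 0 \<or> N = 1" by auto
  then have "log 2 (log 2 (real N)) = 0" by (auto simp: log_def)
  then show ?thesis using assms(2) by simp
next
  case False
  then have "0 < log 2 (real N)" by simp
  moreover have "log 2 (real N) \<le> Y" using assms(1) False by (simp add: log_le_iff)
  ultimately show ?thesis using assms(2) by simp
qed

lemma exp_decay:
  fixes r :: real
  assumes "r > 0"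
  shows "(\<lambda>n. exp (- (real n * r))) \<longlonglongrightarrow> 0"
  using assms by real_asymp

lemma log_rate:
  fixes q :: real
  assumes "q > 0"
  shows "(\<lambda>n. log 2 (real n * q) / real n) \<longlonglongrightarrow> 0"
  unfolding log_def using assms by real_asymp

theorem id_cap_le_holevo_cap:
  fixes W :: "'x::finite \<Rightarrow> complex mat"
  assumes Wd: "\<And>x. density d (W x)" and l: "l1 + l2 < 1"
  shows "id_cap d W l1 l2 \<le> holevo_cap d W"
proof (cases "holevo_cap d W = \<infinity>")
  case False
  define p0 :: "'x \<Rightarrow> real" where "p0 = (\<lambda>x. 1 / CARD('x))"
  have p0: "is_dist UNIV p0" by (simp add: p0_def is_dist_def)
  have "ereal (mutual_info d W p0) \<le> holevo_cap d W"
    unfolding holevo_cap_def by (rule SUP_upper) (simp add: p0)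
  with False obtain C where C: "holevo_cap d W = ereal C" by (cases "holevo_cap d W") auto
  have up: "mutual_info d W p \<le> C" if "is_dist UNIV p" for p
  proof -
    have "ereal (mutual_info d W p) \<le> holevo_cap d W"
      unfolding holevo_cap_def by (rule SUP_upper) (simp add: that)
    then show ?thesis by (simp add: C)
  qed
  have near: "\<exists>p. is_dist UNIV p \<and> C - \<delta> \<le> mutual_info d W p" if "\<delta> > 0" for \<delta>
  proof -
    have "ereal (C - \<delta>) < holevo_cap d W" using that by (simp add: C)
    then show ?thesis unfolding holevo_cap_def less_SUP_iff by (force intro: less_imp_le)
  qed
  obtain a e where W: "\<And>x. spec d (W x) (a x) (e x)"
    and a: "\<And>x i. i < d \<Longrightarrow> 0 \<le> a x i" "\<And>x. (\<Sum>i<d. a x i) = 1"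
    using density_spec_family[where W = W, OF Wd] by blast
  have "\<exists>b f. onb d f \<and> (\<forall>k<d. 0 \<le> b k) \<and> (\<Sum>k<d. b k) = 1 \<and>
     (\<forall>x. \<forall>i<d. \<forall>k<d. b k = 0 \<longrightarrow> a x i * (cmod (cin d (f k) (e x i)))\<^sup>2 = 0) \<and>
     (\<forall>x. ns d (a x) (e x) b f (\<lambda>u v. ln u - ln v) \<le> C * ln 2)"
    by (rule capacity_output_state[OF Wd W]) (rule up near; assumption)+
  then obtain b f where f: "onb d f" and b: "\<And>k. k < d \<Longrightarrow> 0 \<le> b k" "(\<Sum>k<d. b k) = 1"
    and supp: "\<And>x i k. i < d \<Longrightarrow> k < d \<Longrightarrow> b k = 0 \<Longrightarrow> a x i * (cmod (cin d (f k) (e x i)))\<^sup>2 = 0"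
    and ent: "\<And>x. ns d (a x) (e x) b f (\<lambda>u v. ln u - ln v) \<le> C * ln 2" by blast
  define c where "c = C * ln 2"
  have c0: "0 \<le> c"
  proof -
    have "0 \<le> ns d (a undefined) (e undefined) b f (\<lambda>u v. ln u - ln v)"
      by (rule ns_ln_nonneg[OF spec_onb[OF W] f]) (use a b supp in auto)
    then show ?thesis using ent[of undefined] unfolding c_def by linarith
  qed
  have "id_cap d W l1 l2 \<le> ereal C + ereal \<epsilon>" if "\<epsilon> > 0" for \<epsilon>
  proof -
    \<comment> \<open>The exponents \<open>c + \<delta>\<close> for the moment,
      \<open>c + 2 * \<delta>\<close> for \<open>L\<close> and \<open>c + 3 * \<delta>\<close> for
      the list length make both error terms decay; the quarter keeps the rate
      \<open>(c + 3 * \<delta>) / ln 2\<close> below \<open>C + \<epsilon>\<close>.\<close>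
    define \<delta> where "\<delta> = \<epsilon> * ln 2 / 4"
    have \<delta>: "\<delta> > 0" using that by (simp add: \<delta>_def)
    have "\<exists>s0>0. \<forall>s. 0 < s \<and> s < s0 \<longrightarrow> ns d (a x) (e x) b f (\<lambda>u v. (u / v) powr s) \<le> exp (s * (c + \<delta>))" for x
    proof (rule ns_exp_bound_up[OF spec_onb[OF W] f])
      show "ns d (a x) (e x) b f (\<lambda>u v. ln u - ln v) < c + \<delta>" using ent[of x] \<delta> by (simp add: c_def)
    qed (use a b supp in auto)
    then obtain s0 where s0: "\<And>x. s0 x > 0"
      "\<And>x s. 0 < s \<Longrightarrow> s < s0 x \<Longrightarrow> ns d (a x) (e x) b f (\<lambda>u v. (u / v) powr s) \<le> exp (s * (c + \<delta>))"
      by metis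
    \<comment> \<open>One exponent for all letters, available because the alphabet is
      finite.\<close>
    define s where "s = Min (range s0) / 2"
    have "Min (range s0) > 0" using s0(1) by simp
    then have s: "s > 0" by (simp add: s_def)
    have s_less: "s < s0 x" for x
    proof -
      have "Min (range s0) \<le> s0 x" by simp
      then show ?thesis using \<open>Min (range s0) > 0\<close> unfolding s_def by linarith
    qed
    define M where "M = (\<lambda>n::nat. nat \<lceil>exp (n * (c + 3 * \<delta>))\<rceil>)"
    have M_ge: "exp (n * (c + 3 * \<delta>)) \<le> M n" for n unfolding M_def by linarith
    have M_le: "M n \<le> 2 * exp (n * (c + 3 * \<delta>))" for n
    proof -
      have "1 \<le> exp (n * (c + 3 * \<delta>))" using c0 \<delta> by simp
      then show ?thesis unfolding M_def by linarith
    qed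
    have M0: "M n > 0" for n using M_ge[of n] by (metis exp_gt_zero not_le of_nat_0_le_iff of_nat_0_less_iff order_less_le_trans)
    define \<kappa> where "\<kappa> = (\<lambda>n::nat. 4 * sqrt (exp (- (n * (s * \<delta>)))) + sqrt (2 * exp (- (n * \<delta>))))"
    have "\<kappa> \<longlonglongrightarrow> 0"
    proof -
      have "\<kappa> \<longlonglongrightarrow> 4 * sqrt 0 + sqrt (2 * 0)"
        unfolding \<kappa>_def using s \<delta> by (intro tendsto_intros exp_decay) auto
      then show ?thesis by simp
    qed
    then have ev1: "\<forall>\<^sub>F n in sequentially. \<kappa> n < (1 - l1 - l2) / 2"
      using l by (intro order_tendstoD(2)) auto
    define Z where "Z = (\<lambda>n::nat. log 2 (real n * (2 * real CARD('x))) / n + (c + 3 * \<delta>) / ln 2)"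
    have "Z \<longlonglongrightarrow> 0 + (c + 3 * \<delta>) / ln 2"
      unfolding Z_def by (intro tendsto_intros log_rate) simp
    then have "Z \<longlonglongrightarrow> (c + 3 * \<delta>) / ln 2" by simp
    moreover have "(c + 3 * \<delta>) / ln 2 < C + \<epsilon>" using that by (simp add: c_def \<delta>_def field_simps)
    ultimately have ev2: "\<forall>\<^sub>F n in sequentially. Z n < C + \<epsilon>" by (rule order_tendstoD(2))
    have "\<forall>\<^sub>F n in sequentially. (case N_id d W l1 l2 n of enat N \<Rightarrow> ereal (log 2 (log 2 (real N)) / real n) | \<infinity> \<Rightarrow> \<infinity>) \<le> ereal (C + \<epsilon>)"
      using ev1 ev2 eventually_gt_at_top[of 0]
    proof eventually_elim
      case (elim n)
      have "N \<le> (CARD('x) ^ n) ^ M n" if code: "is_id_code d W n N l1 l2 p E" for N p E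
      proof (rule id_code_size_le[OF _ _ code])
        show "2 * \<kappa> n < 1 - l1 - l2" using elim(1) by simp
        fix p :: "'x list \<Rightarrow> real" assume p: "is_dist (seqs n) p"
        define L where "L = exp (n * (c + 2 * \<delta>))"
        have L: "L > 0" by (simp add: L_def)
        have 1: "L powr (- s) * exp (n * (s * (c + \<delta>))) = exp (- (n * (s * \<delta>)))"
          by (simp add: L_def powr_def exp_add[symmetric] algebra_simps)
        have 2: "2 * L / M n \<le> 2 * exp (- (n * \<delta>))"
        proof -
          have "2 * L / M n \<le> 2 * L / exp (n * (c + 3 * \<delta>))"
            using M_ge[of n] L M0[of n] by (intro divide_left_mono) auto
          also have "\<dots> = 2 * exp (n * (c + 2 * \<delta>) - n * (c + 3 * \<delta>))" unfolding L_def exp_diff by simp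
          also have "n * (c + 2 * \<delta>) - n * (c + 3 * \<delta>) = - (n * \<delta>)" by (simp add: algebra_simps)
          finally show ?thesis .
        qed
        have "4 * sqrt (L powr (- s) * exp (n * (s * (c + \<delta>)))) + sqrt (2 * L / M n) \<le> \<kappa> n"
          unfolding 1 \<kappa>_def using 2 by simp
        moreover have "\<exists>xs. length xs = M n \<and> set xs \<subseteq> seqs n \<and> (\<forall>T. effect (d ^ n) T \<longrightarrow>
           cmod ((\<Sum>x\<in>seqs n. of_real (p x) * trp (d ^ n) (\<lambda>i j. tpow W x $$ (i,j)) T)
              - (\<Sum>x\<leftarrow>xs. trp (d ^ n) (\<lambda>i j. tpow W x $$ (i,j)) T) / of_nat (M n))
            \<le> 4 * sqrt (L powr (- s) * exp (n * (s * (c + \<delta>)))) + sqrt (2 * L / M n))"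
          by (rule block_covering[OF Wd W f b(1) b(2) supp s s0(2)[OF s s_less] L M0 p]) assumption+
        ultimately show "\<exists>xs. length xs = M n \<and> set xs \<subseteq> seqs n \<and> (\<forall>T. effect (d ^ n) T \<longrightarrow>
           cmod ((\<Sum>x\<in>seqs n. of_real (p x) * trp (d ^ n) (\<lambda>i j. tpow W x $$ (i,j)) T)
              - (\<Sum>x\<leftarrow>xs. trp (d ^ n) (\<lambda>i j. tpow W x $$ (i,j)) T) / of_nat (M n)) \<le> \<kappa> n)"
          by (meson order_trans)
      qed
      then have "\<exists>N0\<le>(CARD('x) ^ n) ^ M n. N_id d W l1 l2 n = enat N0" by (rule N_id_le)
      then obtain N0 where N0: "N0 \<le> (CARD('x) ^ n) ^ M n" "N_id d W l1 l2 n = enat N0" by blast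
      \<comment> \<open>The alphabet size is bounded by 2 to its own power, so Y dominates the
        binary logarithm of the number of lists. The inflation is by a constant factor, invisible
        after the second logarithm.\<close>
      define Y where "Y = real n * real (M n) * real CARD('x)"
      have Y1: "1 \<le> Y"
      proof -
        have "1 \<le> n * M n * CARD('x)" using elim(3) M0[of n] by simp
        then show ?thesis unfolding Y_def by (metis of_nat_1 of_nat_le_iff of_nat_mult)
      qed
      have "real N0 \<le> real CARD('x) ^ (n * M n)" using N0(1) by (metis of_nat_le_iff of_nat_power power_mult)
      also have "\<dots> \<le> (2 ^ CARD('x)) ^ (n * M n)"
        by (rule power_mono) (use of_nat_less_two_power[of "CARD('x)", where 'a = real] in auto)
      also have "\<dots> = 2 powr Y" by (simp add: Y_def powr_realpow[symmetric] powr_powr mult_ac)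
      finally have "log 2 (log 2 (real N0)) \<le> log 2 Y" using Y1 by (rule loglog_le)
      also have "\<dots> \<le> log 2 (real n * (2 * real CARD('x)) * exp (n * (c + 3 * \<delta>)))"
        using M_le[of n] elim(3) Y1 unfolding Y_def
        by (subst log_le_cancel_iff) (auto simp: mult_ac intro!: mult_left_mono)
      also have "\<dots> = log 2 (real n * (2 * real CARD('x))) + n * (c + 3 * \<delta>) / ln 2"
        using elim(3) by (subst log_mult) (auto simp: log_def)
      finally have "log 2 (log 2 (real N0)) / n \<le> (log 2 (real n * (2 * real CARD('x))) + n * (c + 3 * \<delta>) / ln 2) / n"
        by (rule divide_right_mono) simp
      also have "\<dots> = Z n" using elim(3) unfolding Z_def by (simp add: add_divide_distrib)
      finally have "log 2 (log 2 (real N0)) / n \<le> Z n" .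
      then show ?case using elim(2) by (simp add: N0(2))
    qed
    then have "id_cap d W l1 l2 \<le> ereal (C + \<epsilon>)"
      unfolding id_cap_def by (intro order_trans[OF Liminf_le_Limsup Limsup_bounded]) auto
    then show ?thesis by simp
  qed
  then show ?thesis unfolding C using ereal_le_epsilon2[of "id_cap d W l1 l2" "ereal C"] by blast
qed simp

section \<open>Resolvability\<close>

lemma exp_chord:
  fixes t y :: real
  assumes "0 \<le> y" "y \<le> 1"
  shows "exp (t * y) \<le> 1 + (exp t - 1) * y"
  using convex_onD[OF exp_convex, of y 0 t] assms by (simp add: algebra_simps)

text \<open>Chernoff bound for a uniformly random \<open>f\<close>; it is applied with \<open>h\<close> the clipped output statistics of one type.\<close>

lemma few_functions_collect:
  fixes h :: "nat \<Rightarrow> nat \<Rightarrow> real" and c :: real and K G :: nat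
  assumes h: "\<And>k g. k < K \<Longrightarrow> g < G \<Longrightarrow> 0 \<le> h k g" "\<And>k g. k < K \<Longrightarrow> g < G \<Longrightarrow> h k g \<le> 1"
    and sum_h: "(\<Sum>k<K. \<Sum>g<G. h k g) \<le> K" and c: "c > 0" and G: "exp (2 / c) \<le> G"
  shows "real (card {f \<in> PiE {..<K} (\<lambda>_. {..<G}). c * K \<le> (\<Sum>k<K. h k (f k))}) \<le> real G ^ K * exp (- real K)"
proof -
  let ?F = "PiE {..<K} (\<lambda>_. {..<G})" and ?A = "{f \<in> PiE {..<K} (\<lambda>_. {..<G}). c * K \<le> (\<Sum>k<K. h k (f k))}"
  \<comment> \<open>The tilt turns the threshold \<open>c * K\<close> into \<open>2 * K\<close>;
    since the moment costs only \<open>exp K\<close> beyond \<open>G ^ K\<close>, a factor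
    \<open>exp (- K)\<close> remains.\<close>
  define t where "t = 2 / c"
  have t0: "t > 0" using c by (simp add: t_def)
  have finF: "finite ?F" by (intro finite_PiE) auto
  have G0: "real G > 0" using G by (meson exp_gt_zero less_le_trans)
  have "real (card ?A) * exp (2 * K) = (\<Sum>f\<in>?A. exp (2 * K))" by simp
  also have "\<dots> \<le> (\<Sum>f\<in>?A. exp (t * (\<Sum>k<K. h k (f k))))"
  proof (rule sum_mono)
    fix f assume "f \<in> ?A"
    then have "t * (c * K) \<le> t * (\<Sum>k<K. h k (f k))" using t0 by (intro mult_left_mono) auto
    then show "exp (2 * K) \<le> exp (t * (\<Sum>k<K. h k (f k)))" using c by (simp add: t_def)
  qed
  also have "\<dots> \<le> (\<Sum>f\<in>?F. exp (t * (\<Sum>k<K. h k (f k))))"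
    using finF by (intro sum_mono2) auto
  also have "\<dots> = (\<Sum>f\<in>?F. \<Prod>k<K. exp (t * h k (f k)))"
    by (simp add: sum_distrib_left exp_sum)
  also have "\<dots> = (\<Prod>k<K. \<Sum>g<G. exp (t * h k g))" by (rule prod_sum_PiE[symmetric]) auto
  also have "\<dots> \<le> (\<Prod>k<K. G * exp (exp t * (\<Sum>g<G. h k g) / G))"
  proof (rule prod_mono)
    fix k assume "k \<in> {..<K}"
    then have k: "k < K" by simp
    have hk: "0 \<le> (\<Sum>g<G. h k g)" using h k by (intro sum_nonneg) auto
    have "(\<Sum>g<G. exp (t * h k g)) \<le> (\<Sum>g<G. 1 + (exp t - 1) * h k g)"
      using h k by (intro sum_mono exp_chord) auto
    also have "\<dots> = G + (exp t - 1) * (\<Sum>g<G. h k g)" by (simp add: sum.distrib sum_distrib_left)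
    also have "\<dots> \<le> G + exp t * (\<Sum>g<G. h k g)" using hk by (intro add_left_mono mult_right_mono) auto
    also have "\<dots> = G * (1 + exp t * (\<Sum>g<G. h k g) / G)" using G0 by (simp add: field_simps)
    also have "\<dots> \<le> G * exp (exp t * (\<Sum>g<G. h k g) / G)"
      using G0 by (intro mult_left_mono exp_ge_add_one_self) auto
    finally show "0 \<le> (\<Sum>g<G. exp (t * h k g)) \<and> (\<Sum>g<G. exp (t * h k g)) \<le> G * exp (exp t * (\<Sum>g<G. h k g) / G)"
      by (simp add: sum_nonneg)
  qed
  also have "\<dots> = real G ^ K * exp (exp t / G * (\<Sum>k<K. \<Sum>g<G. h k g))"
    by (simp add: prod.distrib exp_sum sum_distrib_left sum_divide_distrib)
  also have "\<dots> \<le> real G ^ K * exp (1 * K)"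
  proof -
    \<comment> \<open>This is why G has to be at least \<open>exp (2 / c)\<close>: the growth of the
      moment generating function is averaged over G symbols.\<close>
    have "exp t / G * (\<Sum>k<K. \<Sum>g<G. h k g) \<le> 1 * real K"
      using G G0 sum_h h by (intro mult_mono sum_nonneg) (auto simp: t_def)
    then show ?thesis by (intro mult_left_mono) auto
  qed
  finally have "real (card ?A) * exp (2 * K) \<le> real G ^ K * exp K" unfolding mult_1 .
  then have "real (card ?A) * exp (2 * K) * exp (- 2 * K) \<le> real G ^ K * exp K * exp (- 2 * K)"
    by (rule mult_right_mono) simp
  then show ?thesis by (simp only: mult.assoc exp_add[symmetric]) simp
qed

text \<open>A union bound: all \<open>G ^ K\<close> functions must be served, and each y serves at
  most a fraction \<open>exp (- K)\<close> of them.\<close>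

lemma count_approximants:
  fixes h :: "'y \<Rightarrow> nat \<Rightarrow> nat \<Rightarrow> real" and c :: real and K G :: nat
  assumes Y: "finite Y"
    and h: "\<And>y k g. y \<in> Y \<Longrightarrow> k < K \<Longrightarrow> g < G \<Longrightarrow> 0 \<le> h y k g" "\<And>y k g. y \<in> Y \<Longrightarrow> k < K \<Longrightarrow> g < G \<Longrightarrow> h y k g \<le> 1"
    and sum_h: "\<And>y. y \<in> Y \<Longrightarrow> (\<Sum>k<K. \<Sum>g<G. h y k g) \<le> K" and c: "c > 0" and G: "exp (2 / c) \<le> G"
    and ex: "\<And>f. f \<in> PiE {..<K} (\<lambda>_. {..<G}) \<Longrightarrow> \<exists>y\<in>Y. c * K \<le> (\<Sum>k<K. h y k (f k))"
  shows "exp (real K) \<le> card Y"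
proof -
  let ?F = "PiE {..<K} (\<lambda>_. {..<G})" and ?A = "\<lambda>y. {f \<in> PiE {..<K} (\<lambda>_. {..<G}). c * K \<le> (\<Sum>k<K. h y k (f k))}"
  have G0: "real G > 0" using G by (meson exp_gt_zero less_le_trans)
  have finF: "finite ?F" by (intro finite_PiE) auto
  have "?F \<subseteq> (\<Union>y\<in>Y. ?A y)" using ex by blast
  then have "card ?F \<le> card (\<Union>y\<in>Y. ?A y)" using Y finF by (intro card_mono) auto
  also have "\<dots> \<le> (\<Sum>y\<in>Y. card (?A y))" by (rule card_UN_le[OF Y])
  finally have "real (card ?F) \<le> real (\<Sum>y\<in>Y. card (?A y))" by (rule of_nat_mono)
  also have "\<dots> = (\<Sum>y\<in>Y. real (card (?A y)))" by (rule of_nat_sum)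
  also have "\<dots> \<le> (\<Sum>y\<in>Y. real G ^ K * exp (- real K))"
    using h sum_h c G by (intro sum_mono few_functions_collect) auto
  also have "\<dots> = real (card Y) * (real G ^ K * exp (- real K))" by simp
  finally have "real G ^ K \<le> real (card Y) * (real G ^ K * exp (- real K))" by (simp add: card_PiE)
  then have "real G ^ K * 1 \<le> real G ^ K * (real (card Y) * exp (- real K))" by (simp add: mult_ac)
  then have "1 \<le> real (card Y) * exp (- real K)" using G0 by (simp only: mult_le_cancel_left_pos zero_less_power)
  then have "1 * exp (real K) \<le> real (card Y) * exp (- real K) * exp (real K)" by (rule mult_right_mono) simp
  then show ?thesis by (simp only: mult.assoc exp_add[symmetric]) simp
qed

subsection \<open>Types as lists\<close>

text \<open>A distribution with denominator M is the empirical distribution of a list of length M.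
  Types are counted through such lists.\<close>

lemma Mdist_list:
  assumes q: "is_Mdist M S q" and S: "finite S" and M: "M > 0"
  shows "\<exists>ys. length ys = M \<and> set ys \<subseteq> S \<and>
    (\<forall>F :: _ \<Rightarrow> complex. (\<Sum>x\<in>S. of_real (q x) * F x) = (\<Sum>y\<leftarrow>ys. F y) / of_nat M)"
proof -
  have q0: "0 \<le> q x" if "x \<in> S" for x using q that by (simp add: is_Mdist_def is_dist_def)
  have "\<exists>c::nat. real M * q x = real c" if x: "x \<in> S" for x
  proof -
    have "real M * q x \<in> \<int>" using q x by (simp add: is_Mdist_def)
    then obtain z :: int where z: "real M * q x = of_int z" by (auto elim: Ints_cases)
    then have "0 \<le> z" using q0[OF x] by (metis mult_nonneg_nonneg of_int_0_le_iff of_nat_0_le_iff)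
    then show ?thesis using z by (intro exI[of _ "nat z"]) simp
  qed
  then have "\<forall>x\<in>S. \<exists>c::nat. real M * q x = real c" by blast
  from bchoice[OF this] obtain c :: "'a \<Rightarrow> nat" where c: "\<And>x. x \<in> S \<Longrightarrow> real M * q x = real (c x)" by blast
  have sub: "\<exists>ys. length ys = sum c T \<and> set ys \<subseteq> T \<and> (\<forall>F :: _ \<Rightarrow> complex. (\<Sum>y\<leftarrow>ys. F y) = (\<Sum>x\<in>T. of_nat (c x) * F x))"
    if "finite T" for T
    using that
  proof (induction T rule: finite_induct)
    case (insert x T)
    then obtain ys where ys: "length ys = sum c T" "set ys \<subseteq> T"
      "\<And>F :: _ \<Rightarrow> complex. (\<Sum>y\<leftarrow>ys. F y) = (\<Sum>x\<in>T. of_nat (c x) * F x)" by blast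
    show ?case using insert.hyps ys
      by (intro exI[of _ "replicate (c x) x @ ys"]) (auto simp: sum_list_replicate)
  qed simp
  have "real (sum c S) = real M * sum q S" by (simp add: sum_distrib_left c)
  also have "\<dots> = real M" using q by (simp add: is_Mdist_def is_dist_def)
  finally have "sum c S = M" by (simp only: of_nat_eq_iff)
  then obtain ys where ys: "length ys = M" "set ys \<subseteq> S"
    "\<And>F :: _ \<Rightarrow> complex. (\<Sum>y\<leftarrow>ys. F y) = (\<Sum>x\<in>S. of_nat (c x) * F x)"
    using sub[OF S] by blast
  have "(\<Sum>x\<in>S. of_real (q x) * F x) = (\<Sum>y\<leftarrow>ys. F y) / of_nat M" for F :: "_ \<Rightarrow> complex"
  proof -
    have "of_real (q x) = (of_nat (c x) / of_nat M :: complex)" if "x \<in> S" for x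
    proof -
      have "q x = real (c x) / real M" using c[OF that] M by (simp add: field_simps)
      then show ?thesis by simp
    qed
    then show ?thesis unfolding ys(3) sum_divide_distrib by simp
  qed
  then show ?thesis using ys(1,2) by blast
qed

text \<open>Round every probability down to a multiple of 1 / M and give the missing mass to one
  point \<open>z\<close>. Its mass remains a multiple of 1 / M because the total is 1.\<close>

lemma Mdist_approx:
  assumes p: "is_dist S p" and S: "finite S" and M: "M > 0"
  shows "\<exists>q. is_Mdist M S q \<and> (\<Sum>x\<in>S. \<bar>p x - q x\<bar>) \<le> 2 * card S / M"
proof -
  have p0: "0 \<le> p x" if "x \<in> S" for x using p that by (simp add: is_dist_def)
  have p1: "sum p S = 1" using p by (simp add: is_dist_def)
  then have "S \<noteq> {}" by auto
  then obtain z where z: "z \<in> S" by auto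
  define c where "c = (\<lambda>x. real_of_int \<lfloor>M * p x\<rfloor> / M)"
  have c1: "0 \<le> p x - c x" "p x - c x \<le> 1 / M" for x
  proof -
    have e: "p x - c x = (M * p x - real_of_int \<lfloor>M * p x\<rfloor>) / M" using M by (simp add: c_def diff_divide_distrib)
    have "0 \<le> M * p x - real_of_int \<lfloor>M * p x\<rfloor>" "M * p x - real_of_int \<lfloor>M * p x\<rfloor> \<le> 1" by linarith+
    then show "0 \<le> p x - c x" "p x - c x \<le> 1 / M" unfolding e by (auto intro: divide_right_mono)
  qed
  have c0: "0 \<le> c x" if "x \<in> S" for x using p0[OF that] by (simp add: c_def)
  define q where "q = (\<lambda>x. if x = z then 1 - sum c (S - {z}) else c x)"
  have dz: "q z - p z = (\<Sum>x\<in>S - {z}. p x - c x)"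
    using p1 S z by (simp add: q_def sum_subtractf sum.remove[of S z])
  have dz0: "0 \<le> q z - p z" unfolding dz using c1 by (intro sum_nonneg) auto
  have "is_Mdist M S q"
    unfolding is_Mdist_def is_dist_def
  proof (intro conjI ballI)
    show "0 \<le> q x" if "x \<in> S" for x
      using dz0 p0[OF z] c0[OF that] by (cases "x = z") (auto simp: q_def)
    have "sum q S = q z + sum q (S - {z})" using S z by (rule sum.remove)
    also have "sum q (S - {z}) = sum c (S - {z})" by (rule sum.cong) (auto simp: q_def)
    finally show "sum q S = 1" by (simp add: q_def)
    have cI: "real M * c x \<in> \<int>" for x using M by (simp add: c_def)
    show "real M * q x \<in> \<int>" for x
    proof (cases "x = z")
      case True
      have "real M * q x = real M - (\<Sum>x\<in>S - {z}. real M * c x)" using True by (simp add: q_def right_diff_distrib sum_distrib_left)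
      also have "\<dots> \<in> \<int>" using cI by (intro Ints_diff Ints_sum) auto
      finally show ?thesis .
    next
      case False
      then show ?thesis using cI by (simp add: q_def)
    qed
  qed
  moreover have "(\<Sum>x\<in>S. \<bar>p x - q x\<bar>) \<le> 2 * card S / M"
  proof -
    have "(\<Sum>x\<in>S. \<bar>p x - q x\<bar>) = \<bar>p z - q z\<bar> + (\<Sum>x\<in>S - {z}. \<bar>p x - q x\<bar>)" using S z by (rule sum.remove)
    also have "(\<Sum>x\<in>S - {z}. \<bar>p x - q x\<bar>) = (\<Sum>x\<in>S - {z}. p x - c x)"
      using c1 by (intro sum.cong) (auto simp: q_def)
    also have "\<bar>p z - q z\<bar> = (\<Sum>x\<in>S - {z}. p x - c x)" using dz dz0 by simp
    also have "(\<Sum>x\<in>S - {z}. p x - c x) + (\<Sum>x\<in>S - {z}. p x - c x) \<le> (\<Sum>x\<in>S. 1 / M) + (\<Sum>x\<in>S. 1 / M)"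
    proof -
      have "(\<Sum>x\<in>S - {z}. p x - c x) \<le> (\<Sum>x\<in>S - {z}. 1 / M)" using c1 by (intro sum_mono) auto
      also have "\<dots> \<le> (\<Sum>x\<in>S. 1 / M)" using S by (intro sum_mono2) auto
      finally show ?thesis by simp
    qed
    finally show ?thesis by simp
  qed
  ultimately show ?thesis by blast
qed

subsection \<open>Trace distance of output mixtures\<close>

lemma tpow_density_spec:
  fixes W :: "'x::finite \<Rightarrow> complex mat"
  assumes Wd: "\<And>x. density d (W x)" and x: "x \<in> seqs n"
  shows "\<exists>l e. spec (d ^ n) (tpow W x) l e \<and> (\<forall>i<d ^ n. 0 \<le> l i) \<and> (\<Sum>i<d ^ n. l i) = 1"
proof -
  obtain a e where W: "\<And>x. spec d (W x) (a x) (e x)"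
    and a: "\<And>x i. i < d \<Longrightarrow> 0 \<le> a x i" "\<And>x. (\<Sum>i<d. a x i) = 1"
    using density_spec_family[where W = W, OF Wd] by blast
  have l: "length x = n" using x by (simp add: seqs_def)
  have "spec (d ^ n) (tpow W x) (tv d a x) (te d e x)" using tpow_spec[of d W a e x, OF W] by (simp add: l)
  moreover have "0 \<le> tv d a x i" if "i < d ^ n" for i by (rule tv_nonneg) (use a that l in auto)
  moreover have "(\<Sum>i<d ^ n. tv d a x i) = 1" using tv_sum[of a d x, OF a(2)] by (simp add: l)
  ultimately show ?thesis by blast
qed

lemma spec_entry_le:
  assumes "spec D A l e" "\<And>i. i < D \<Longrightarrow> 0 \<le> l i" "(\<Sum>i<D. l i) = 1" "k < D" "k' < D"
  shows "cmod (A $$ (k,k')) \<le> 1"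
proof -
  have e1: "cmod (e i j) \<le> 1" if "i < D" "j < D" for i j
    by (rule onb_entry_le[OF spec_onb[OF assms(1)] that])
  have "cmod (A $$ (k,k')) \<le> (\<Sum>i<D. cmod (of_real (l i) * e i k * cnj (e i k')))"
    unfolding specD[OF assms(1,4,5)] osum_def by (rule norm_sum)
  also have "\<dots> \<le> (\<Sum>i<D. l i * (1 * 1))"
  proof (rule sum_mono)
    fix i assume "i \<in> {..<D}"
    then show "cmod (of_real (l i) * e i k * cnj (e i k')) \<le> l i * (1 * 1)"
      unfolding norm_mult complex_mod_cnj mult.assoc norm_of_real
      using assms(2,4,5) e1 by (intro mult_mono) auto
  qed
  finally show ?thesis using assms(3) by simp
qed

lemma tpow_mix_carrier: "tpow_mix d W n p \<in> carrier_mat (d ^ n) (d ^ n)"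
  by (simp add: tpow_mix_def mix_def)

text \<open>The dimension factor is harmless: the bound is applied at fixed \<open>n\<close>, to
  bound the supremum and to see that large M reach any accuracy.\<close>

lemma tpow_mix_trace_norm_le:
  fixes W :: "'x::finite \<Rightarrow> complex mat"
  assumes Wd: "\<And>x. density d (W x)"
  shows "trace_norm (tpow_mix d W n p - tpow_mix d W n q) \<le> real (d ^ n) * real (d ^ n) * (\<Sum>x\<in>seqs n. \<bar>p x - q x\<bar>)"
proof (rule trace_norm_le_entries)
  show "tpow_mix d W n p - tpow_mix d W n q \<in> carrier_mat (d ^ n) (d ^ n)"
    by (rule minus_carrier_mat[OF tpow_mix_carrier])
  fix k k' assume kk: "k < d ^ n" "k' < d ^ n"
  have "(tpow_mix d W n p - tpow_mix d W n q) $$ (k,k') = (\<Sum>x\<in>seqs n. of_real (p x - q x) * tpow W x $$ (k,k'))"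
    using kk by (simp add: tpow_mix_def mix_def left_diff_distrib sum_subtractf)
  also have "cmod \<dots> \<le> (\<Sum>x\<in>seqs n. \<bar>p x - q x\<bar> * 1)"
  proof (rule order_trans[OF norm_sum], rule sum_mono)
    fix x :: "'x list" assume "x \<in> seqs n"
    from tpow_density_spec[where W = W, OF Wd this] obtain l e where "spec (d ^ n) (tpow W x) l e" "\<forall>i<d ^ n. 0 \<le> l i" "(\<Sum>i<d ^ n. l i) = 1"
      by blast
    then have "cmod (tpow W x $$ (k,k')) \<le> 1" using kk by (intro spec_entry_le) auto
    then show "cmod (of_real (p x - q x) * tpow W x $$ (k,k')) \<le> \<bar>p x - q x\<bar> * 1"
      unfolding norm_mult norm_of_real by (intro mult_left_mono) auto
  qed
  finally show "cmod ((tpow_mix d W n p - tpow_mix d W n q) $$ (k,k')) \<le> (\<Sum>x\<in>seqs n. \<bar>p x - q x\<bar>)" by simp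
qed (simp add: sum_nonneg)

lemma tpow_mix_test_le:
  fixes W :: "'x::finite \<Rightarrow> complex mat"
  assumes Wd: "\<And>x. density d (W x)" and p: "is_dist (seqs n) p" and q: "is_dist (seqs n) q" and E: "effect (d ^ n) E"
  shows "Re (\<Sum>x\<in>seqs n. of_real (p x) * trp (d ^ n) (\<lambda>i j. tpow W x $$ (i,j)) E)
     - Re (\<Sum>x\<in>seqs n. of_real (q x) * trp (d ^ n) (\<lambda>i j. tpow W x $$ (i,j)) E)
     \<le> trace_norm (tpow_mix d W n p - tpow_mix d W n q) / 2"
proof -
  define D where "D = d ^ n"
  define A where "A = tpow_mix d W n p - tpow_mix d W n q"
  have A: "A \<in> carrier_mat D D" unfolding A_def D_def by (rule minus_carrier_mat[OF tpow_mix_carrier])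
  have Ai: "A $$ (i,j) = (\<Sum>x\<in>seqs n. of_real (p x - q x) * tpow W x $$ (i,j))" if "i < D" "j < D" for i j
    using that by (simp add: A_def D_def tpow_mix_def mix_def left_diff_distrib sum_subtractf)
  have sp: "\<exists>l e. spec D (tpow W x) l e \<and> (\<Sum>i<D. l i) = 1" if "x \<in> seqs n" for x
    using tpow_density_spec[where W = W, OF Wd that] unfolding D_def by blast
  have H: "herm D (\<lambda>i j. A $$ (i,j))" unfolding herm_def
  proof (intro allI impI)
    fix i j assume ij: "i < D" "j < D"
    have "cnj (tpow W x $$ (i,j)) = tpow W x $$ (j,i)" if x: "x \<in> seqs n" for x
    proof -
      obtain l e where "spec D (tpow W x) l e" using sp[OF x] by blast
      then show ?thesis using ij by (simp add: specD hermD[OF osum_herm])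
    qed
    then show "A $$ (j,i) = cnj (A $$ (i,j))" using ij by (simp add: Ai)
  qed
  have tr: "mtrace A = 0"
  proof -
    have "mtrace A = (\<Sum>i<D. \<Sum>x\<in>seqs n. of_real (p x - q x) * tpow W x $$ (i,i))"
      using A by (simp add: mtrace_def Ai)
    also have "\<dots> = (\<Sum>x\<in>seqs n. \<Sum>i<D. of_real (p x - q x) * tpow W x $$ (i,i))" by (rule sum.swap)
    also have "\<dots> = (\<Sum>x\<in>seqs n. of_real (p x - q x))"
    proof (rule sum.cong[OF refl])
      fix x :: "'x list" assume x: "x \<in> seqs n"
      obtain l e where s: "spec D (tpow W x) l e" "(\<Sum>i<D. l i) = 1" using sp[OF x] by blast
      have "dim_row (tpow W x) = D" using s(1) by (auto simp: spec_def)
      then have "(\<Sum>i<D. tpow W x $$ (i,i)) = 1" using mtrace_spec[OF s(1)] s(2) by (simp only: mtrace_def of_real_1)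
      then show "(\<Sum>i<D. of_real (p x - q x) * tpow W x $$ (i,i)) = of_real (p x - q x)"
        by (simp only: sum_distrib_left[symmetric] mult_1_right)
    qed
    also have "\<dots> = of_real (sum p (seqs n) - sum q (seqs n))" by (simp add: sum_subtractf)
    finally show ?thesis using p q by (simp add: is_dist_def del: of_real_sum)
  qed
  have "trp D (\<lambda>i j. A $$ (i,j)) E = trp D (\<lambda>i j. tpow_mix d W n p $$ (i,j)) E - trp D (\<lambda>i j. tpow_mix d W n q $$ (i,j)) E"
    unfolding trp_def sum_subtractf[symmetric]
    by (intro sum.cong refl) (simp add: A_def D_def tpow_mix_def mix_def left_diff_distrib)
  also have "\<dots> = (\<Sum>x\<in>seqs n. of_real (p x) * trp D (\<lambda>i j. tpow W x $$ (i,j)) E)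
     - (\<Sum>x\<in>seqs n. of_real (q x) * trp D (\<lambda>i j. tpow W x $$ (i,j)) E)"
    unfolding tpow_mix_def D_def[symmetric] trp_mix ..
  finally have e: "trp D (\<lambda>i j. A $$ (i,j)) E = (\<Sum>x\<in>seqs n. of_real (p x) * trp D (\<lambda>i j. tpow W x $$ (i,j)) E)
     - (\<Sum>x\<in>seqs n. of_real (q x) * trp D (\<lambda>i j. tpow W x $$ (i,j)) E)" .
  have "2 * Re (trp D (\<lambda>i j. A $$ (i,j)) E) \<le> trace_norm A"
    by (rule trace_norm_ge[OF A H tr]) (use E in \<open>simp add: D_def\<close>)
  then have "2 * (Re (\<Sum>x\<in>seqs n. of_real (p x) * trp D (\<lambda>i j. tpow W x $$ (i,j)) E)
     - Re (\<Sum>x\<in>seqs n. of_real (q x) * trp D (\<lambda>i j. tpow W x $$ (i,j)) E)) \<le> trace_norm A"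
    unfolding e minus_complex.sel .
  then show ?thesis unfolding A_def[symmetric] D_def[symmetric]
    by (subst le_divide_eq_numeral1(1)) (simp only: mult.commute)
qed

lemma Mdist_nonempty:
  assumes "M > 0"
  shows "\<exists>q. is_Mdist M (seqs n :: 'x::finite list set) q"
proof -
  define p0 :: "'x list \<Rightarrow> real" where "p0 = (\<lambda>x. 1 / card (seqs n :: 'x list set))"
  have "is_dist (seqs n) p0" by (simp add: p0_def is_dist_def card_seqs)
  from Mdist_approx[OF this finite_seqs assms] show ?thesis by blast
qed

lemma dist_abs_diff_le:
  assumes "is_dist S p" "is_dist S q"
  shows "(\<Sum>x\<in>S. \<bar>p x - q x\<bar>) \<le> 2"
proof -
  have "(\<Sum>x\<in>S. \<bar>p x - q x\<bar>) \<le> (\<Sum>x\<in>S. p x + q x)"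
    using assms by (intro sum_mono) (auto simp: is_dist_def abs_le_iff add_increasing add_increasing2)
  then show ?thesis using assms by (simp add: sum.distrib is_dist_def)
qed

text \<open>Suprema and infima of reals carry information only under these bounds; they make the
  usual comparison rules available for \<open>approx_err\<close>.\<close>

lemma approx_err_INF:
  fixes W :: "'x::finite \<Rightarrow> complex mat" and n :: nat
  assumes Wd: "\<And>x. density d (W x)" and M: "M > 0"
  defines "g \<equiv> \<lambda>p q. trace_norm (tpow_mix d W n p - tpow_mix d W n q) / 2"
  shows "bdd_below (g p ` {q. is_Mdist M (seqs n) q})"
    and "bdd_above ((\<lambda>p. INF q\<in>{q. is_Mdist M (seqs n) q}. g p q) ` {p. is_dist (seqs n) p})"
proof -
  have g0: "0 \<le> g p q" for p q
    unfolding g_def using trace_norm_nonneg[OF minus_carrier_mat[OF tpow_mix_carrier]] by simp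
  have bb: "bdd_below (g p ` {q. is_Mdist M (seqs n) q})" for p
    by (rule bdd_belowI2[where m = 0]) (rule g0)
  show "bdd_below (g p ` {q. is_Mdist M (seqs n) q})" by (rule bb)
  obtain q0 where q0: "is_Mdist M (seqs n :: 'x list set) q0" using Mdist_nonempty[OF M] by blast
  show "bdd_above ((\<lambda>p. INF q\<in>{q. is_Mdist M (seqs n) q}. g p q) ` {p. is_dist (seqs n) p})"
  proof (rule bdd_aboveI2)
    fix p assume p: "p \<in> {p. is_dist (seqs n :: 'x list set) p}"
    have "(INF q\<in>{q. is_Mdist M (seqs n) q}. g p q) \<le> g p q0" using bb q0 by (intro cINF_lower) auto
    also have "\<dots> \<le> real (d ^ n) * real (d ^ n) * (\<Sum>x\<in>seqs n. \<bar>p x - q0 x\<bar>) / 2"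
      unfolding g_def using tpow_mix_trace_norm_le[OF Wd] by (intro divide_right_mono) auto
    also have "\<dots> \<le> real (d ^ n) * real (d ^ n) * 2 / 2"
      using dist_abs_diff_le[of "seqs n" p q0] p q0 by (intro divide_right_mono mult_left_mono) (auto simp: is_Mdist_def)
    finally show "(INF q\<in>{q. is_Mdist M (seqs n) q}. g p q) \<le> real (d ^ n) * real (d ^ n) * 2 / 2" .
  qed
qed

text \<open>The infimum over types is compared strictly, so the accuracy is relaxed to a slightly
  larger \<epsilon>'.\<close>

lemma approx_err_le_imp:
  fixes W :: "'x::finite \<Rightarrow> complex mat"
  assumes Wd: "\<And>x. density d (W x)" and M: "M > 0" and err: "approx_err d W n M \<le> \<epsilon>" and lt: "\<epsilon> < \<epsilon>'"
    and p: "is_dist (seqs n) p"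
  shows "\<exists>q. is_Mdist M (seqs n) q \<and> trace_norm (tpow_mix d W n p - tpow_mix d W n q) / 2 < \<epsilon>'"
proof -
  let ?g = "\<lambda>p q. trace_norm (tpow_mix d W n p - tpow_mix d W n q) / 2"
  have "(INF q\<in>{q. is_Mdist M (seqs n) q}. ?g p q) \<le> approx_err d W n M"
    unfolding approx_err_def
    by (rule cSUP_upper[where f = "\<lambda>p. INF q\<in>{q. is_Mdist M (seqs n) q}. ?g p q", OF _ approx_err_INF(2)[OF Wd M]])
      (use p in simp)
  then have "(INF q\<in>{q. is_Mdist M (seqs n) q}. ?g p q) < \<epsilon>'" using err lt by linarith
  moreover have "{q. is_Mdist M (seqs n :: 'x list set) q} \<noteq> {}" using Mdist_nonempty[OF M] by auto
  ultimately show ?thesis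
    using cINF_less_iff[OF _ approx_err_INF(1)[where W = W and p = p, OF Wd M]] by blast
qed

text \<open>\<open>LEAST\<close> attains its property only if some M satisfies it; rounding with M
  of order \<open>B / \<epsilon>\<close> provides one.\<close>

lemma M_eps_properties:
  fixes W :: "'x::finite \<Rightarrow> complex mat"
  assumes Wd: "\<And>x. density d (W x)" and \<epsilon>: "\<epsilon> > 0"
  shows "0 < M_eps d W \<epsilon> n" "approx_err d W n (M_eps d W \<epsilon> n) \<le> \<epsilon>"
proof -
  define B where "B = real (d ^ n) * real (d ^ n) * card (seqs n :: 'x list set)"
  obtain M :: nat where M: "B / \<epsilon> < M" using reals_Archimedean2 by blast
  have B0: "0 \<le> B" by (simp add: B_def)
  then have M0: "M > 0" using M \<epsilon> by (metis divide_nonneg_pos gr0I not_less of_nat_0)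
  have BM: "B / M \<le> \<epsilon>" using M M0 \<epsilon> by (simp add: field_simps)
  have "approx_err d W n M \<le> \<epsilon>"
    unfolding approx_err_def
  proof (rule cSUP_least)
    obtain q0 where "is_Mdist M (seqs n :: 'x list set) q0" using Mdist_nonempty[OF M0] by blast
    then show "{p. is_dist (seqs n :: 'x list set) p} \<noteq> {}" by (auto simp: is_Mdist_def)
    fix p assume "p \<in> {p. is_dist (seqs n :: 'x list set) p}"
    then have "is_dist (seqs n) p" by simp
    from Mdist_approx[OF this finite_seqs M0] obtain q where q: "is_Mdist M (seqs n) q"
      "(\<Sum>x\<in>seqs n. \<bar>p x - q x\<bar>) \<le> 2 * card (seqs n :: 'x list set) / M" by blast
    have "(INF q\<in>{q. is_Mdist M (seqs n) q}. trace_norm (tpow_mix d W n p - tpow_mix d W n q) / 2)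
      \<le> trace_norm (tpow_mix d W n p - tpow_mix d W n q) / 2"
      using approx_err_INF(1)[OF Wd M0] q by (intro cINF_lower) auto
    also have "\<dots> \<le> real (d ^ n) * real (d ^ n) * (\<Sum>x\<in>seqs n. \<bar>p x - q x\<bar>) / 2"
      using tpow_mix_trace_norm_le[OF Wd] by (intro divide_right_mono) auto
    also have "\<dots> \<le> real (d ^ n) * real (d ^ n) * (2 * card (seqs n :: 'x list set) / M) / 2"
      using q by (intro divide_right_mono mult_left_mono) auto
    also have "\<dots> = B / M" by (simp add: B_def)
    finally show "(INF q\<in>{q. is_Mdist M (seqs n) q}. trace_norm (tpow_mix d W n p - tpow_mix d W n q) / 2) \<le> \<epsilon>"
      using BM by linarith
  qed
  then have "0 < M_eps d W \<epsilon> n \<and> approx_err d W n (M_eps d W \<epsilon> n) \<le> \<epsilon>"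
    unfolding M_eps_def using M0 by (intro LeastI[of "\<lambda>M. 0 < M \<and> approx_err d W n M \<le> \<epsilon>" M]) auto
  then show "0 < M_eps d W \<epsilon> n" "approx_err d W n (M_eps d W \<epsilon> n) \<le> \<epsilon>" by auto
qed

section \<open>Counting the types that approximate the distributions of a code\<close>

lemma trp_density_le_1:
  fixes W :: "'x::finite \<Rightarrow> complex mat"
  assumes Wd: "\<And>x. density d (W x)" and x: "x \<in> seqs n" and T: "effect (d ^ n) T"
  shows "Re (trp (d ^ n) (\<lambda>i j. tpow W x $$ (i,j)) T) \<le> 1"
proof -
  from tpow_density_spec[where W = W, OF Wd x] obtain l e where s: "spec (d ^ n) (tpow W x) l e"
    and l: "\<forall>i<d ^ n. 0 \<le> l i" "(\<Sum>i<d ^ n. l i) = 1" by blast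
  have "trp (d ^ n) (\<lambda>i j. tpow W x $$ (i,j)) T = trp (d ^ n) (osum (d ^ n) l e) T"
    using specD[OF s] by (intro trp_cong) auto
  then have "Re (trp (d ^ n) (\<lambda>i j. tpow W x $$ (i,j)) T) = (\<Sum>i<d ^ n. l i * Re (cin (d ^ n) (e i) (ap (d ^ n) T (e i))))"
    by (simp add: trp_osum)
  also have "\<dots> \<le> (\<Sum>i<d ^ n. l i * nsq (d ^ n) (e i))"
    using T l by (intro sum_mono mult_left_mono) (auto simp: effect_def)
  also have "\<dots> = 1" using nsq_onb[OF spec_onb[OF s]] l by simp
  finally show ?thesis .
qed

lemma Re_sum_list_divide: "Re ((\<Sum>y\<leftarrow>ys. F y) / of_nat M) = (\<Sum>y\<leftarrow>ys. Re (F y)) / M"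
proof -
  have "Re (\<Sum>y\<leftarrow>ys. F y) = (\<Sum>y\<leftarrow>ys. Re (F y))" by (induction ys) auto
  then show ?thesis by (metis Re_divide_of_nat)
qed

lemma sum_list_swap:
  fixes F :: "'a \<Rightarrow> 'b \<Rightarrow> real"
  shows "(\<Sum>y\<leftarrow>ys. \<Sum>j\<in>B. F y j) = (\<Sum>j\<in>B. \<Sum>y\<leftarrow>ys. F y j)"
  by (induction ys) (auto simp: sum.distrib)

lemma sum_list_le_length:
  fixes F :: "'a \<Rightarrow> real"
  shows "(\<And>y. y \<in> set ys \<Longrightarrow> F y \<le> 1) \<Longrightarrow> (\<Sum>y\<leftarrow>ys. F y) \<le> length ys"
  by (induction ys) (auto simp: add_mono add.commute)

text \<open>Codeword (k, g) has index \<open>k * G + g\<close>. Every function f gives the uniform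
  input on the words (k, f k), and any type close to it must leave a trace on the graph of f in its
  decoded statistics; \<open>count_approximants\<close> then bounds the number of types
  below.\<close>

theorem resolvability_lower_bound:
  fixes W :: "'x::finite \<Rightarrow> complex mat" and K G M n :: nat
  assumes Wd: "\<And>x. density d (W x)"
    and u: "\<And>k. k < K * G \<Longrightarrow> u k \<in> seqs n"
    and E: "\<And>B. B \<subseteq> {..<K * G} \<Longrightarrow> effect (d ^ n) (\<lambda>i l. \<Sum>k\<in>B. E k i l)"
    and E0: "\<And>k x. k < K * G \<Longrightarrow> x \<in> seqs n \<Longrightarrow> 0 \<le> Re (trp (d ^ n) (\<lambda>i j. tpow W x $$ (i,j)) (E k))"
    and E1: "\<And>k. k < K * G \<Longrightarrow> 1 - \<theta> \<le> Re (trp (d ^ n) (\<lambda>i j. tpow W (u k) $$ (i,j)) (E k))"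
    and \<theta>: "0 \<le> \<theta>" and c: "c = 1 - \<epsilon>' - \<theta>" "c > 0" and G: "exp (2 / c) \<le> G" and K: "K > 0"
    and M: "M > 0" and err: "approx_err d W n M \<le> \<epsilon>" and \<epsilon>: "\<epsilon> < \<epsilon>'"
  shows "exp (real K) \<le> (CARD('x) ^ n) ^ M"
proof -
  define D where "D = d ^ n"
  define t where "t = (\<lambda>x j. Re (trp D (\<lambda>i j. tpow W x $$ (i,j)) (E j)))"
  define Y where "Y = {ys. set ys \<subseteq> (seqs n :: 'x list set) \<and> length ys = M}"
  define Q where "Q = (\<lambda>ys j. (\<Sum>y\<leftarrow>ys. t y j) / M)"
  \<comment> \<open>\<open>Q ys\<close> is the distribution of the decoded index. Scaling by K makes
    the value 1 typical on the right graph, and clipping gives values in [0,1], so that one heavily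
    weighted index cannot stand in for many.\<close>
  define h where "h = (\<lambda>ys k g. min (K * Q ys (k * G + g)) 1)"
  have idx: "k * G + g < K * G" if "k < K" "g < G" for k g
  proof -
    have "k * G + g < Suc k * G" using that by simp
    also have "\<dots> \<le> K * G" using that by (intro mult_le_mono1) simp
    finally show ?thesis .
  qed
  have finY: "finite Y" unfolding Y_def by (rule finite_lists_length_eq) simp
  have cardY: "card Y = (CARD('x) ^ n) ^ M" unfolding Y_def by (simp add: card_lists_length_eq card_seqs)
  have t0: "0 \<le> t x j" if "x \<in> seqs n" "j < K * G" for x j using E0[OF that(2,1)] by (simp add: t_def D_def)
  have tB: "Re (trp D (\<lambda>i j. tpow W x $$ (i,j)) (\<lambda>i l. \<Sum>k\<in>B. E k i l)) = (\<Sum>j\<in>B. t x j)" for x B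
    by (simp add: trp_sum_right t_def)
  have Q0: "0 \<le> Q ys j" if "ys \<in> Y" "j < K * G" for ys j
    unfolding Q_def using that t0 by (intro divide_nonneg_nonneg sum_list_nonneg) (auto simp: Y_def)
  have Qsum: "(\<Sum>j<K * G. Q ys j) \<le> 1" if ys: "ys \<in> Y" for ys
  proof -
    have "(\<Sum>j<K * G. Q ys j) = (\<Sum>y\<leftarrow>ys. \<Sum>j<K * G. t y j) / M"
      unfolding Q_def sum_list_swap sum_divide_distrib ..
    also have "(\<Sum>y\<leftarrow>ys. \<Sum>j<K * G. t y j) \<le> length ys"
    proof (rule sum_list_le_length)
      fix y assume "y \<in> set ys"
      then have y: "y \<in> seqs n" using ys by (auto simp: Y_def)
      show "(\<Sum>j<K * G. t y j) \<le> 1"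
        unfolding tB[symmetric] D_def by (rule trp_density_le_1[where W = W, OF Wd y E]) simp
    qed
    then have "(\<Sum>y\<leftarrow>ys. \<Sum>j<K * G. t y j) / M \<le> length ys / M" by (rule divide_right_mono) simp
    also have "length ys / M = 1" using ys M by (simp add: Y_def)
    finally show ?thesis by simp
  qed
  have "exp (real K) \<le> card Y"
  proof (rule count_approximants[where h = h, OF finY _ _ _ c(2) G])
    show "0 \<le> h ys k g" if "ys \<in> Y" "k < K" "g < G" for ys k g
      unfolding h_def using Q0[OF that(1) idx[OF that(2,3)]] by simp
    show "h ys k g \<le> 1" for ys k g by (simp add: h_def)
    show "(\<Sum>k<K. \<Sum>g<G. h ys k g) \<le> K" if ys: "ys \<in> Y" for ys
    proof -
      have "(\<Sum>k<K. \<Sum>g<G. h ys k g) \<le> (\<Sum>k<K. \<Sum>g<G. K * Q ys (k * G + g))"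
        by (intro sum_mono) (simp add: h_def)
      also have "\<dots> = (\<Sum>j<K * G. K * Q ys (j div G * G + j mod G))"
        by (rule sum_div_mod[symmetric, where f = "\<lambda>k g. K * Q ys (k * G + g)"])
      also have "\<dots> = K * (\<Sum>j<K * G. Q ys j)" by (simp add: sum_distrib_left)
      also have "\<dots> \<le> real K * 1" using Qsum[OF ys] by (intro mult_left_mono) auto
      finally show ?thesis by simp
    qed
    fix f assume f: "f \<in> PiE {..<K} (\<lambda>_. {..<G})"
    define v where "v = (\<lambda>k. k * G + f k)"
    have fG: "f k < G" if "k < K" for k using f that by (auto simp: PiE_def Pi_def)
    have vK: "v k < K * G" if "k < K" for k unfolding v_def by (rule idx[OF that fG[OF that]])
    have v_div: "v k div G = k" if "k < K" for k unfolding v_def using fG[OF that] by simp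
    have v_inj: "inj_on v {..<K}" by (rule inj_on_inverseI[where g = "\<lambda>j. j div G"]) (simp add: v_div)
    \<comment> \<open>Mass is counted with multiplicity, as \<open>u\<close> may repeat
      words.\<close>
    define p where "p = (\<lambda>x. (\<Sum>k<K. if u (v k) = x then 1 else 0) / K :: real)"
    have p_sum: "(\<Sum>x\<in>seqs n. p x * F x) = (\<Sum>k<K. F (u (v k))) / K" for F :: "'x list \<Rightarrow> real"
    proof -
      have "(\<Sum>x\<in>seqs n. p x * F x) = (\<Sum>x\<in>seqs n. \<Sum>k<K. if u (v k) = x then F (u (v k)) / K else 0)"
        unfolding p_def sum_divide_distrib sum_distrib_right by (intro sum.cong refl) auto
      also have "\<dots> = (\<Sum>k<K. \<Sum>x\<in>seqs n. if u (v k) = x then F (u (v k)) / K else 0)" by (rule sum.swap)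
      also have "\<dots> = (\<Sum>k<K. F (u (v k)) / K)" using u vK by (intro sum.cong refl) simp
      finally show ?thesis by (simp add: sum_divide_distrib)
    qed
    have p: "is_dist (seqs n) p"
    proof -
      have "(\<Sum>x\<in>seqs n. p x) = 1" using p_sum[of "\<lambda>_. 1"] K by simp
      moreover have "0 \<le> p x" for x unfolding p_def by (intro divide_nonneg_nonneg sum_nonneg) auto
      ultimately show ?thesis by (simp add: is_dist_def)
    qed
    from approx_err_le_imp[where W = W, OF Wd M err \<epsilon> p] obtain q where q: "is_Mdist M (seqs n) q"
      "trace_norm (tpow_mix d W n p - tpow_mix d W n q) / 2 < \<epsilon>'" by blast
    from Mdist_list[OF q(1) finite_seqs M] obtain ys where ys: "length ys = M" "set ys \<subseteq> seqs n"
      "\<And>F :: _ \<Rightarrow> complex. (\<Sum>x\<in>seqs n. of_real (q x) * F x) = (\<Sum>y\<leftarrow>ys. F y) / of_nat M" by blast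
    have ysY: "ys \<in> Y" using ys by (simp add: Y_def)
    define B where "B = {k. k < K \<and> K * Q ys (v k) < 1}"
    have B: "finite B" "B \<subseteq> {..<K}" by (auto simp: B_def)
    have vB: "v ` B \<subseteq> {..<K * G}" using vK by (auto simp: B_def)
    have injB: "inj_on v B" by (rule inj_on_subset[OF v_inj B(2)])
    let ?T = "\<lambda>i l. \<Sum>k\<in>v ` B. E k i l"
    have "Re (\<Sum>x\<in>seqs n. of_real (p x) * trp D (\<lambda>i j. tpow W x $$ (i,j)) ?T)
       - Re (\<Sum>x\<in>seqs n. of_real (q x) * trp D (\<lambda>i j. tpow W x $$ (i,j)) ?T) \<le> \<epsilon>'"
      using tpow_mix_test_le[where W = W, OF Wd p _ E[OF vB], of q] q unfolding D_def by (simp add: is_Mdist_def)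
    moreover have "Re (\<Sum>x\<in>seqs n. of_real (p x) * trp D (\<lambda>i j. tpow W x $$ (i,j)) ?T) \<ge> card B * (1 - \<theta>) / K"
    proof -
      have "Re (\<Sum>x\<in>seqs n. of_real (p x) * trp D (\<lambda>i j. tpow W x $$ (i,j)) ?T) = (\<Sum>k<K. \<Sum>j\<in>v ` B. t (u (v k)) j) / K"
        unfolding tB[symmetric] p_sum[of "\<lambda>x. Re (trp D (\<lambda>i j. tpow W x $$ (i,j)) ?T)", symmetric] by simp
      moreover have "card B * (1 - \<theta>) \<le> (\<Sum>k<K. \<Sum>j\<in>v ` B. t (u (v k)) j)"
      proof -
        have "card B * (1 - \<theta>) = (\<Sum>k\<in>B. 1 - \<theta>)" by simp
        also have "\<dots> \<le> (\<Sum>k\<in>B. \<Sum>j\<in>v ` B. t (u (v k)) j)"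
        proof (rule sum_mono)
          fix k assume k: "k \<in> B"
          then have kK: "k < K" using B by auto
          have "1 - \<theta> \<le> t (u (v k)) (v k)" using E1[OF vK[OF kK]] by (simp add: t_def D_def)
          also have "\<dots> \<le> (\<Sum>j\<in>v ` B. t (u (v k)) j)"
            using k B vB t0 u[OF vK[OF kK]] by (intro member_le_sum) auto
          finally show "1 - \<theta> \<le> (\<Sum>j\<in>v ` B. t (u (v k)) j)" .
        qed
        also have "\<dots> \<le> (\<Sum>k<K. \<Sum>j\<in>v ` B. t (u (v k)) j)"
          using B vB t0 u vK by (intro sum_mono2 sum_nonneg) auto
        finally show ?thesis .
      qed
      ultimately show ?thesis by (simp add: divide_right_mono)
    qed
    moreover have "Re (\<Sum>x\<in>seqs n. of_real (q x) * trp D (\<lambda>i j. tpow W x $$ (i,j)) ?T) = (\<Sum>k\<in>B. Q ys (v k))"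
      unfolding ys(3) Re_sum_list_divide tB sum_list_swap sum_divide_distrib
      by (simp add: Q_def sum.reindex[OF injB])
    ultimately have "card B * (1 - \<theta>) / K - \<epsilon>' \<le> (\<Sum>k\<in>B. Q ys (v k))" by linarith
    then have "K * (card B * (1 - \<theta>) / K - \<epsilon>') \<le> K * (\<Sum>k\<in>B. Q ys (v k))" by (rule mult_left_mono) simp
    moreover have "K * (card B * (1 - \<theta>) / K - \<epsilon>') = card B * (1 - \<theta>) - K * \<epsilon>'"
      using K by (simp add: field_simps)
    ultimately have "card B * (1 - \<theta>) - K * \<epsilon>' \<le> (\<Sum>k\<in>B. K * Q ys (v k))"
      by (simp only: sum_distrib_left)
    moreover have "(\<Sum>k<K. h ys k (f k)) = (\<Sum>k\<in>B. K * Q ys (v k)) + (\<Sum>k\<in>{..<K} - B. 1)"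
    proof -
      have "(\<Sum>k<K. h ys k (f k)) = (\<Sum>k\<in>{..<K} - B. h ys k (f k)) + (\<Sum>k\<in>B. h ys k (f k))"
        using B by (intro sum.subset_diff) auto
      also have "(\<Sum>k\<in>{..<K} - B. h ys k (f k)) = (\<Sum>k\<in>{..<K} - B. 1)"
        by (intro sum.cong refl) (auto simp: h_def v_def B_def min_def)
      also have "(\<Sum>k\<in>B. h ys k (f k)) = (\<Sum>k\<in>B. K * Q ys (v k))"
        by (intro sum.cong refl) (auto simp: h_def v_def B_def min_def)
      finally show ?thesis by simp
    qed
    moreover have "(\<Sum>k\<in>{..<K} - B. 1::real) = K - real (card B)"
      using B card_mono[OF _ B(2)] by (simp add: card_Diff_subset of_nat_diff)
    moreover have "card B * \<theta> \<le> K * \<theta>" using card_mono[OF _ B(2)] \<theta> by (intro mult_right_mono) auto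
    ultimately have "c * K \<le> (\<Sum>k<K. h ys k (f k))" unfolding c(1) by (simp add: algebra_simps)
    then show "\<exists>ys\<in>Y. c * K \<le> (\<Sum>k<K. h ys k (f k))" using ysY by blast
  qed
  then show ?thesis by (simp add: cardY)
qed

theorem holevo_cap_le_R_eps:
  fixes W :: "'x::finite \<Rightarrow> complex mat"
  assumes Wd: "\<And>x. density d (W x)" and \<epsilon>: "0 < \<epsilon>" "\<epsilon> < 1"
  shows "holevo_cap d W \<le> R_eps d W \<epsilon>"
  unfolding holevo_cap_def
proof (rule SUP_least)
  fix p assume "p \<in> {p. is_dist (UNIV :: 'x set) p}"
  then have p: "is_dist UNIV p" by simp
  define I where "I = mutual_info d W p"
  define Mn where "Mn = M_eps d W \<epsilon>"
  have Mn: "0 < Mn n" "approx_err d W n (Mn n) \<le> \<epsilon>" for n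
    unfolding Mn_def using M_eps_properties[where W = W, OF Wd \<epsilon>(1)] by auto
  obtain a e where W: "\<And>x. spec d (W x) (a x) (e x)"
    and a: "\<And>x i. i < d \<Longrightarrow> 0 \<le> a x i" "\<And>x. (\<Sum>i<d. a x i) = 1"
    using density_spec_family[where W = W, OF Wd] by blast
  have rd: "density d (mix d UNIV W p)" by (rule mix_density[OF Wd p])
  from density_spec_exists[OF rd] obtain b f where r: "spec d (mix d UNIV W p) b f" by blast
  note b = density_spec[OF rd r]
  have "ereal (I - \<delta>) \<le> R_eps d W \<epsilon>" if "\<delta> > 0" for \<delta>
  proof (cases "I - \<delta> / 2 \<le> 0")
    case True
    \<comment> \<open>A nonpositive target is met because all rates are nonnegative; the main case
      may assume a positive exponent \<open>r0\<close>.\<close>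
    have nn: "0 \<le> log 2 (real (Mn n)) / real n" for n using Mn(1)[of n] by simp
    have "I - \<delta> \<le> 0" using True that by linarith
    then have "ereal (I - \<delta>) \<le> ereal (log 2 (real (Mn n)) / real n)" for n
      unfolding ereal_less_eq by (rule order_trans[OF _ nn])
    then show ?thesis unfolding R_eps_def Mn_def[symmetric] by (intro Liminf_bounded always_eventually) auto
  next
    case False
    \<comment> \<open>Three steps of size \<gamma> are spent: one in the moment bound, one between
      \<mu> and the exponent of \<open>L\<close>, one between that and the exponent of
      \<open>K\<close>. They cost \<delta> / 2 bits, and the other half absorbs the term of order
      log n / n.\<close>
    define \<gamma> where "\<gamma> = \<delta> * ln 2 / 6"
    have \<gamma>: "\<gamma> > 0" using that by (simp add: \<gamma>_def)
    define \<mu> where "\<mu> = I * ln 2 - \<gamma>"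
    define r0 where "r0 = \<mu> - 2 * \<gamma>"
    have r0: "r0 = (I - \<delta> / 2) * ln 2" by (simp add: r0_def \<mu>_def \<gamma>_def algebra_simps)
    then have r0_pos: "r0 > 0" using False by simp
    have "\<exists>s>0. (\<Sum>x\<in>UNIV. p x * ns d (a x) (e x) b f (\<lambda>u v. (v / u) powr s)) \<le> exp (- s * \<mu>)"
    proof (rule ns_exp_bound_down[OF p spec_onb[OF W] spec_onb[OF r]])
      show "\<mu> < (\<Sum>x\<in>UNIV. p x * ns d (a x) (e x) b f (\<lambda>u v. ln u - ln v))"
        unfolding mutual_info_ns[OF W r, symmetric] \<mu>_def I_def using \<gamma> by simp
      show "p x * (a x i * (cmod (cin d (f k) (e x i)))\<^sup>2) = 0" if "i < d" "k < d" "b k = 0" for x i k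
        by (rule mix_support[OF W _ p r that(2,3,1)]) (rule a(1))
    qed (use a b in auto)
    then obtain s where s: "s > 0" "(\<Sum>x\<in>UNIV. p x * ns d (a x) (e x) b f (\<lambda>u v. (v / u) powr s)) \<le> exp (- s * \<mu>)"
      by blast
    \<comment> \<open>The room above \<epsilon> is halved for the relaxed accuracy, and what is left
      below 1 is halved again into the decoding error \<theta> and \<open>c\<close>; both are
      constant in \<open>n\<close>, and so is G.\<close>
    define \<epsilon>' where "\<epsilon>' = (1 + \<epsilon>) / 2"
    define \<theta> where "\<theta> = (1 - \<epsilon>') / 2"
    define c where "c = 1 - \<epsilon>' - \<theta>"
    have \<epsilon>': "\<epsilon> < \<epsilon>'" "\<epsilon>' < 1" using \<epsilon> by (auto simp: \<epsilon>'_def)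
    have c: "c > 0" "\<theta> > 0" using \<epsilon>' by (auto simp: c_def \<theta>_def field_simps)
    define G where "G = nat \<lceil>exp (2 / c)\<rceil>"
    have G: "exp (2 / c) \<le> G" unfolding G_def by linarith
    define K where "K = (\<lambda>n::nat. nat \<lfloor>exp (n * r0)\<rfloor>)"
    have K_le: "K n \<le> exp (n * r0)" for n unfolding K_def by (simp add: of_nat_floor)
    have K_ge: "exp (n * r0) / 2 \<le> K n" and K0: "K n > 0" for n
    proof -
      \<comment> \<open>A number that is at least 1 loses at most half of itself when rounded
        down.\<close>
      have "1 \<le> exp (n * r0)" using r0_pos by simp
      then have f1: "1 \<le> \<lfloor>exp (n * r0)\<rfloor>" by (simp add: le_floor_iff)
      have f2: "real (K n) = real_of_int \<lfloor>exp (n * r0)\<rfloor>" unfolding K_def using f1 by simp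
      have f3: "1 \<le> real_of_int \<lfloor>exp (n * r0)\<rfloor>" using f1 by linarith
      have f4: "exp (n * r0) < real_of_int \<lfloor>exp (n * r0)\<rfloor> + 1" by linarith
      show "exp (n * r0) / 2 \<le> K n" using f2 f3 f4 by linarith
      show "K n > 0" using f2 f3 by linarith
    qed
    define err where "err = (\<lambda>n::nat. 4 * (G * exp (- (n * \<gamma>)) + exp (- (n * (s * \<gamma>)))))"
    have "err \<longlonglongrightarrow> 4 * (real G * 0 + 0)"
      unfolding err_def using s(1) \<gamma> by (intro tendsto_intros exp_decay) auto
    then have ev1: "\<forall>\<^sub>F n in sequentially. err n < \<theta>" using c(2) by (intro order_tendstoD(2)) auto
    define Z where "Z = (\<lambda>n::nat. r0 / ln 2 - log 2 (real n * (2 * real CARD('x))) / n)"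
    have "Z \<longlonglongrightarrow> r0 / ln 2 - 0" unfolding Z_def by (intro tendsto_intros log_rate) simp
    moreover have "r0 / ln 2 - 0 > I - \<delta>" using that by (simp add: r0)
    ultimately have ev2: "\<forall>\<^sub>F n in sequentially. I - \<delta> < Z n" by (rule order_tendstoD(1))
    have "\<forall>\<^sub>F n in sequentially. ereal (I - \<delta>) \<le> ereal (log 2 (real (Mn n)) / real n)"
      using ev1 ev2 eventually_gt_at_top[of 0]
    proof eventually_elim
      case (elim n)
      define L where "L = exp (n * (\<mu> - \<gamma>))"
      have L: "L > 0" by (simp add: L_def)
      have bound: "4 * (real (K n * G) / L + L powr s * exp (- (n * (s * \<mu>)))) \<le> \<theta>"
      proof -
        have "real (K n * G) / L \<le> exp (n * r0) * G / L"
          using K_le[of n] L by (intro divide_right_mono) (auto intro: mult_right_mono)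
        also have "\<dots> = G * (exp (n * r0) / exp (n * (\<mu> - \<gamma>)))" by (simp add: L_def)
        also have "exp (n * r0) / exp (n * (\<mu> - \<gamma>)) = exp (n * r0 - n * (\<mu> - \<gamma>))" by (rule exp_diff[symmetric])
        also have "n * r0 - n * (\<mu> - \<gamma>) = - (n * \<gamma>)" by (simp add: r0_def algebra_simps)
        finally have 1: "real (K n * G) / L \<le> G * exp (- (n * \<gamma>))" .
        have 2: "L powr s * exp (- (n * (s * \<mu>))) = exp (- (n * (s * \<gamma>)))"
          by (simp add: L_def powr_def exp_add[symmetric] algebra_simps)
        show ?thesis using 1 elim(1) unfolding 2 err_def by simp
      qed
      have "\<exists>u E. (\<forall>k<K n * G. u k \<in> seqs n) \<and> (\<forall>B\<subseteq>{..<K n * G}. effect (d ^ n) (\<lambda>i l. \<Sum>k\<in>B. E k i l)) \<and>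
        (\<forall>k<K n * G. \<forall>x\<in>seqs n. 0 \<le> Re (trp (d ^ n) (\<lambda>i j. tpow W x $$ (i,j)) (E k))) \<and>
        (\<forall>k<K n * G. 1 - 4 * (real (K n * G) / L + L powr s * exp (- (n * (s * \<mu>))))
           \<le> Re (trp (d ^ n) (\<lambda>i j. tpow W (u k) $$ (i,j)) (E k)))"
        by (rule block_code[OF Wd W p r _ s L]) (rule b(1))
      then obtain u E where uE: "\<And>k. k < K n * G \<Longrightarrow> u k \<in> seqs n"
        "\<And>B. B \<subseteq> {..<K n * G} \<Longrightarrow> effect (d ^ n) (\<lambda>i l. \<Sum>k\<in>B. E k i l)"
        "\<And>k x. k < K n * G \<Longrightarrow> x \<in> seqs n \<Longrightarrow> 0 \<le> Re (trp (d ^ n) (\<lambda>i j. tpow W x $$ (i,j)) (E k))"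
        "\<And>k. k < K n * G \<Longrightarrow> 1 - 4 * (real (K n * G) / L + L powr s * exp (- (n * (s * \<mu>))))
          \<le> Re (trp (d ^ n) (\<lambda>i j. tpow W (u k) $$ (i,j)) (E k))"
        by blast
      have "exp (real (K n)) \<le> (CARD('x) ^ n) ^ Mn n"
      proof (rule resolvability_lower_bound[where W = W and u = u and E = E and \<theta> = \<theta> and \<epsilon> = \<epsilon> and \<epsilon>' = \<epsilon>' and c = c, OF Wd uE(1-3)])
        show "1 - \<theta> \<le> Re (trp (d ^ n) (\<lambda>i j. tpow W (u k) $$ (i,j)) (E k))" if "k < K n * G" for k
          using uE(4)[OF that] bound by linarith
      qed (use c c_def G K0 Mn \<epsilon>' in auto)
      then have "exp (real (K n)) \<le> real CARD('x) ^ (n * Mn n)" by (simp add: power_mult)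
      also have "\<dots> \<le> exp (real CARD('x)) ^ (n * Mn n)"
      proof (rule power_mono)
        show "real CARD('x) \<le> exp (real CARD('x))" using exp_ge_add_one_self[of "real CARD('x)"] by linarith
      qed simp
      also have "\<dots> = exp (real (n * Mn n) * real CARD('x))" by (rule exp_of_nat_mult[symmetric])
      finally have "real (K n) \<le> n * Mn n * CARD('x)" by simp
      then have "exp (n * r0) / 2 \<le> n * Mn n * CARD('x)" using K_ge[of n] by linarith
      then have "exp (n * r0) \<le> real (Mn n) * (real n * (2 * real CARD('x)))" by (simp add: mult_ac)
      then have "ln (exp (n * r0)) \<le> ln (real (Mn n) * (real n * (2 * real CARD('x))))"
        by (subst ln_le_cancel_iff) (use Mn(1)[of n] elim(3) in auto)
      also have "\<dots> = ln (real (Mn n)) + ln (real n * (2 * real CARD('x)))"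
        using Mn(1)[of n] elim(3) by (intro ln_mult_pos) auto
      finally have "n * r0 - ln (real n * (2 * real CARD('x))) \<le> ln (real (Mn n))" by simp
      then have "(n * r0 - ln (real n * (2 * real CARD('x)))) / ln 2 / n \<le> ln (real (Mn n)) / ln 2 / n"
        by (intro divide_right_mono) auto
      moreover have "(n * r0 - ln (real n * (2 * real CARD('x)))) / ln 2 / n = Z n"
        using elim(3) by (simp add: Z_def log_def diff_divide_distrib)
      ultimately have "Z n \<le> log 2 (real (Mn n)) / n" by (simp add: log_def)
      then show ?case using elim(2) by simp
    qed
    then show ?thesis unfolding R_eps_def Mn_def[symmetric] by (intro Liminf_bounded) auto
  qed
  then have "ereal I \<le> R_eps d W \<epsilon> + ereal \<delta>" if "\<delta> > 0" for \<delta>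
    using that by (cases "R_eps d W \<epsilon>") (auto simp: algebra_simps)
  then show "ereal (mutual_info d W p) \<le> R_eps d W \<epsilon>"
    unfolding I_def[symmetric] using ereal_le_epsilon2[of "ereal I" "R_eps d W \<epsilon>"] by blast
qed

theorem theorem5:
  fixes W :: "'x::finite \<Rightarrow> complex mat" and d :: nat
    and lam1 lam2 \<epsilon> :: real
  assumes W: "\<forall>x. density d (W x)"
    and l1: "0 < lam1" "lam1 < 1" and l2: "0 < lam2" "lam2 < 1"
    and eps: "0 < \<epsilon>" "\<epsilon> < 1 - lam1 - lam2"
  shows "id_cap d W lam1 lam2 \<le> R_eps d W \<epsilon> \<and>
         (\<forall>\<epsilon>'. 0 < \<epsilon>' \<and> \<epsilon>' < 1 \<longrightarrow> holevo_cap d W \<le> R_eps d W \<epsilon>')"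
proof (intro conjI allI impI)
  have Wd: "density d (W x)" for x using W by simp
  show direct: "holevo_cap d W \<le> R_eps d W \<epsilon>'" if "0 < \<epsilon>' \<and> \<epsilon>' < 1" for \<epsilon>'
    using that by (intro holevo_cap_le_R_eps[OF Wd]) auto
  have "id_cap d W lam1 lam2 \<le> holevo_cap d W"
    using eps by (intro id_cap_le_holevo_cap[OF Wd]) linarith
  also have "\<dots> \<le> R_eps d W \<epsilon>" using eps l1 l2 by (intro direct) linarith
  finally show "id_cap d W lam1 lam2 \<le> R_eps d W \<epsilon>" .
qed

end
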